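(* Let $A\in\mathbb{R}_+^{n\times n}$. Then, both in max algebra and in nonnegative algebra, $$\operatorname{core}(A)=\sum_{k\geq 1,\ \rho\in\Lambda(A)} V(A^k,\rho^k)=V^{\Sigma}(A^{\sigma_{\Lambda}}).$$
   Context: The statement is asserted in each of two settings. Nonnegative algebra: the semiring $\mathbb{R}_+=[0,\infty)$ with usual addition and multiplication. Max algebra: $\mathbb{R}_+$ with addition $a\oplus b=\max(a,b)$ and usual multiplication. Sums, matrix products $Ax$, powers $A^k$ and spans are taken in the algebra considered (in max algebra $(A\otimes B)_{ij}=\max_k a_{ik}b_{kj}$ and $A^k$ is the $k$-th max-algebraic power). Cones: a cone is a subset of $\mathbb{R}_+^n$ closed under the addition of the algebra and under multiplication by scalars in $\mathbb{R}_+$. $\operatorname{span}(A)$ is the set of all combinations of the columns of $A$ with coefficients in $\mathbb{R}_+$. A (possibly infinite) sum of cones is the set of all finite sums of their elements (an empty sum is $\{0\}$). The core is $\operatorname{core}(A)=\bigcap_{i\ge 1}\operatorname{span}(A^i)$. Eigencones: $\rho\in\mathbb{R}_+$ is an eigenvalue of $A$ if $Ax=\rho x$ for some nonzero $x\in\mathbb{R}_+^n$; $V(A,\rho)=\{x\in\mathbb{R}_+^n: Ax=\rho x\}$; $\Lambda(A)$ is the set of nonzero eigenvalues; $V^{\Sigma}(A)=\sum_{\rho\in\Lambda(A)}V(A,\rho)$, equal to $\{0\}$ if $\Lambda(A)=\emptyset$. Classes: $\mathcal{G}(A)$ is the weighted digraph on $\{1,\dots,n\}$ with an edge $(i,j)$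 of weight $a_{ij}$ iff $a_{ij}\ne0$. The classes $\mu$ of $A$ correspond to the strongly connected components of $\mathcal{G}(A)$ (an isolated node without a loop counts as a component), with node sets $N_\mu$; $A_{\mu\mu}$ is the corresponding (irreducible) principal submatrix and its unique eigenvalue in the algebra considered is the Perron root $\rho_\mu$. Class $\mu$ accesses class $\nu$ ($\mu\to\nu$) if $\mu=\nu$ or there is a path in $\mathcal{G}(A)$ from a node of $\mu$ to a node of $\nu$; a node accesses $\nu$ if its class does. A class $\nu$ is spectral, associated with $\rho\neq0$ (or $(A,\rho)$-spectral), if $\rho_\nu=\rho$ and: in max algebra, $\mu\to\nu$ implies $\rho_\mu\le\rho_\nu$; in nonnegative algebra, $\mu\to\nu$, $\mu\ne\nu$ implies $\rho_\mu<\rho_\nu$. Cyclicity: the cyclicity of a strongly connected graph is the gcd of the lengths of its elementary cycles ($1$ for a single node without edges); for a graph with several strongly connected components it is the lcm of their cyclicities. The cyclicity of a class $\mu$ is that of $\mathcal{G}(A_{\mu\mu})$. Critical graph (max algebra only): for a matrix $B$, $\lambda(B)$ is the maximum over cycles $C$ of $\mathcal{G}(B)$ of $w(C)^{1/l(C)}$ ($w$ = product of edge weights, $l$ = length), and the critical graph $\mathcal{C}(B)$ consists of all nodes and edges on cycles attaining this maximum. For $\rho\in\Lambda(A)$ let $M_\rho$ be the set of indices accessing some $(A,\rho)$-spectral class, and let $A_\rho$ be the $n\times n$ matrix with entries $\rho^{-1}a_{ij}$ for $i,j\in M_\rho$ and $0$ otherwise. The critical graph associated with $\rho$ is $\mathcal{C}(A_\rho)$.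 Numbers $\sigma$: for $\rho\in\Lambda(A)$, $\sigma_\rho$ is, in nonnegative algebra, the lcm of the cyclicities of all spectral classes associated with $\rho$, and, in max algebra, the cyclicity of the critical graph associated with $\rho$. $\sigma_\Lambda$ is the lcm of all $\sigma_\rho$, $\rho\in\Lambda(A)$ (the empty lcm being $1$). *)

theory Defs
  imports
    "HOL-Analysis.Analysis"
    "Graph_Theory.Pair_Digraph"
    "Graph_Theory.Digraph_Component"
begin

datatype algebra_kind = Nonneg_Alg | Max_Alg

text \<open>
  Scalars are nonnegative reals, represented in \<^typ>\<open>real\<close>. Multiplication is the usual one in both
  algebras; only the addition depends on the algebra. The sum over the empty set is 0 in both.
\<close>

fun alg_add :: "algebra_kind \<Rightarrow> real \<Rightarrow> real \<Rightarrow> real" where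
  "alg_add Nonneg_Alg a b = a + b"
| "alg_add Max_Alg a b = max a b"

fun alg_sum :: "algebra_kind \<Rightarrow> ('i \<Rightarrow> real) \<Rightarrow> 'i set \<Rightarrow> real" where
  "alg_sum Nonneg_Alg f S = sum f S"
| "alg_sum Max_Alg f S = (if S = {} then 0 else Max (f ` S))"

definition nonneg_vec :: "real ^ 'n \<Rightarrow> bool" where
  "nonneg_vec x \<longleftrightarrow> (\<forall>i. 0 \<le> x $ i)"

definition nonneg_mat :: "real ^ 'n ^ 'm \<Rightarrow> bool" where
  "nonneg_mat A \<longleftrightarrow> (\<forall>i j. 0 \<le> A $ i $ j)"

definition vec_add :: "algebra_kind \<Rightarrow> real ^ 'n \<Rightarrow> real ^ 'n \<Rightarrow> real ^ 'n" where
  "vec_add alg x y = (\<chi> i. alg_add alg (x $ i) (y $ i))"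

definition mat_vec :: "algebra_kind \<Rightarrow> real ^ 'n ^ 'n \<Rightarrow> real ^ 'n \<Rightarrow> real ^ 'n" where
  "mat_vec alg A x = (\<chi> i. alg_sum alg (\<lambda>j. A $ i $ j * x $ j) UNIV)"

definition mat_mul :: "algebra_kind \<Rightarrow> real ^ 'n ^ 'n \<Rightarrow> real ^ 'n ^ 'n \<Rightarrow> real ^ 'n ^ 'n" where
  "mat_mul alg A B = (\<chi> i j. alg_sum alg (\<lambda>k. A $ i $ k * B $ k $ j) UNIV)"

text \<open>On nonnegative matrices \<^term>\<open>mat 1\<close> is the unit of matrix multiplication in both algebras.\<close>

primrec mat_pow :: "algebra_kind \<Rightarrow> real ^ 'n ^ 'n \<Rightarrow> nat \<Rightarrow> real ^ 'n ^ 'n" where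
  "mat_pow alg A 0 = mat 1"
| "mat_pow alg A (Suc k) = mat_mul alg A (mat_pow alg A k)"

lemma vec_add_Nonneg: "vec_add Nonneg_Alg x y = x + y"
  by (simp add: vec_add_def vec_eq_iff)

lemma mat_vec_Nonneg: "mat_vec Nonneg_Alg A x = A *v x"
  by (simp add: mat_vec_def matrix_vector_mult_def)

lemma mat_mul_Nonneg: "mat_mul Nonneg_Alg A B = A ** B"
  by (simp add: mat_mul_def matrix_matrix_mult_def)

definition mat_span :: "algebra_kind \<Rightarrow> real ^ 'n ^ 'n \<Rightarrow> (real ^ 'n) set" where
  "mat_span alg A =
     {y. \<exists>c. (\<forall>j. 0 \<le> c j) \<and> y = (\<chi> i. alg_sum alg (\<lambda>j. c j * column j A $ i) UNIV)}"

definition core :: "algebra_kind \<Rightarrow> real ^ 'n ^ 'n \<Rightarrow> (real ^ 'n) set" where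
  "core alg A = (\<Inter>i\<in>{1..}. mat_span alg (mat_pow alg A i))"

text \<open>All finite sums of elements of the cones; the empty list gives the zero vector.\<close>

definition cone_sum ::
    "algebra_kind \<Rightarrow> 'i set \<Rightarrow> ('i \<Rightarrow> (real ^ 'n) set) \<Rightarrow> (real ^ 'n) set" where
  "cone_sum alg I C = {foldr (vec_add alg) xs 0 | xs. set xs \<subseteq> (\<Union>i\<in>I. C i)}"

definition eigenvalue :: "algebra_kind \<Rightarrow> real ^ 'n ^ 'n \<Rightarrow> real \<Rightarrow> bool" where
  "eigenvalue alg A \<rho> \<longleftrightarrow>
     0 \<le> \<rho> \<and> (\<exists>x. nonneg_vec x \<and> x \<noteq> 0 \<and> mat_vec alg A x = \<rho> *\<^sub>R x)"

definition eigencone :: "algebra_kind \<Rightarrow> real ^ 'n ^ 'n \<Rightarrow> real \<Rightarrow> (real ^ 'n) set" where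
  "eigencone alg A \<rho> = {x. nonneg_vec x \<and> mat_vec alg A x = \<rho> *\<^sub>R x}"

definition Lambda :: "algebra_kind \<Rightarrow> real ^ 'n ^ 'n \<Rightarrow> real set" where
  "Lambda alg A = {\<rho>. eigenvalue alg A \<rho> \<and> \<rho> \<noteq> 0}"

definition eigencone_sum :: "algebra_kind \<Rightarrow> real ^ 'n ^ 'n \<Rightarrow> (real ^ 'n) set" where
  "eigencone_sum alg A = cone_sum alg (Lambda alg A) (eigencone alg A)"

definition mat_digraph_on :: "'n set \<Rightarrow> real ^ 'n ^ 'n \<Rightarrow> ('n, 'n \<times> 'n) pre_digraph" where
  "mat_digraph_on N A =
     with_proj \<lparr> pverts = N, parcs = {(i, j). i \<in> N \<and> j \<in> N \<and> A $ i $ j \<noteq> 0} \<rparr>"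

abbreviation mat_digraph :: "real ^ 'n ^ 'n \<Rightarrow> ('n, 'n \<times> 'n) pre_digraph" where
  "mat_digraph A \<equiv> mat_digraph_on UNIV A"

text \<open>A class is represented by its node set.\<close>

definition classes :: "real ^ 'n ^ 'n \<Rightarrow> 'n set set" where
  "classes A = pre_digraph.sccs_verts (mat_digraph A)"

definition class_accesses :: "real ^ 'n ^ 'n \<Rightarrow> 'n set \<Rightarrow> 'n set \<Rightarrow> bool" where
  "class_accesses A \<mu> \<nu> \<longleftrightarrow> \<mu> = \<nu> \<or> (\<exists>i\<in>\<mu>. \<exists>j\<in>\<nu>. i \<rightarrow>\<^sup>*\<^bsub>mat_digraph A\<^esub> j)"

text \<open>
  Eigenvalues of the principal submatrix with index set \<open>N\<close>; only the entries of \<open>x\<close> indexed by \<open>N\<close>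
  matter.
\<close>

definition submatrix_eigenvalue ::
    "algebra_kind \<Rightarrow> real ^ 'n ^ 'n \<Rightarrow> 'n set \<Rightarrow> real \<Rightarrow> bool" where
  "submatrix_eigenvalue alg A N \<rho> \<longleftrightarrow>
     0 \<le> \<rho> \<and> (\<exists>x :: 'n \<Rightarrow> real. (\<forall>i\<in>N. 0 \<le> x i) \<and> (\<exists>i\<in>N. x i \<noteq> 0) \<and>
       (\<forall>i\<in>N. alg_sum alg (\<lambda>j. A $ i $ j * x j) N = \<rho> * x i))"

definition perron_root :: "algebra_kind \<Rightarrow> real ^ 'n ^ 'n \<Rightarrow> 'n set \<Rightarrow> real" where
  "perron_root alg A \<mu> = (THE \<rho>. submatrix_eigenvalue alg A \<mu> \<rho>)"

fun spectral_class :: "algebra_kind \<Rightarrow> real ^ 'n ^ 'n \<Rightarrow> real \<Rightarrow> 'n set \<Rightarrow> bool" where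
  "spectral_class Nonneg_Alg A \<rho> \<nu> \<longleftrightarrow>
     \<nu> \<in> classes A \<and> \<rho> \<noteq> 0 \<and> perron_root Nonneg_Alg A \<nu> = \<rho> \<and>
     (\<forall>\<mu>\<in>classes A. class_accesses A \<mu> \<nu> \<and> \<mu> \<noteq> \<nu> \<longrightarrow>
        perron_root Nonneg_Alg A \<mu> < perron_root Nonneg_Alg A \<nu>)"
| "spectral_class Max_Alg A \<rho> \<nu> \<longleftrightarrow>
     \<nu> \<in> classes A \<and> \<rho> \<noteq> 0 \<and> perron_root Max_Alg A \<nu> = \<rho> \<and>
     (\<forall>\<mu>\<in>classes A. class_accesses A \<mu> \<nu> \<longrightarrow>
        perron_root Max_Alg A \<mu> \<le> perron_root Max_Alg A \<nu>)"

text \<open>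
  \<^const>\<open>pre_digraph.cycle\<close> is the notion of an elementary cycle (a loop being one of length 1).
  The only strongly connected digraphs without such a cycle are single nodes without edges; for
  these the set of lengths is empty and its \<^const>\<open>Gcd\<close> would be 0.
\<close>

definition scc_cyclicity :: "('a, 'b) pre_digraph \<Rightarrow> nat" where
  "scc_cyclicity H =
     (if \<exists>p. pre_digraph.cycle H p then Gcd {length p | p. pre_digraph.cycle H p} else 1)"

definition cyclicity :: "('a, 'b) pre_digraph \<Rightarrow> nat" where
  "cyclicity G = Lcm (scc_cyclicity ` pre_digraph.sccs G)"

text \<open>
  Cycles are nonempty closed walks here, not necessarily elementary. The set of their geometric
  means may be infinite, so its maximum is expressed by \<^const>\<open>Greatest\<close>.
\<close>

definition mat_cycle :: "real ^ 'n ^ 'n \<Rightarrow> ('n \<times> 'n) list \<Rightarrow> bool" where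
  "mat_cycle B p \<longleftrightarrow> p \<noteq> [] \<and> (\<exists>u. pre_digraph.awalk (mat_digraph B) u p u)"

definition cycle_mean :: "real ^ 'n ^ 'n \<Rightarrow> ('n \<times> 'n) list \<Rightarrow> real" where
  "cycle_mean B p = root (length p) (\<Prod>(i, j)\<leftarrow>p. B $ i $ j)"

definition max_cycle_mean :: "real ^ 'n ^ 'n \<Rightarrow> real" where
  "max_cycle_mean B = (GREATEST r. \<exists>p. mat_cycle B p \<and> r = cycle_mean B p)"

definition critical_edges :: "real ^ 'n ^ 'n \<Rightarrow> ('n \<times> 'n) set" where
  "critical_edges B = \<Union> {set p | p. mat_cycle B p \<and> cycle_mean B p = max_cycle_mean B}"

text \<open>Every node on a cycle is the tail of an edge of that cycle.\<close>

definition critical_graph :: "real ^ 'n ^ 'n \<Rightarrow> ('n, 'n \<times> 'n) pre_digraph" where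
  "critical_graph B = with_proj \<lparr> pverts = fst ` critical_edges B, parcs = critical_edges B \<rparr>"

definition access_set :: "real ^ 'n ^ 'n \<Rightarrow> real \<Rightarrow> 'n set" where
  "access_set A \<rho> =
     {i. \<exists>\<nu>. spectral_class Max_Alg A \<rho> \<nu> \<and> (\<exists>\<mu>\<in>classes A. i \<in> \<mu> \<and> class_accesses A \<mu> \<nu>)}"

definition access_matrix :: "real ^ 'n ^ 'n \<Rightarrow> real \<Rightarrow> real ^ 'n ^ 'n" where
  "access_matrix A \<rho> =
     (\<chi> i j. if i \<in> access_set A \<rho> \<and> j \<in> access_set A \<rho> then inverse \<rho> * A $ i $ j else 0)"

fun sigma_rho :: "algebra_kind \<Rightarrow> real ^ 'n ^ 'n \<Rightarrow> real \<Rightarrow> nat" where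
  "sigma_rho Nonneg_Alg A \<rho> =
     Lcm {cyclicity (mat_digraph_on \<nu> A) | \<nu>. spectral_class Nonneg_Alg A \<rho> \<nu>}"
| "sigma_rho Max_Alg A \<rho> = cyclicity (critical_graph (access_matrix A \<rho>))"

definition sigma_Lambda :: "algebra_kind \<Rightarrow> real ^ 'n ^ 'n \<Rightarrow> nat" where
  "sigma_Lambda alg A = Lcm (sigma_rho alg A ` Lambda alg A)"

end

theory Submission
  imports Defs
begin

text \<open>
  Write \<open>T\<close> for the map \<open>x \<mapsto> A x\<close>. An eigenvector \<open>T\<^sup>k x = \<rho>\<^sup>k x\<close> with \<open>\<rho> > 0\<close> lies in the range of every
  power of \<open>T\<close>, so the sum of the eigencones is contained in the core. Both equalities then follow
  from two facts: the core is generated by eigenvectors of powers of \<open>A\<close>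
  (\<open>core_eigen_generated\<close>), and such eigenvectors are already eigenvectors of the single power
  \<open>A\<^sup>\<sigma>\<close> with \<open>\<sigma> = \<sigma>\<^sub>\<Lambda>\<close> (\<open>eigencone_pow_period\<close>).

  The first fact is an argument of Pullman, which uses the semiring only through a few laws of its
  addition and therefore runs in both algebras at once. Every \<open>span (A\<^sup>i)\<close> is generated by \<open>n\<close> columns,
  which may be normalised; a limit point of these \<open>n\<close>-tuples generates the core
  (\<open>core_finitely_generated\<close>). Compactness also shows that \<open>T\<close> maps the core onto itself
  (\<open>core_surj\<close>). In an irredundant generating family every generator is extremal
  (\<open>irredundant_extremal\<close>), and since it is the image of an element of the core, it is a positive
  multiple of the image of a single generator. Thus \<open>T\<close> permutes the finitely many rays of
  generators, and a power of \<open>T\<close> fixes each of them.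

  For the second fact, an eigenvector of \<open>A\<^sup>k\<close> is the value at time \<open>0\<close> of a \<open>k\<close>-periodic orbit \<open>f\<close> with
  \<open>T (f t) = \<rho> f (t + 1)\<close>. The sum of the orbit is an eigenvector \<open>y\<close> of \<open>A\<close> with eigenvalue \<open>\<rho>\<close> and the same
  support as the orbit. On suitable strongly connected graphs the orbit satisfies
  \<open>f (t + 1) i = w i j \<cdot> f t j\<close> along every edge \<open>(i, j)\<close>, which makes the lengths of cycles, hence also
  their gcd, periods of \<open>f\<close> at all nodes of the component (\<open>cyclicity_period\<close>).

  In nonnegative algebra these graphs are the classes of the support of \<open>y\<close> that access no other class
  of the support. Comparison with \<open>y\<close> shows that their Perron root is \<open>\<rho>\<close> and that all other classes
  accessing them have smaller roots, so they are spectral; the edge relation, with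
  \<open>w i j = y i / y j\<close>, and the extension of the period to the remaining nodes both come from the maximum
  principle for the stochastic matrix \<open>a i j y j / (\<rho> y i)\<close>.

  In max algebra the graph is the critical graph of \<open>A\<^sub>\<rho>\<close>. Following back where the maxima are attained
  leads from any node of the support to a cycle of weight \<open>1\<close> in \<open>A\<^sub>\<rho>\<close>. Along critical edges the
  inequality \<open>f (t + 1) i \<ge> b i j \<cdot> f t j\<close> closes up around a cycle and, by periodicity, is an equality;
  the tight walk carries the period from the critical node to its origin.
\<close>

section \<open>Sums in the two algebras\<close>

lemma alg_add_commute: "alg_add alg a b = alg_add alg b a"
  by (cases alg) auto

lemma alg_add_assoc: "alg_add alg (alg_add alg a b) c = alg_add alg a (alg_add alg b c)"
  by (cases alg) auto

lemma alg_add_left_commute: "alg_add alg b (alg_add alg a c) = alg_add alg a (alg_add alg b c)"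
  by (cases alg) auto

lemmas alg_add_ac = alg_add_assoc alg_add_commute alg_add_left_commute

lemma alg_add_0 [simp]:
  assumes "0 \<le> a" shows "alg_add alg a 0 = a" "alg_add alg 0 a = a"
  using assms by (cases alg; simp)+

lemma alg_add_ge:
  assumes "0 \<le> a" "0 \<le> b" shows "a \<le> alg_add alg a b" "b \<le> alg_add alg a b"
  using assms by (cases alg; simp)+

lemma alg_add_nonneg: "0 \<le> a \<Longrightarrow> 0 \<le> b \<Longrightarrow> 0 \<le> alg_add alg a b"
  by (cases alg) auto

lemma alg_add_mono: "a \<le> a' \<Longrightarrow> b \<le> b' \<Longrightarrow> alg_add alg a b \<le> alg_add alg a' b'"
  by (cases alg) auto

lemma alg_add_distrib: "0 \<le> c \<Longrightarrow> c * alg_add alg a b = alg_add alg (c * a) (c * b)"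
  by (cases alg) (auto simp: algebra_simps max_mult_distrib_left)

lemma tendsto_alg_add:
  assumes "(f \<longlongrightarrow> a) F" "(g \<longlongrightarrow> b) F"
  shows "((\<lambda>x. alg_add alg (f x) (g x)) \<longlongrightarrow> alg_add alg a b) F"
  using assms by (cases alg) (auto intro: tendsto_add tendsto_max)

lemma alg_sum_empty [simp]: "alg_sum alg f {} = 0"
  by (cases alg) auto

text \<open>
  The common recursion for both kinds of sums. Nonnegativity makes \<open>0\<close> neutral for the maximum; all
  further properties of sums follow by induction on the index set, without distinguishing the algebras.
\<close>

lemma alg_sum_insert:
  assumes "finite S" "a \<notin> S" "0 \<le> f a" "\<And>i. i \<in> S \<Longrightarrow> 0 \<le> f i"
  shows "alg_sum alg f (insert a S) = alg_add alg (f a) (alg_sum alg f S)"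
  using assms by (cases alg) auto

lemma alg_sum_cong: "(\<And>i. i \<in> S \<Longrightarrow> f i = g i) \<Longrightarrow> alg_sum alg f S = alg_sum alg g S"
  by (cases alg) (auto intro!: sum.cong arg_cong[where f = Max])

lemma alg_sum_zero [simp]: "alg_sum alg (\<lambda>_. 0) S = 0"
  by (cases alg) (auto simp: image_constant_conv)

lemma alg_sum_nonneg:
  assumes "finite S" "\<And>i. i \<in> S \<Longrightarrow> 0 \<le> f i" shows "0 \<le> alg_sum alg f S"
  using assms by (induction S) (auto simp: alg_sum_insert intro: alg_add_nonneg)

lemma alg_sum_mono:
  assumes "finite S" "\<And>i. i \<in> S \<Longrightarrow> 0 \<le> f i" "\<And>i. i \<in> S \<Longrightarrow> f i \<le> g i"
  shows "alg_sum alg f S \<le> alg_sum alg g S"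
  using assms
proof (induction S)
  case (insert a S)
  have "0 \<le> g i" if "i \<in> insert a S" for i
    using insert.prems(1,2)[OF that] by linarith
  with insert show ?case by (simp add: alg_sum_insert alg_add_mono)
qed auto

lemma alg_sum_ge:
  assumes "finite S" "\<And>i. i \<in> S \<Longrightarrow> 0 \<le> f i" "i \<in> S" shows "f i \<le> alg_sum alg f S"
  using assms
proof (induction S)
  case (insert a S)
  show ?case
  proof (cases "i = a")
    case True
    with insert show ?thesis by (simp add: alg_sum_insert alg_sum_nonneg alg_add_ge)
  next
    case False
    with insert have "f i \<le> alg_sum alg f S" by auto
    also have "\<dots> \<le> alg_add alg (f a) (alg_sum alg f S)"
      using insert by (intro alg_add_ge) (auto intro: alg_sum_nonneg)
    finally show ?thesis using insert by (simp add: alg_sum_insert)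
  qed
qed auto

lemma alg_sum_distrib_left:
  assumes "finite S" "0 \<le> c" "\<And>i. i \<in> S \<Longrightarrow> 0 \<le> f i"
  shows "c * alg_sum alg f S = alg_sum alg (\<lambda>i. c * f i) S"
  using assms by (induction S) (auto simp: alg_sum_insert alg_add_distrib)

lemma alg_sum_add:
  assumes "finite S" "\<And>i. i \<in> S \<Longrightarrow> 0 \<le> f i" "\<And>i. i \<in> S \<Longrightarrow> 0 \<le> g i"
  shows "alg_sum alg (\<lambda>i. alg_add alg (f i) (g i)) S
         = alg_add alg (alg_sum alg f S) (alg_sum alg g S)"
  using assms by (induction S) (auto simp: alg_sum_insert alg_add_nonneg alg_add_ac)

lemma alg_sum_swap:
  assumes "finite S" "finite T" "\<And>i j. i \<in> S \<Longrightarrow> j \<in> T \<Longrightarrow> 0 \<le> f i j"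
  shows "alg_sum alg (\<lambda>i. alg_sum alg (f i) T) S = alg_sum alg (\<lambda>j. alg_sum alg (\<lambda>i. f i j) S) T"
  using assms
proof (induction S)
  case (insert a S)
  have "alg_sum alg (\<lambda>i. alg_sum alg (f i) T) (insert a S)
      = alg_add alg (alg_sum alg (f a) T) (alg_sum alg (\<lambda>i. alg_sum alg (f i) T) S)"
    using insert by (intro alg_sum_insert alg_sum_nonneg) auto
  also have "\<dots> = alg_sum alg (\<lambda>j. alg_add alg (f a j) (alg_sum alg (\<lambda>i. f i j) S)) T"
    using insert by (simp add: alg_sum_add alg_sum_nonneg)
  also have "\<dots> = alg_sum alg (\<lambda>j. alg_sum alg (\<lambda>i. f i j) (insert a S)) T"
    using insert by (intro alg_sum_cong) (simp add: alg_sum_insert)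
  finally show ?case .
qed auto

lemma alg_sum_mono_neutral:
  assumes "finite S" "T \<subseteq> S" "\<And>i. i \<in> S \<Longrightarrow> 0 \<le> f i" "\<And>i. i \<in> S - T \<Longrightarrow> f i = 0"
  shows "alg_sum alg f S = alg_sum alg f T"
  using assms
proof (induction S arbitrary: T)
  case (insert a S)
  show ?case
  proof (cases "a \<in> T")
    case True
    then have T: "T = insert a (T - {a})" by auto
    have "alg_sum alg f S = alg_sum alg f (T - {a})"
      using insert by (intro insert.IH) auto
    moreover have "alg_sum alg f T = alg_add alg (f a) (alg_sum alg f (T - {a}))"
      using insert.prems insert.hyps True finite_subset[OF insert.prems(1)]
      by (subst T, intro alg_sum_insert) auto
    ultimately show ?thesis using insert by (simp add: alg_sum_insert)
  next
    case False
    have "alg_sum alg f S = alg_sum alg f T" using insert False by (intro insert.IH) auto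
    moreover have "f a = 0" "0 \<le> alg_sum alg f S" using insert False by (auto intro: alg_sum_nonneg)
    ultimately show ?thesis using insert by (simp add: alg_sum_insert)
  qed
qed auto

lemma alg_sum_single:
  assumes "finite S" "j \<in> S" "0 \<le> f j" "\<And>i. i \<in> S \<Longrightarrow> i \<noteq> j \<Longrightarrow> f i = 0"
  shows "alg_sum alg f S = f j"
proof -
  have "alg_sum alg f S = alg_sum alg f {j}"
    using assms by (intro alg_sum_mono_neutral) force+
  also have "\<dots> = f j" using assms by (cases alg) auto
  finally show ?thesis .
qed

lemma alg_sum_pos_iff:
  assumes "finite S" "\<And>i. i \<in> S \<Longrightarrow> 0 \<le> f i"
  shows "0 < alg_sum alg f S \<longleftrightarrow> (\<exists>i\<in>S. 0 < f i)"
proof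
  assume pos: "0 < alg_sum alg f S"
  show "\<exists>i\<in>S. 0 < f i"
  proof (rule ccontr)
    assume "\<not> ?thesis"
    then have "f i = 0" if "i \<in> S" for i using assms that by force
    then have "alg_sum alg f S = alg_sum alg (\<lambda>_. 0) S" by (intro alg_sum_cong) auto
    with pos show False by simp
  qed
next
  assume "\<exists>i\<in>S. 0 < f i"
  then obtain i where i: "i \<in> S" "0 < f i" by blast
  have "f i \<le> alg_sum alg f S" using assms i(1) by (rule alg_sum_ge)
  with i(2) show "0 < alg_sum alg f S" by linarith
qed

lemma tendsto_alg_sum:
  assumes "finite S" "\<And>n i. i \<in> S \<Longrightarrow> 0 \<le> f n i" "\<And>i. i \<in> S \<Longrightarrow> (\<lambda>n. f n i) \<longlonglongrightarrow> l i"
  shows "(\<lambda>n. alg_sum alg (f n) S) \<longlonglongrightarrow> alg_sum alg l S"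
  using assms
proof (induction S)
  case (insert a S)
  have "0 \<le> l i" if "i \<in> insert a S" for i
    using LIMSEQ_le_const[OF insert.prems(2)[OF that]] insert.prems(1)[OF that] by blast
  with insert show ?case by (simp add: alg_sum_insert tendsto_alg_add)
qed auto

section \<open>Nonnegative vectors and matrices\<close>

lemma nonneg_vecD: "nonneg_vec x \<Longrightarrow> 0 \<le> x $ i"
  by (simp add: nonneg_vec_def)

lemma nonneg_matD: "nonneg_mat A \<Longrightarrow> 0 \<le> A $ i $ j"
  by (simp add: nonneg_mat_def)

lemma mat_vec_nth: "mat_vec alg A x $ i = alg_sum alg (\<lambda>j. A $ i $ j * x $ j) UNIV"
  by (simp add: mat_vec_def)

lemma nonneg_mat_vec: "nonneg_mat A \<Longrightarrow> nonneg_vec x \<Longrightarrow> nonneg_vec (mat_vec alg A x)"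
  by (auto simp: nonneg_vec_def nonneg_mat_def mat_vec_nth intro: alg_sum_nonneg)

lemma mat_vec_ge:
  assumes "nonneg_mat A" "nonneg_vec x" shows "A $ i $ j * x $ j \<le> mat_vec alg A x $ i"
  unfolding mat_vec_nth using assms
  by (intro alg_sum_ge[where f = "\<lambda>j. A $ i $ j * x $ j"]) (auto simp: nonneg_vec_def nonneg_mat_def)

lemma mat_vec_scale:
  assumes "nonneg_mat A" "nonneg_vec x" "0 \<le> c"
  shows "mat_vec alg A (c *\<^sub>R x) = c *\<^sub>R mat_vec alg A x"
  using assms by (simp add: vec_eq_iff mat_vec_nth alg_sum_distrib_left nonneg_matD nonneg_vecD mult.left_commute)

lemma mat_vec_add:
  assumes "nonneg_mat A" "nonneg_vec x" "nonneg_vec y"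
  shows "mat_vec alg A (vec_add alg x y) = vec_add alg (mat_vec alg A x) (mat_vec alg A y)"
  using assms
  by (simp add: vec_eq_iff mat_vec_nth vec_add_def alg_add_distrib nonneg_matD nonneg_vecD
      flip: alg_sum_add)

lemma nonneg_vec_add: "nonneg_vec x \<Longrightarrow> nonneg_vec y \<Longrightarrow> nonneg_vec (vec_add alg x y)"
  by (simp add: nonneg_vec_def vec_add_def alg_add_nonneg)

lemma nonneg_vec_scale: "nonneg_vec x \<Longrightarrow> 0 \<le> c \<Longrightarrow> nonneg_vec (c *\<^sub>R x)"
  by (simp add: nonneg_vec_def)

lemma nonneg_vec_0 [simp]: "nonneg_vec 0"
  by (simp add: nonneg_vec_def)

lemma mat_vec_0 [simp]: "mat_vec alg A 0 = 0"
  by (simp add: vec_eq_iff mat_vec_nth)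

definition alg_comb :: "algebra_kind \<Rightarrow> 'j set \<Rightarrow> ('j \<Rightarrow> real) \<Rightarrow> ('j \<Rightarrow> real ^ 'n) \<Rightarrow> real ^ 'n" where
  "alg_comb alg J c g = (\<chi> i. alg_sum alg (\<lambda>j. c j * g j $ i) J)"

lemma alg_comb_nth: "alg_comb alg J c g $ i = alg_sum alg (\<lambda>j. c j * g j $ i) J"
  by (simp add: alg_comb_def)

lemma nonneg_alg_comb:
  assumes "finite J" "\<And>j. j \<in> J \<Longrightarrow> 0 \<le> c j" "\<And>j. j \<in> J \<Longrightarrow> nonneg_vec (g j)"
  shows "nonneg_vec (alg_comb alg J c g)"
  using assms by (auto simp: nonneg_vec_def alg_comb_nth intro!: alg_sum_nonneg)

lemma alg_comb_cong:
  "(\<And>j. j \<in> J \<Longrightarrow> c j = d j) \<Longrightarrow> (\<And>j. j \<in> J \<Longrightarrow> g j = h j) \<Longrightarrow> alg_comb alg J c g = alg_comb alg J d h"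
  by (simp add: vec_eq_iff alg_comb_nth cong: alg_sum_cong)

lemma alg_comb_ge:
  assumes "finite J" "\<And>j. j \<in> J \<Longrightarrow> 0 \<le> c j" "\<And>j. j \<in> J \<Longrightarrow> nonneg_vec (g j)" "j \<in> J"
  shows "c j * g j $ i \<le> alg_comb alg J c g $ i"
  unfolding alg_comb_nth
  using assms by (intro alg_sum_ge[where f = "\<lambda>j. c j * g j $ i"]) (auto simp: nonneg_vecD)

lemma alg_comb_insert:
  assumes "finite J" "a \<notin> J" "\<And>j. j \<in> insert a J \<Longrightarrow> 0 \<le> c j" "\<And>j. j \<in> insert a J \<Longrightarrow> nonneg_vec (g j)"
  shows "alg_comb alg (insert a J) c g = vec_add alg (c a *\<^sub>R g a) (alg_comb alg J c g)"
  using assms by (simp add: vec_eq_iff alg_comb_nth vec_add_def alg_sum_insert nonneg_vecD)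

text \<open>
  The product of two coefficient matrices is again taken in the algebra considered. Linearity of
  matrices and associativity of the matrix product are instances, since \<open>A x\<close> is the combination of
  the columns of \<open>A\<close> with coefficients \<open>x\<close>.
\<close>

lemma alg_comb_comb:
  assumes "finite J" "finite L" "\<And>j. j \<in> J \<Longrightarrow> 0 \<le> c j"
    "\<And>j l. j \<in> J \<Longrightarrow> l \<in> L \<Longrightarrow> 0 \<le> d j l" "\<And>l. l \<in> L \<Longrightarrow> nonneg_vec (g l)"
  shows "alg_comb alg J c (\<lambda>j. alg_comb alg L (d j) g)
       = alg_comb alg L (\<lambda>l. alg_sum alg (\<lambda>j. c j * d j l) J) g"
proof -
  have "alg_sum alg (\<lambda>j. c j * alg_sum alg (\<lambda>l. d j l * g l $ i) L) J
      = alg_sum alg (\<lambda>l. alg_sum alg (\<lambda>j. c j * d j l) J * g l $ i) L" (is "?l = ?r") for i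
  proof -
    have "?l = alg_sum alg (\<lambda>j. alg_sum alg (\<lambda>l. c j * (d j l * g l $ i)) L) J"
      using assms by (intro alg_sum_cong alg_sum_distrib_left) (auto simp: nonneg_vecD)
    also have "\<dots> = alg_sum alg (\<lambda>l. alg_sum alg (\<lambda>j. c j * (d j l * g l $ i)) J) L"
      using assms by (intro alg_sum_swap) (auto simp: nonneg_vecD)
    also have "\<dots> = alg_sum alg (\<lambda>l. g l $ i * alg_sum alg (\<lambda>j. c j * d j l) J) L"
    proof (intro alg_sum_cong)
      fix l assume "l \<in> L"
      then show "alg_sum alg (\<lambda>j. c j * (d j l * g l $ i)) J = g l $ i * alg_sum alg (\<lambda>j. c j * d j l) J"
        using assms by (subst alg_sum_distrib_left) (auto simp: nonneg_vecD mult_ac)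
    qed
    finally show ?thesis by (simp add: mult.commute)
  qed
  then show ?thesis by (simp add: vec_eq_iff alg_comb_nth)
qed

lemma mat_vec_eq_comb: "mat_vec alg A x = alg_comb alg UNIV (\<lambda>j. x $ j) (\<lambda>j. column j A)"
  by (simp add: vec_eq_iff mat_vec_nth alg_comb_nth column_def mult.commute)

lemma mat_vec_alg_comb:
  assumes "nonneg_mat A" "finite J" "\<And>j. j \<in> J \<Longrightarrow> 0 \<le> c j" "\<And>j. j \<in> J \<Longrightarrow> nonneg_vec (g j)"
  shows "mat_vec alg A (alg_comb alg J c g) = alg_comb alg J c (\<lambda>j. mat_vec alg A (g j))"
proof -
  have "alg_comb alg J c (\<lambda>j. mat_vec alg A (g j))
      = alg_comb alg UNIV (\<lambda>l. alg_sum alg (\<lambda>j. c j * g j $ l) J) (\<lambda>l. column l A)"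
    unfolding mat_vec_eq_comb using assms
    by (intro alg_comb_comb) (auto simp: nonneg_vecD nonneg_matD nonneg_vec_def column_def)
  then show ?thesis by (simp add: mat_vec_eq_comb alg_comb_nth)
qed

lemma mat_vec_mat_mul:
  assumes "nonneg_mat A" "nonneg_mat B" "nonneg_vec x"
  shows "mat_vec alg (mat_mul alg A B) x = mat_vec alg A (mat_vec alg B x)"
proof -
  have "column j (mat_mul alg A B) = mat_vec alg A (column j B)" for j
    by (simp add: vec_eq_iff column_def mat_mul_def mat_vec_nth)
  moreover have "mat_vec alg A (mat_vec alg B x)
      = alg_comb alg UNIV (\<lambda>j. x $ j) (\<lambda>j. mat_vec alg A (column j B))"
    unfolding mat_vec_eq_comb[of alg B x] using assms
    by (intro mat_vec_alg_comb) (auto simp: nonneg_vec_def column_def nonneg_matD)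
  ultimately show ?thesis by (simp add: mat_vec_eq_comb[of alg "mat_mul alg A B" x])
qed

lemma mat_vec_one: "nonneg_vec x \<Longrightarrow> mat_vec alg (mat 1) x = x"
  unfolding vec_eq_iff mat_vec_nth
proof
  fix i assume "nonneg_vec x"
  then have "alg_sum alg (\<lambda>j. mat 1 $ i $ j * x $ j) UNIV = mat 1 $ i $ i * x $ i"
    by (intro alg_sum_single[where f = "\<lambda>j. mat 1 $ i $ j * x $ j"]) (auto simp: mat_def nonneg_vecD)
  then show "alg_sum alg (\<lambda>j. mat 1 $ i $ j * x $ j) UNIV = x $ i" by (simp add: mat_def)
qed

lemma nonneg_mat_pow: "nonneg_mat A \<Longrightarrow> nonneg_mat (mat_pow alg A k)"
  by (induction k) (auto simp: nonneg_mat_def mat_def mat_mul_def intro!: alg_sum_nonneg)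

lemma mat_vec_mat_pow:
  assumes "nonneg_mat A" "nonneg_vec x"
  shows "mat_vec alg (mat_pow alg A k) x = (mat_vec alg A ^^ k) x"
  using assms by (induction k) (simp_all add: mat_vec_one mat_vec_mat_mul nonneg_mat_pow)

lemma nonneg_funpow: "nonneg_mat A \<Longrightarrow> nonneg_vec x \<Longrightarrow> nonneg_vec ((mat_vec alg A ^^ k) x)"
  by (induction k) (auto simp: nonneg_mat_vec)

lemma funpow_scale:
  assumes "nonneg_mat A" "nonneg_vec x" "0 \<le> c"
  shows "(mat_vec alg A ^^ k) (c *\<^sub>R x) = c *\<^sub>R (mat_vec alg A ^^ k) x"
  using assms by (induction k) (auto simp: mat_vec_scale nonneg_funpow)

lemma funpow_vec_add:
  assumes "nonneg_mat A" "nonneg_vec x" "nonneg_vec y"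
  shows "(mat_vec alg A ^^ k) (vec_add alg x y)
       = vec_add alg ((mat_vec alg A ^^ k) x) ((mat_vec alg A ^^ k) y)"
  using assms by (induction k) (auto simp: mat_vec_add nonneg_funpow)

lemma funpow_eigen:
  assumes "nonneg_mat A" "nonneg_vec x" "0 \<le> c" "(mat_vec alg A ^^ k) x = c *\<^sub>R x"
  shows "(mat_vec alg A ^^ (k * m)) x = c ^ m *\<^sub>R x"
proof (induction m)
  case (Suc m)
  have "(mat_vec alg A ^^ (k * Suc m)) x = (mat_vec alg A ^^ k) ((mat_vec alg A ^^ (k * m)) x)"
    by (simp add: funpow_add)
  with Suc assms show ?case by (simp add: funpow_scale mult.commute)
qed simp

section \<open>The core and sums of cones\<close>

lemma mat_span_eq: "mat_span alg B = {mat_vec alg B c | c. nonneg_vec c}"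
proof (intro equalityI subsetI)
  fix y assume "y \<in> mat_span alg B"
  then obtain c where "\<forall>j. 0 \<le> c j" "y = (\<chi> i. alg_sum alg (\<lambda>j. c j * column j B $ i) UNIV)"
    unfolding mat_span_def by blast
  then have "y = mat_vec alg B (\<chi> j. c j)" "nonneg_vec (\<chi> j. c j)"
    by (auto simp: mat_vec_eq_comb alg_comb_def nonneg_vec_def)
  then show "y \<in> {mat_vec alg B c | c. nonneg_vec c}" by blast
next
  fix y assume "y \<in> {mat_vec alg B c | c. nonneg_vec c}"
  then show "y \<in> mat_span alg B"
    unfolding mat_span_def nonneg_vec_def mat_vec_eq_comb alg_comb_def by blast
qed

lemma mat_span_pow:
  assumes "nonneg_mat A"
  shows "mat_span alg (mat_pow alg A i) = {(mat_vec alg A ^^ i) c | c. nonneg_vec c}"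
  unfolding mat_span_eq using mat_vec_mat_pow[OF assms] by (intro Collect_cong ex_cong1) auto

lemma core_iff:
  assumes "nonneg_mat A"
  shows "x \<in> core alg A \<longleftrightarrow> (\<forall>i\<ge>1. \<exists>c. nonneg_vec c \<and> x = (mat_vec alg A ^^ i) c)"
  unfolding core_def using mat_span_pow[OF assms] by auto

lemma nonneg_core: "nonneg_mat A \<Longrightarrow> x \<in> core alg A \<Longrightarrow> nonneg_vec x"
  using nonneg_funpow core_iff by (metis order_refl)

lemma core_scale:
  assumes "nonneg_mat A" "x \<in> core alg A" "0 \<le> c" shows "c *\<^sub>R x \<in> core alg A"
  unfolding core_iff[OF assms(1)]
proof (intro allI impI)
  fix i :: nat assume "1 \<le> i"
  with assms obtain d where "nonneg_vec d" "x = (mat_vec alg A ^^ i) d" using core_iff by blast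
  then show "\<exists>d. nonneg_vec d \<and> c *\<^sub>R x = (mat_vec alg A ^^ i) d"
    using assms by (intro exI[of _ "c *\<^sub>R d"]) (auto simp: funpow_scale nonneg_vec_scale)
qed

lemma core_add:
  assumes "nonneg_mat A" "x \<in> core alg A" "y \<in> core alg A" shows "vec_add alg x y \<in> core alg A"
  unfolding core_iff[OF assms(1)]
proof (intro allI impI)
  fix i :: nat assume i: "1 \<le> i"
  from i assms obtain d where "nonneg_vec d" "x = (mat_vec alg A ^^ i) d" using core_iff by blast
  moreover from i assms obtain e where "nonneg_vec e" "y = (mat_vec alg A ^^ i) e" using core_iff by blast
  ultimately show "\<exists>d. nonneg_vec d \<and> vec_add alg x y = (mat_vec alg A ^^ i) d"
    using assms by (intro exI[of _ "vec_add alg d e"]) (auto simp: funpow_vec_add nonneg_vec_add)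
qed

lemma core_0: "nonneg_mat A \<Longrightarrow> 0 \<in> core alg A"
  unfolding core_iff using funpow_scale[of A 0 0] by (auto intro!: exI[of _ 0])

lemma core_alg_comb:
  assumes "nonneg_mat A" "finite J" "\<And>j. j \<in> J \<Longrightarrow> 0 \<le> c j" "\<And>j. j \<in> J \<Longrightarrow> g j \<in> core alg A"
  shows "alg_comb alg J c g \<in> core alg A"
  using assms(2-)
proof (induction J)
  case empty
  then show ?case using core_0[OF assms(1)] by (simp add: alg_comb_def zero_vec_def)
next
  case (insert a J)
  then show ?case
    using assms(1) nonneg_core[OF assms(1)] by (subst alg_comb_insert) (auto intro: core_add core_scale)
qed

lemma mat_vec_core:
  assumes "nonneg_mat A" "x \<in> core alg A" shows "mat_vec alg A x \<in> core alg A"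
  unfolding core_iff[OF assms(1)]
proof (intro allI impI)
  fix i :: nat assume i: "1 \<le> i"
  with assms obtain d where d: "nonneg_vec d" "x = (mat_vec alg A ^^ i) d" using core_iff by blast
  then show "\<exists>d. nonneg_vec d \<and> mat_vec alg A x = (mat_vec alg A ^^ i) d"
    using assms(1) by (intro exI[of _ "mat_vec alg A d"]) (auto simp: funpow_swap1 nonneg_mat_vec)
qed

lemma cone_sum_mono:
  assumes "(\<Union>i\<in>I. C i) \<subseteq> (\<Union>i\<in>J. D i)" shows "cone_sum alg I C \<subseteq> cone_sum alg J D"
  using assms unfolding cone_sum_def by blast

lemma alg_comb_in_cone_sum:
  assumes "finite J" "\<And>j. j \<in> J \<Longrightarrow> 0 \<le> c j" "\<And>j. j \<in> J \<Longrightarrow> nonneg_vec (g j)"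
    "\<And>j. j \<in> J \<Longrightarrow> c j *\<^sub>R g j \<in> (\<Union>i\<in>I. C i)"
  shows "alg_comb alg J c g \<in> cone_sum alg I C"
  using assms
proof (induction J)
  case empty
  have "alg_comb alg {} c g = foldr (vec_add alg) [] 0" by (simp add: alg_comb_def zero_vec_def)
  then show ?case unfolding cone_sum_def by (intro CollectI exI[of _ "[]"]) auto
next
  case (insert a J)
  then obtain xs where "alg_comb alg J c g = foldr (vec_add alg) xs 0" "set xs \<subseteq> (\<Union>i\<in>I. C i)"
    unfolding cone_sum_def by auto
  moreover have "alg_comb alg (insert a J) c g = vec_add alg (c a *\<^sub>R g a) (alg_comb alg J c g)"
    using insert by (intro alg_comb_insert) auto
  ultimately have "alg_comb alg (insert a J) c g = foldr (vec_add alg) (c a *\<^sub>R g a # xs) 0"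
    "set (c a *\<^sub>R g a # xs) \<subseteq> (\<Union>i\<in>I. C i)"
    using insert.prems(3) by auto
  then show ?case unfolding cone_sum_def by blast
qed

lemma cone_sum_subset_core:
  assumes "nonneg_mat A" "\<And>i. i \<in> I \<Longrightarrow> C i \<subseteq> core alg A"
  shows "cone_sum alg I C \<subseteq> core alg A"
proof -
  have "foldr (vec_add alg) xs 0 \<in> core alg A" if "set xs \<subseteq> (\<Union>i\<in>I. C i)" for xs
    using that by (induction xs) (use assms core_0 in \<open>auto intro!: core_add\<close>)
  then show ?thesis unfolding cone_sum_def by blast
qed

lemma eigencone_pow_iff:
  assumes "nonneg_mat A"
  shows "x \<in> eigencone alg (mat_pow alg A k) r \<longleftrightarrow> nonneg_vec x \<and> (mat_vec alg A ^^ k) x = r *\<^sub>R x"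
  using assms by (auto simp: eigencone_def mat_vec_mat_pow)

lemma eigencone_pow_subset_core:
  assumes A: "nonneg_mat A" and k: "k \<ge> 1" and l: "r > 0"
  shows "eigencone alg (mat_pow alg A k) r \<subseteq> core alg A"
proof
  fix x assume "x \<in> eigencone alg (mat_pow alg A k) r"
  then have x: "nonneg_vec x" "(mat_vec alg A ^^ k) x = r *\<^sub>R x" using eigencone_pow_iff[OF A] by auto
  show "x \<in> core alg A" unfolding core_iff[OF A]
  proof (intro allI impI)
    fix i :: nat
    have le: "i \<le> k * i" using k by simp
    define y where "y = inverse (r ^ i) *\<^sub>R (mat_vec alg A ^^ (k * i - i)) x"
    have "(mat_vec alg A ^^ i) y = inverse (r ^ i) *\<^sub>R (mat_vec alg A ^^ i) ((mat_vec alg A ^^ (k * i - i)) x)"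
      unfolding y_def using A x l by (intro funpow_scale nonneg_funpow) auto
    also have "\<dots> = inverse (r ^ i) *\<^sub>R (mat_vec alg A ^^ (k * i)) x"
      using le by (simp flip: funpow_add comp_apply[of "mat_vec alg A ^^ i"])
    also have "\<dots> = x" using funpow_eigen[OF A x(1) _ x(2)] l by simp
    finally show "\<exists>c. nonneg_vec c \<and> x = (mat_vec alg A ^^ i) c"
      using A x l by (intro exI[of _ y]) (auto simp: y_def nonneg_vec_scale nonneg_funpow)
  qed
qed

section \<open>Finite generation of the core\<close>

lemma tendsto_mat_vec:
  assumes "\<And>r. nonneg_mat (B r)" "\<And>r. nonneg_vec (c r)" "B \<longlonglongrightarrow> L" "c \<longlonglongrightarrow> d"
  shows "(\<lambda>r. mat_vec alg (B r) (c r)) \<longlonglongrightarrow> mat_vec alg L d"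
proof (rule vec_tendstoI)
  fix i
  show "(\<lambda>r. mat_vec alg (B r) (c r) $ i) \<longlonglongrightarrow> mat_vec alg L d $ i"
    unfolding mat_vec_nth using assms
    by (intro tendsto_alg_sum) (auto intro!: tendsto_mult tendsto_vec_nth simp: nonneg_matD nonneg_vecD)
qed

lemma nonneg_vec_limit: "x \<longlonglongrightarrow> l \<Longrightarrow> (\<And>r. nonneg_vec (x r)) \<Longrightarrow> nonneg_vec l"
  unfolding nonneg_vec_def by (intro allI LIMSEQ_le_const[OF tendsto_vec_nth]) auto

definition col_sum :: "real ^ 'n ^ 'm \<Rightarrow> 'n \<Rightarrow> real" where
  "col_sum B j = (\<Sum>i\<in>UNIV. B $ i $ j)"

text \<open>
  Columns are scaled to sum \<open>1\<close> in the usual sense for both algebras; a zero column stays zero, because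
  \<open>x / 0 = 0\<close>.
\<close>

definition norm_cols :: "real ^ 'n ^ 'm \<Rightarrow> real ^ 'n ^ 'm" where
  "norm_cols B = (\<chi> i j. B $ i $ j / col_sum B j)"

lemma col_sum_eq_0_iff:
  assumes "nonneg_mat B" shows "col_sum B j = 0 \<longleftrightarrow> (\<forall>i. B $ i $ j = 0)"
  using assms by (auto simp: col_sum_def nonneg_mat_def sum_nonneg_eq_0_iff)

lemma col_sum_nonneg: "nonneg_mat B \<Longrightarrow> 0 \<le> col_sum B j"
  by (simp add: col_sum_def nonneg_mat_def sum_nonneg)

lemma nonneg_norm_cols: "nonneg_mat B \<Longrightarrow> nonneg_mat (norm_cols B)"
  by (auto simp: nonneg_mat_def norm_cols_def col_sum_nonneg)

lemma col_sum_norm_cols: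
  assumes "nonneg_mat B" shows "col_sum (norm_cols B) j \<in> {0, 1}"
proof -
  have "col_sum (norm_cols B) j = col_sum B j / col_sum B j"
    by (simp add: col_sum_def norm_cols_def flip: sum_divide_distrib)
  then show ?thesis by auto
qed

lemma mat_span_norm_cols:
  assumes "nonneg_mat B"
  shows "mat_span alg (norm_cols B) = mat_span alg B"
proof (intro equalityI subsetI)
  fix y assume "y \<in> mat_span alg (norm_cols B)"
  then obtain c where c: "nonneg_vec c" "y = mat_vec alg (norm_cols B) c" unfolding mat_span_eq by auto
  have "y = mat_vec alg B (\<chi> j. c $ j / col_sum B j)"
    unfolding c by (simp add: vec_eq_iff mat_vec_nth norm_cols_def)
  moreover have "nonneg_vec (\<chi> j. c $ j / col_sum B j)"
    using c assms by (simp add: nonneg_vec_def col_sum_nonneg)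
  ultimately show "y \<in> mat_span alg B" unfolding mat_span_eq by auto
next
  fix y assume "y \<in> mat_span alg B"
  then obtain c where c: "nonneg_vec c" "y = mat_vec alg B c" unfolding mat_span_eq by auto
  have "B $ i $ j * c $ j = norm_cols B $ i $ j * (c $ j * col_sum B j)" for i j
    using col_sum_eq_0_iff[OF assms, of j] by (auto simp: norm_cols_def)
  then have "y = mat_vec alg (norm_cols B) (\<chi> j. c $ j * col_sum B j)"
    unfolding c vec_eq_iff mat_vec_nth by (intro allI alg_sum_cong) simp
  moreover have "nonneg_vec (\<chi> j. c $ j * col_sum B j)"
    using c assms by (simp add: nonneg_vec_def col_sum_nonneg)
  ultimately show "y \<in> mat_span alg (norm_cols B)" unfolding mat_span_eq by auto
qed

lemma bounded_nonneg_vecs: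
  fixes x :: "nat \<Rightarrow> real ^ 'n"
  assumes "\<And>r. nonneg_vec (x r)" "\<And>r i. x r $ i \<le> K"
  shows "bounded (range x)"
proof -
  have "norm (x r) \<le> real CARD('n) * K" for r
  proof -
    have "norm (x r) \<le> (\<Sum>i\<in>UNIV. \<bar>x r $ i\<bar>)" by (rule norm_le_l1_cart)
    also have "\<dots> \<le> (\<Sum>i\<in>(UNIV::'n set). K)"
      using assms by (intro sum_mono) (simp add: nonneg_vec_def)
    finally show ?thesis by simp
  qed
  then show ?thesis by (auto simp: bounded_iff)
qed

text \<open>
  A column of sum \<open>1\<close> bounds its coefficient by the sum of the entries of the combination, and the
  coefficient of a zero column may be taken to be zero. So the coefficients stay bounded and a
  subsequence of them converges.
\<close>

lemma normalised_limit:
  fixes B :: "nat \<Rightarrow> real ^ 'n ^ 'n"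
  assumes B: "\<And>r. nonneg_mat (B r)" "\<And>r j. col_sum (B r) j \<in> {0, 1}" "B \<longlonglongrightarrow> L"
    and x: "\<And>r. x r \<in> mat_span alg (B r)" "x \<longlonglongrightarrow> l"
  shows "l \<in> mat_span alg L"
proof -
  from x(1) have "\<exists>c. nonneg_vec c \<and> x r = mat_vec alg (B r) c" for r unfolding mat_span_eq by auto
  then obtain c where c: "\<And>r. nonneg_vec (c r)" "\<And>r. x r = mat_vec alg (B r) (c r)" by metis
  define e where "e r = (\<chi> j. if col_sum (B r) j = 0 then 0 else c r $ j)" for r
  have e: "nonneg_vec (e r)" for r using c by (simp add: e_def nonneg_vec_def)
  have xe: "x r = mat_vec alg (B r) (e r)" for r
    unfolding c(2) using col_sum_eq_0_iff[OF B(1)[of r]]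
    by (auto simp: vec_eq_iff mat_vec_nth e_def intro!: alg_sum_cong)
  have le: "e r $ j \<le> (\<Sum>i\<in>UNIV. x r $ i)" for r j
  proof (cases "col_sum (B r) j = 0")
    case True
    then show ?thesis
      using nonneg_mat_vec[OF B(1) e] by (auto simp: e_def xe nonneg_vec_def intro!: sum_nonneg)
  next
    case False
    then have "e r $ j = (\<Sum>i\<in>UNIV. B r $ i $ j * e r $ j)"
      using B(2)[of r j] by (auto simp: col_sum_def simp flip: sum_distrib_right)
    also have "\<dots> \<le> (\<Sum>i\<in>UNIV. x r $ i)"
      unfolding xe by (intro sum_mono mat_vec_ge B e)
    finally show ?thesis .
  qed
  have "(\<lambda>r. \<Sum>i\<in>UNIV. x r $ i) \<longlonglongrightarrow> (\<Sum>i\<in>UNIV. l $ i)"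
    by (intro tendsto_sum tendsto_vec_nth x)
  then have "Bseq (\<lambda>r. \<Sum>i\<in>UNIV. x r $ i)" by (intro convergent_imp_Bseq convergentI)
  then obtain K where "\<And>r. \<bar>\<Sum>i\<in>UNIV. x r $ i\<bar> \<le> K" unfolding Bseq_def by auto
  then have "e r $ j \<le> K" for r j using le[of r j] by (smt (verit))
  then have "bounded (range e)" using e bounded_nonneg_vecs by blast
  then obtain d s where ds: "strict_mono (s :: nat \<Rightarrow> nat)" "(e \<circ> s) \<longlonglongrightarrow> d"
    using bounded_imp_convergent_subsequence by blast
  have "(\<lambda>r. mat_vec alg (B (s r)) (e (s r))) \<longlonglongrightarrow> mat_vec alg L d"
    using LIMSEQ_subseq_LIMSEQ[OF B(3) ds(1)] ds(2)
    by (intro tendsto_mat_vec B e) (auto simp: comp_def)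
  moreover have "(\<lambda>r. mat_vec alg (B (s r)) (e (s r))) \<longlonglongrightarrow> l"
    using LIMSEQ_subseq_LIMSEQ[OF x(2) ds(1)] by (simp add: comp_def xe)
  ultimately have "l = mat_vec alg L d" using LIMSEQ_unique by blast
  moreover have "nonneg_vec d" using nonneg_vec_limit[OF ds(2)] e by simp
  ultimately show ?thesis unfolding mat_span_eq by blast
qed

lemma mat_span_closed:
  assumes "nonneg_mat B" "\<And>r. x r \<in> mat_span alg B" "x \<longlonglongrightarrow> l"
  shows "l \<in> mat_span alg B"
  using normalised_limit[where B = "\<lambda>_. norm_cols B" and x = x and l = l and L = "norm_cols B" and alg = alg]
    assms by (simp add: nonneg_norm_cols col_sum_norm_cols[simplified] mat_span_norm_cols)

lemma mat_span_pow_mono: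
  assumes "nonneg_mat A" "i \<le> k"
  shows "mat_span alg (mat_pow alg A k) \<subseteq> mat_span alg (mat_pow alg A i)"
proof
  fix x assume "x \<in> mat_span alg (mat_pow alg A k)"
  then obtain c where "nonneg_vec c" "x = (mat_vec alg A ^^ k) c" using mat_span_pow[OF assms(1)] by auto
  moreover have "(mat_vec alg A ^^ k) c = (mat_vec alg A ^^ i) ((mat_vec alg A ^^ (k - i)) c)"
    using assms(2) by (simp flip: funpow_add comp_apply[of "mat_vec alg A ^^ i"])
  ultimately show "x \<in> mat_span alg (mat_pow alg A i)"
    using nonneg_funpow[OF assms(1)] mat_span_pow[OF assms(1)] by blast
qed

lemma core_limit:
  assumes A: "nonneg_mat A" and s: "\<And>r. r \<le> s r" and x: "\<And>r. x r \<in> mat_span alg (mat_pow alg A (s r))"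
    and lim: "x \<longlonglongrightarrow> l"
  shows "l \<in> core alg A"
  unfolding core_def
proof
  fix i :: nat
  have "x (r + i) \<in> mat_span alg (mat_pow alg A i)" for r
    using x[of "r + i"] s[of "r + i"] mat_span_pow_mono[OF A, of i "s (r + i)"] by fastforce
  then show "l \<in> mat_span alg (mat_pow alg A i)"
    by (rule mat_span_closed[OF nonneg_mat_pow[OF A] _ LIMSEQ_ignore_initial_segment[OF lim]])
qed

text \<open>
  The normalised columns of \<open>A\<^sup>i\<close> stay in a compact set. Along a convergent subsequence of the matrices the limit
  columns lie in every \<open>span (A\<^sup>i)\<close>, as these cones are closed and decreasing; conversely an
  element of the core is a combination of the columns at each stage and hence of the limit columns.
\<close>

lemma core_finitely_generated:
  fixes A :: "real ^ 'n ^ 'n"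
  assumes A: "nonneg_mat A"
  obtains G where "nonneg_mat G" "core alg A = mat_span alg G"
proof -
  define N where "N i = norm_cols (mat_pow alg A i)" for i
  have N: "nonneg_mat (N i)" "col_sum (N i) j \<in> {0, 1}"
    "mat_span alg (N i) = mat_span alg (mat_pow alg A i)" for i j
    using nonneg_mat_pow[OF A] by (simp_all add: N_def nonneg_norm_cols col_sum_norm_cols[simplified] mat_span_norm_cols)
  have "norm (N i) \<le> real CARD('n) * real CARD('n)" for i
  proof -
    have le1: "N i $ a $ b \<le> 1" for a b
    proof -
      have "N i $ a $ b \<le> col_sum (N i) b"
        unfolding col_sum_def using N(1)[of i] by (intro member_le_sum) (auto simp: nonneg_mat_def)
      also have "\<dots> \<le> 1" using N(2)[of i b] by auto
      finally show ?thesis .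
    qed
    have "norm (N i) \<le> (\<Sum>a\<in>UNIV. norm (N i $ a))"
      unfolding norm_vec_def by (rule L2_set_le_sum) auto
    also have "\<dots> \<le> (\<Sum>a\<in>UNIV. \<Sum>b\<in>UNIV. \<bar>N i $ a $ b\<bar>)" by (intro sum_mono norm_le_l1_cart)
    also have "\<dots> \<le> (\<Sum>a\<in>(UNIV::'n set). \<Sum>b\<in>(UNIV::'n set). 1)"
      using le1 N(1)[of i] by (intro sum_mono) (simp add: nonneg_mat_def)
    finally show ?thesis by simp
  qed
  then have "bounded (range N)" by (auto simp: bounded_iff)
  then obtain G s where s: "strict_mono (s :: nat \<Rightarrow> nat)" "(N \<circ> s) \<longlonglongrightarrow> G"
    using bounded_imp_convergent_subsequence by blast
  have lim: "(\<lambda>r. N (s r) $ i $ j) \<longlonglongrightarrow> G $ i $ j" for i j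
    using s(2) by (auto simp: comp_def intro!: tendsto_vec_nth)
  have G: "nonneg_mat G" unfolding nonneg_mat_def
    using LIMSEQ_le_const[OF lim] N(1) nonneg_matD by blast
  have col: "column j G \<in> core alg A" for j
  proof (rule core_limit[OF A])
    show "r \<le> s r" for r using s(1) by (rule seq_suble)
    show "(\<lambda>r. column j (N (s r))) \<longlonglongrightarrow> column j G"
      by (rule vec_tendstoI) (simp add: column_def lim)
    have axis: "nonneg_vec (axis j 1 :: real ^ 'n)" by (simp add: nonneg_vec_def axis_def)
    have "column j B $ i = mat_vec alg B (axis j 1) $ i" if "nonneg_mat B" for i and B :: "real ^ 'n ^ 'n"
    proof -
      have "alg_sum alg (\<lambda>l. B $ i $ l * axis j 1 $ l) UNIV = B $ i $ j * axis j 1 $ j"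
        using that
        by (intro alg_sum_single[where f = "\<lambda>l. B $ i $ l * axis j 1 $ l"]) (auto simp: axis_def nonneg_matD)
      then show ?thesis by (simp add: mat_vec_nth column_def axis_def)
    qed
    then have "column j (N (s r)) = mat_vec alg (N (s r)) (axis j 1)" for r
      using N(1) by (simp add: vec_eq_iff)
    then have "column j (N (s r)) \<in> mat_span alg (N (s r))" for r
      using axis unfolding mat_span_eq by auto
    then show "column j (N (s r)) \<in> mat_span alg (mat_pow alg A (s r))" for r
      by (simp add: N(3))
  qed
  have "core alg A = mat_span alg G"
  proof (intro equalityI subsetI)
    fix x assume x: "x \<in> core alg A"
    have x': "x \<in> mat_span alg (N i)" for i
    proof (cases "i = 0")
      case True
      then show ?thesis
        using nonneg_core[OF A x] mat_span_pow[OF A, of alg 0] by (simp add: N(3) del: mat_pow.simps)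
    next
      case False
      then show ?thesis using x by (simp add: N(3) core_def)
    qed
    show "x \<in> mat_span alg G"
      by (rule normalised_limit[where B = "N \<circ> s" and x = "\<lambda>_. x"]) (use N x' s in auto)
  next
    fix x assume "x \<in> mat_span alg G"
    then obtain c where "nonneg_vec c" "x = mat_vec alg G c" unfolding mat_span_eq by auto
    then show "x \<in> core alg A"
      using col unfolding mat_vec_eq_comb by (auto intro!: core_alg_comb A simp: nonneg_vecD)
  qed
  with G show thesis by (rule that)
qed

lemma mat_vec_eq_0_iff:
  assumes "nonneg_mat B" "nonneg_vec c"
  shows "mat_vec alg B c = 0 \<longleftrightarrow> (\<forall>j. c $ j = 0 \<or> column j B = 0)"
proof
  assume z: "mat_vec alg B c = 0"
  have "B $ i $ j * c $ j = 0" for i j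
  proof (rule order_antisym)
    show "B $ i $ j * c $ j \<le> 0" using mat_vec_ge[OF assms, of i j alg] z by simp
    show "0 \<le> B $ i $ j * c $ j" using assms by (simp add: nonneg_matD nonneg_vecD)
  qed
  then show "\<forall>j. c $ j = 0 \<or> column j B = 0" by (auto simp: vec_eq_iff column_def)
next
  assume "\<forall>j. c $ j = 0 \<or> column j B = 0"
  then have "B $ i $ j * c $ j = 0" for i j
    by (metis (no_types, lifting) column_def mult_eq_0_iff vec_lambda_beta zero_index)
  then have "mat_vec alg B c $ i = 0" for i
    unfolding mat_vec_nth by (simp only: alg_sum_zero)
  then show "mat_vec alg B c = 0" by (simp add: vec_eq_iff)
qed

text \<open>
  The set of indices \<open>j\<close> whose column of \<open>A\<^sup>i\<close> vanishes grows with \<open>i\<close> and so is eventually stationary. At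
  such an \<open>i\<close>, multiplication by \<open>A\<close> kills no nonzero column of \<open>A\<^sup>i\<close>, and thus no nonzero
  combination of these columns.
\<close>

lemma core_kernel:
  fixes A :: "real ^ 'n ^ 'n"
  assumes A: "nonneg_mat A" and z: "z \<in> core alg A" "mat_vec alg A z = 0"
  shows "z = 0"
proof -
  define Z where "Z i = {j. column j (mat_pow alg A i) = 0}" for i
  have col: "column j (mat_pow alg A (Suc i)) = mat_vec alg A (column j (mat_pow alg A i))" for i j
    by (simp add: vec_eq_iff column_def mat_mul_def mat_vec_nth)
  have mono: "Z i \<subseteq> Z (Suc i)" for i unfolding Z_def col by auto
  have "\<exists>i. Z (Suc i) = Z i"
  proof (rule ccontr)
    assume "\<not> ?thesis"
    then have str: "Z i \<subset> Z (Suc i)" for i using mono by blast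
    have "i \<le> card (Z i)" for i
    proof (induction i)
      case (Suc i)
      have "card (Z i) < card (Z (Suc i))" by (rule psubset_card_mono[OF _ str]) simp
      with Suc show ?case by simp
    qed simp
    then have "Suc CARD('n) \<le> card (Z (Suc CARD('n)))" .
    also have "\<dots> \<le> CARD('n)" by (intro card_mono) auto
    finally show False by simp
  qed
  then obtain i where i: "Z (Suc i) = Z i" ..
  obtain c where c: "nonneg_vec c" "z = (mat_vec alg A ^^ i) c"
  proof (cases "i = 0")
    case True
    with nonneg_core[OF A z(1)] show ?thesis by (intro that[of z]) auto
  next
    case False
    then have "1 \<le> i" by simp
    with z(1) show ?thesis using that unfolding core_iff[OF A] by blast
  qed
  have "mat_vec alg (mat_pow alg A (Suc i)) c = 0" using z c A by (simp only: mat_vec_mat_pow funpow.simps comp_apply)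
  then have "\<forall>j. c $ j = 0 \<or> j \<in> Z (Suc i)"
    using mat_vec_eq_0_iff[OF nonneg_mat_pow[OF A] c(1)] by (simp add: Z_def del: mat_pow.simps)
  then have "mat_vec alg (mat_pow alg A i) c = 0"
    unfolding i using mat_vec_eq_0_iff[OF nonneg_mat_pow[OF A] c(1)] by (simp add: Z_def)
  then show "z = 0" using A c by (simp add: mat_vec_mat_pow)
qed

text \<open>
  Preimages \<open>y i\<close> of \<open>x\<close> in \<open>span (A\<^sup>i)\<close> exist by definition of the core, and a limit point of them is the
  required preimage. They are bounded: otherwise the normalised \<open>y i\<close> would have a limit point of
  norm \<open>1\<close> in the core that is mapped to \<open>0\<close>.
\<close>

lemma core_surj:
  assumes A: "nonneg_mat A" and x: "x \<in> core alg A"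
  obtains y where "y \<in> core alg A" "mat_vec alg A y = x"
proof -
  have "\<exists>y. y \<in> mat_span alg (mat_pow alg A i) \<and> mat_vec alg A y = x" for i
  proof -
    have "1 \<le> Suc i" by simp
    with x obtain c where c: "nonneg_vec c" "x = (mat_vec alg A ^^ Suc i) c"
      unfolding core_iff[OF A] by blast
    then show ?thesis by (intro exI[of _ "(mat_vec alg A ^^ i) c"]) (auto simp: mat_span_pow[OF A])
  qed
  then obtain y where y: "\<And>i. y i \<in> mat_span alg (mat_pow alg A i)" "\<And>i. mat_vec alg A (y i) = x" by metis
  have ny: "nonneg_vec (y i)" for i
    using y(1)[of i] nonneg_funpow[OF A] unfolding mat_span_pow[OF A] by auto
  have bd: "bounded (range y)"
  proof (rule ccontr)
    assume nb: "\<not> ?thesis"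
    have "\<exists>i\<ge>m. norm (y i) > real m" for m
    proof (rule ccontr)
      assume "\<not> ?thesis"
      then have "bounded (y ` {m..})" by (auto simp: bounded_iff not_less)
      moreover have "bounded (y ` {..<m})" by (simp add: finite_imp_bounded)
      ultimately have "bounded (y ` {..<m} \<union> y ` {m..})" by simp
      moreover have "range y = y ` {..<m} \<union> y ` {m..}"
        by (subst image_Un[symmetric], rule arg_cong[where f = "image y"]) auto
      ultimately show False using nb by simp
    qed
    then obtain a where a: "\<And>m. a m \<ge> m" "\<And>m. norm (y (a m)) > real m" by metis
    define z where "z m = inverse (norm (y (a m))) *\<^sub>R y (a m)" for m
    have pos: "norm (y (a m)) > 0" for m using a(2)[of m] by (meson le_less_trans of_nat_0_le_iff)
    have nz: "norm (z m) = 1" for m using pos[of m] by (auto simp: z_def)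
    then have "bounded (range z)" by (auto simp: bounded_iff intro!: exI[of _ 1])
    then obtain l s where s: "strict_mono (s :: nat \<Rightarrow> nat)" "(z \<circ> s) \<longlonglongrightarrow> l"
      using bounded_imp_convergent_subsequence by blast
    have "l \<in> core alg A"
    proof (rule core_limit[OF A _ _ s(2)])
      show "r \<le> a (s r)" for r using seq_suble[OF s(1)] a(1) le_trans by blast
      fix r
      obtain c where "nonneg_vec c" "y (a (s r)) = (mat_vec alg A ^^ a (s r)) c"
        using y(1)[of "a (s r)"] unfolding mat_span_pow[OF A] by auto
      then show "(z \<circ> s) r \<in> mat_span alg (mat_pow alg A (a (s r)))"
        unfolding mat_span_pow[OF A] z_def comp_apply
        by (intro CollectI exI[of _ "inverse (norm (y (a (s r)))) *\<^sub>R c"])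
          (auto simp: funpow_scale[OF A] nonneg_vec_scale)
    qed
    moreover have "mat_vec alg A l = 0"
    proof (rule LIMSEQ_unique)
      show "(\<lambda>r. mat_vec alg A ((z \<circ> s) r)) \<longlonglongrightarrow> mat_vec alg A l"
        by (intro tendsto_mat_vec A s tendsto_const) (auto simp: z_def nonneg_vec_scale ny)
      have "filterlim (\<lambda>m. norm (y (a m))) at_top sequentially"
        by (rule filterlim_at_top_mono[OF filterlim_real_sequentially]) (use a(2) in \<open>auto simp: less_imp_le\<close>)
      then have "(\<lambda>m. inverse (norm (y (a m)))) \<longlonglongrightarrow> 0" by (rule tendsto_inverse_0_at_top)
      then have "(\<lambda>m. inverse (norm (y (a m))) *\<^sub>R x) \<longlonglongrightarrow> 0 *\<^sub>R x" by (intro tendsto_scaleR tendsto_const)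
      moreover have "mat_vec alg A (z m) = inverse (norm (y (a m))) *\<^sub>R x" for m
        by (simp add: z_def mat_vec_scale A ny y(2))
      ultimately have "(\<lambda>m. mat_vec alg A (z m)) \<longlonglongrightarrow> 0" by simp
      from LIMSEQ_subseq_LIMSEQ[OF this s(1)]
      show "(\<lambda>r. mat_vec alg A ((z \<circ> s) r)) \<longlonglongrightarrow> 0" by (simp add: comp_def)
    qed
    ultimately have "l = 0" by (rule core_kernel[OF A])
    moreover have "norm l = 1"
      using tendsto_norm[OF s(2)] nz by (simp add: comp_def LIMSEQ_const_iff)
    ultimately show False by simp
  qed
  then obtain l s where s: "strict_mono (s :: nat \<Rightarrow> nat)" "(y \<circ> s) \<longlonglongrightarrow> l"
    using bounded_imp_convergent_subsequence by blast
  show thesis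
  proof (rule that)
    show "l \<in> core alg A"
      by (rule core_limit[OF A _ _ s(2), where s = s]) (use y s(1) in \<open>auto intro: seq_suble\<close>)
    have "(\<lambda>r. mat_vec alg A ((y \<circ> s) r)) \<longlonglongrightarrow> mat_vec alg A l"
      by (intro tendsto_mat_vec A s tendsto_const) (auto simp: ny)
    then show "mat_vec alg A l = x" by (simp add: y(2) LIMSEQ_const_iff)
  qed
qed

section \<open>Irredundant generators of cones\<close>

definition generated_cone :: "algebra_kind \<Rightarrow> 'j set \<Rightarrow> ('j \<Rightarrow> real ^ 'n) \<Rightarrow> (real ^ 'n) set" where
  "generated_cone alg J g = {alg_comb alg J c g | c. \<forall>j\<in>J. 0 \<le> c j}"

lemma generated_cone_trans:
  assumes "finite J" "finite L" "\<And>l. l \<in> L \<Longrightarrow> nonneg_vec (g l)" "\<And>j. j \<in> J \<Longrightarrow> h j \<in> generated_cone alg L g"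
  shows "generated_cone alg J h \<subseteq> generated_cone alg L g"
proof
  fix x assume "x \<in> generated_cone alg J h"
  then obtain c where c: "\<forall>j\<in>J. 0 \<le> c j" "x = alg_comb alg J c h" unfolding generated_cone_def by auto
  have "\<forall>j\<in>J. \<exists>d. (\<forall>l\<in>L. 0 \<le> d l) \<and> h j = alg_comb alg L d g"
    using assms(4) unfolding generated_cone_def by blast
  then obtain d where d: "\<And>j. j \<in> J \<Longrightarrow> \<forall>l\<in>L. 0 \<le> d j l" "\<And>j. j \<in> J \<Longrightarrow> h j = alg_comb alg L (d j) g"
    by metis
  have "x = alg_comb alg J c (\<lambda>j. alg_comb alg L (d j) g)" unfolding c by (intro alg_comb_cong) (auto simp: d)
  also have "\<dots> = alg_comb alg L (\<lambda>l. alg_sum alg (\<lambda>j. c j * d j l) J) g"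
    using assms c d by (intro alg_comb_comb) auto
  finally show "x \<in> generated_cone alg L g"
    unfolding generated_cone_def using assms c d
    by (intro CollectI exI conjI) (auto intro!: alg_sum_nonneg)
qed

lemma alg_comb_single:
  assumes "finite J" "j \<in> J" "nonneg_vec (g j)" "0 \<le> t"
  shows "alg_comb alg J (\<lambda>l. if l = j then t else 0) g = t *\<^sub>R g j"
  unfolding vec_eq_iff alg_comb_nth
proof
  fix i
  show "alg_sum alg (\<lambda>l. (if l = j then t else 0) * g l $ i) J = (t *\<^sub>R g j) $ i"
    using alg_sum_single[of J j "\<lambda>l. (if l = j then t else 0) * g l $ i" alg] assms by (simp add: nonneg_vecD)
qed

lemma scale_in_generated_cone:
  assumes "finite J" "j \<in> J" "nonneg_vec (g j)" "0 \<le> t" shows "t *\<^sub>R g j \<in> generated_cone alg J g"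
  unfolding generated_cone_def using alg_comb_single[of J j g t alg] assms
  by (intro CollectI exI[of _ "\<lambda>l. if l = j then t else 0"]) auto

lemma alg_comb_remove:
  assumes "finite J" "j \<in> J" "\<And>j. j \<in> J \<Longrightarrow> 0 \<le> c j" "\<And>j. j \<in> J \<Longrightarrow> nonneg_vec (g j)"
  shows "alg_comb alg J c g = vec_add alg (c j *\<^sub>R g j) (alg_comb alg (J - {j}) c g)"
  using alg_comb_insert[of "J - {j}" j c g alg] assms by (auto simp: insert_absorb)

definition irredundant :: "algebra_kind \<Rightarrow> 'j set \<Rightarrow> ('j \<Rightarrow> real ^ 'n) \<Rightarrow> bool" where
  "irredundant alg J g \<longleftrightarrow> finite J \<and> (\<forall>j\<in>J. nonneg_vec (g j) \<and> g j \<notin> generated_cone alg (J - {j}) g)"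

lemma irredundant_nz:
  assumes "irredundant alg J g" "j \<in> J" shows "g j \<noteq> 0"
proof
  assume z: "g j = 0"
  have "alg_comb alg (J - {j}) (\<lambda>_. 0) g = 0" by (simp add: vec_eq_iff alg_comb_nth)
  then have "g j \<in> generated_cone alg (J - {j}) g" unfolding generated_cone_def z by (intro CollectI exI[of _ "\<lambda>_. 0"]) auto
  with assms show False by (auto simp: irredundant_def)
qed

text \<open>
  If the coefficient of \<open>g j\<close> were smaller than \<open>1\<close>, its term could be cancelled: by subtraction in
  nonnegative algebra, and in max algebra because it attains the maximum in no nonzero entry.
\<close>

lemma irredundant_coeff:
  assumes irr: "irredundant alg J g" and j: "j \<in> J" and e: "\<And>l. l \<in> J \<Longrightarrow> 0 \<le> e l"
    and g: "g j = alg_comb alg J e g"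
  shows "e j = 1"
proof -
  have fin: "finite J" and nn: "\<And>l. l \<in> J \<Longrightarrow> nonneg_vec (g l)"
    and nr: "g j \<notin> generated_cone alg (J - {j}) g" using irr j by (auto simp: irredundant_def)
  obtain i where i: "g j $ i > 0"
    using irredundant_nz[OF irr j] nn[OF j] by (auto simp: vec_eq_iff nonneg_vec_def less_le)
  have "e j * g j $ i \<le> g j $ i"
    using alg_comb_ge[of J e g j i alg] fin e nn j g by simp
  then have "e j \<le> 1" using i by simp
  moreover have "\<not> e j < 1"
  proof
    assume lt: "e j < 1"
    define R where "R = alg_comb alg (J - {j}) e g"
    have R: "R \<in> generated_cone alg (J - {j}) g" unfolding R_def generated_cone_def using e by auto
    have gR: "g j = vec_add alg (e j *\<^sub>R g j) R"
      unfolding R_def using g alg_comb_remove[OF fin j e nn] by simp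
    have nR: "nonneg_vec R" unfolding R_def using fin e nn by (intro nonneg_alg_comb) auto
    show False
    proof (cases alg)
      case Nonneg_Alg
      then have "R = (1 - e j) *\<^sub>R g j" using gR by (simp add: vec_add_Nonneg algebra_simps)
      then have "g j = inverse (1 - e j) *\<^sub>R R" using lt by simp
      moreover have "inverse (1 - e j) *\<^sub>R R = alg_comb alg (J - {j}) (\<lambda>l. inverse (1 - e j) * e l) g"
      proof -
        have "inverse (1 - e j) * alg_sum alg (\<lambda>l. e l * g l $ i) (J - {j})
            = alg_sum alg (\<lambda>l. inverse (1 - e j) * (e l * g l $ i)) (J - {j})" for i
          using fin lt e nn by (intro alg_sum_distrib_left) (auto simp: nonneg_vecD)
        then show ?thesis unfolding R_def vec_eq_iff by (simp add: alg_comb_nth mult.assoc)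
      qed
      ultimately have "g j \<in> generated_cone alg (J - {j}) g" unfolding generated_cone_def using lt e
        by (intro CollectI exI[of _ "\<lambda>l. inverse (1 - e j) * e l"]) auto
      with nr show False ..
    next
      case Max_Alg
      have "g j $ i = R $ i" for i
      proof -
        have m: "g j $ i = max (e j * g j $ i) (R $ i)"
          using gR Max_Alg by (metis alg_add.simps(2) vec_add_def vec_lambda_beta vector_scaleR_component real_scaleR_def)
        have "0 \<le> g j $ i" "0 \<le> R $ i" using nn[OF j] nR by (auto simp: nonneg_vecD)
        show ?thesis
        proof (cases "g j $ i = 0")
          case True
          with m \<open>0 \<le> R $ i\<close> show ?thesis by (simp add: max_def split: if_splits)
        next
          case False
          with \<open>0 \<le> g j $ i\<close> lt have "e j * g j $ i < g j $ i" by simp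
          with m show ?thesis by (auto simp: max_def split: if_splits)
        qed
      qed
      then have "g j = R" by (simp add: vec_eq_iff)
      with R nr show False by simp
    qed
  qed
  ultimately show ?thesis by simp
qed

text \<open>
  Extremality of irredundant generators: if a combination of elements of the cone gives \<open>g j\<close>, then one
  of them is already proportional to \<open>g j\<close>. The total coefficient of \<open>g j\<close> in the combination is \<open>1\<close>. In
  nonnegative algebra this leaves nothing for the other generators; in max algebra a
  term that attains the coefficient \<open>1\<close> lies both above and below \<open>g j\<close>.
\<close>

lemma irredundant_extremal:
  assumes irr: "irredundant alg J g" and j: "j \<in> J" and L: "finite L" and a: "\<And>l. l \<in> L \<Longrightarrow> 0 \<le> a l"
    and u: "\<And>l. l \<in> L \<Longrightarrow> u l \<in> generated_cone alg J g" and g: "g j = alg_comb alg L a u"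
  obtains l t where "l \<in> L" "t > 0" "u l = t *\<^sub>R g j"
proof -
  have fin: "finite J" and nn: "\<And>l. l \<in> J \<Longrightarrow> nonneg_vec (g l)" using irr by (auto simp: irredundant_def)
  have "\<forall>l\<in>L. \<exists>d. (\<forall>m\<in>J. 0 \<le> d m) \<and> u l = alg_comb alg J d g"
    using u unfolding generated_cone_def by blast
  then obtain d where d: "\<And>l. l \<in> L \<Longrightarrow> \<forall>m\<in>J. 0 \<le> d l m" "\<And>l. l \<in> L \<Longrightarrow> u l = alg_comb alg J (d l) g"
    by metis
  define e where "e m = alg_sum alg (\<lambda>l. a l * d l m) L" for m
  have e0: "0 \<le> e m" if "m \<in> J" for m unfolding e_def using a d that L by (intro alg_sum_nonneg) auto
  have "g j = alg_comb alg L a (\<lambda>l. alg_comb alg J (d l) g)" unfolding g by (intro alg_comb_cong) (auto simp: d)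
  also have "\<dots> = alg_comb alg J e g"
    unfolding e_def using L fin a d nn by (intro alg_comb_comb) auto
  finally have ge: "g j = alg_comb alg J e g" .
  have e1: "e j = 1" by (intro irredundant_coeff[OF irr j _ ge] e0)
  have nu: "nonneg_vec (u l)" if "l \<in> L" for l
    unfolding d(2)[OF that] using d(1)[OF that] fin nn by (intro nonneg_alg_comb) auto
  show thesis
  proof (cases alg)
    case Nonneg_Alg
    obtain l where l: "l \<in> L" "a l * d l j > 0"
      using alg_sum_pos_iff[of L "\<lambda>l. a l * d l j" alg] L a d(1) j e1 unfolding e_def by force
    have "g j = e j *\<^sub>R g j + alg_comb alg (J - {j}) e g"
      using ge alg_comb_remove[OF fin j e0 nn, where alg = alg] Nonneg_Alg by (simp add: vec_add_Nonneg)
    then have R0: "alg_comb alg (J - {j}) e g = 0" using e1 by simp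
    have z: "d l m * g m $ i = 0" if m: "m \<in> J - {j}" for m i
    proof -
      have "e m * g m $ i \<le> 0"
        using alg_comb_ge[of "J - {j}" e g m i alg] R0 e0 nn fin m by auto
      moreover have "a l * d l m \<le> e m"
        unfolding e_def using L a d l m by (intro alg_sum_ge[where f = "\<lambda>l. a l * d l m"]) auto
      moreover have "0 \<le> a l * d l m" "0 \<le> g m $ i" using l m a d nn by (auto simp: nonneg_vecD)
      ultimately have "a l * d l m * g m $ i = 0"
        using mult_right_mono[of "a l * d l m" "e m" "g m $ i"] mult_nonneg_nonneg[of "a l * d l m" "g m $ i"]
        by linarith
      then show ?thesis using l by auto
    qed
    have "alg_comb alg (J - {j}) (d l) g = 0"
    proof -
      have "alg_sum alg (\<lambda>m. d l m * g m $ i) (J - {j}) = alg_sum alg (\<lambda>_. 0) (J - {j})" for i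
        by (rule alg_sum_cong) (rule z)
      then show ?thesis by (simp add: vec_eq_iff alg_comb_nth)
    qed
    then have "u l = d l j *\<^sub>R g j"
      unfolding d(2)[OF l(1)] using alg_comb_remove[OF fin j, of "d l" g alg] d(1)[OF l(1)] nn Nonneg_Alg
      by (simp add: vec_add_Nonneg)
    moreover have "d l j > 0" using l a[OF l(1)] by (simp add: zero_less_mult_iff)
    ultimately show thesis using l that by blast
  next
    case Max_Alg
    have "L \<noteq> {}" using e1 unfolding e_def by auto
    then have "e j = Max ((\<lambda>l. a l * d l j) ` L)" unfolding e_def Max_Alg by simp
    then have "1 \<in> (\<lambda>l. a l * d l j) ` L"
      using Max_in[of "(\<lambda>l. a l * d l j) ` L"] L e1 \<open>L \<noteq> {}\<close> by simp
    then obtain l where l: "l \<in> L" "a l * d l j = 1" by auto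
    have "a l * u l $ i = g j $ i" for i
    proof (rule order_antisym)
      show "a l * u l $ i \<le> g j $ i"
        unfolding g using L a nu l(1) by (intro alg_comb_ge)
      have "d l j * g j $ i \<le> u l $ i"
        unfolding d(2)[OF l(1)] using fin d(1)[OF l(1)] nn j by (intro alg_comb_ge) auto
      then have "a l * (d l j * g j $ i) \<le> a l * u l $ i" using a l by (intro mult_left_mono) auto
      then show "g j $ i \<le> a l * u l $ i" using l(2) by (simp flip: mult.assoc)
    qed
    moreover have "a l > 0" using l a[OF l(1)] by (cases "a l = 0") auto
    ultimately have "u l = inverse (a l) *\<^sub>R g j"
      by (auto simp: vec_eq_iff field_simps)
    then show thesis using that[of l "inverse (a l)"] l \<open>a l > 0\<close> by simp
  qed
qed

lemma irredundant_exists: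
  fixes g :: "'j \<Rightarrow> real ^ 'n"
  assumes "finite J0" "\<And>j. j \<in> J0 \<Longrightarrow> nonneg_vec (g j)"
  obtains J where "J \<subseteq> J0" "irredundant alg J g" "generated_cone alg J g = generated_cone alg J0 g"
proof -
  let ?P = "\<lambda>J. J \<subseteq> J0 \<and> generated_cone alg J g = generated_cone alg J0 g"
  obtain J where J: "?P J" "\<And>J'. ?P J' \<Longrightarrow> card J \<le> card J'"
    using ex_has_least_nat[of ?P J0 card] by auto
  have fin: "finite J" using J assms finite_subset by blast
  have nn: "nonneg_vec (g j)" if "j \<in> J" for j using that J assms by auto
  have "g j \<notin> generated_cone alg (J - {j}) g" if j: "j \<in> J" for j
  proof
    assume mem: "g j \<in> generated_cone alg (J - {j}) g"
    have "g l \<in> generated_cone alg (J - {j}) g" if "l \<in> J" for l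
    proof (cases "l = j")
      case False
      then show ?thesis using scale_in_generated_cone[of "J - {j}" l g 1 alg] that fin nn by auto
    qed (use mem in auto)
    then have "generated_cone alg J g \<subseteq> generated_cone alg (J - {j}) g" using fin nn by (intro generated_cone_trans) auto
    moreover have "generated_cone alg (J - {j}) g \<subseteq> generated_cone alg J g"
      using fin nn scale_in_generated_cone[of J _ g 1 alg] by (intro generated_cone_trans) auto
    ultimately have "?P (J - {j})" using J(1) by auto
    from J(2)[OF this] fin j show False
      by (metis card_Diff1_less not_le)
  qed
  then have "irredundant alg J g" using fin nn by (auto simp: irredundant_def)
  with J(1) show thesis using that by blast
qed

text \<open>
  Extremality turns surjectivity of \<open>T\<close> on the core into a map \<open>\<phi>\<close> on the generators such that
  \<open>T (g (\<phi> j))\<close> is a positive multiple of \<open>g j\<close>. The sequence \<open>\<phi>\<^sup>n j\<close> runs into a cycle, whose members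
  are eigenvectors of a power of \<open>T\<close>; the generator \<open>g j\<close> is the image of one of them under a power of
  \<open>T\<close>, up to a factor, and inherits the eigenvector property.
\<close>

lemma core_eigen_generated:
  fixes A :: "real ^ 'n ^ 'n"
  assumes A: "nonneg_mat A"
  obtains J :: "'n set" and g where "\<And>j. j \<in> J \<Longrightarrow> nonneg_vec (g j) \<and> g j \<noteq> 0"
    "core alg A = generated_cone alg J g"
    "\<And>j. j \<in> J \<Longrightarrow> \<exists>m\<ge>1. \<exists>s>0. (mat_vec alg A ^^ m) (g j) = s *\<^sub>R g j"
proof -
  obtain G where G: "nonneg_mat G" "core alg A = mat_span alg G" by (rule core_finitely_generated[OF A])
  define g where "g j = column j G" for j
  have ng: "nonneg_vec (g j)" for j using G by (simp add: g_def nonneg_vec_def nonneg_mat_def column_def)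
  have "mat_span alg G = generated_cone alg UNIV g"
    unfolding mat_span_def generated_cone_def g_def alg_comb_def by auto
  moreover obtain J where "irredundant alg J g" "generated_cone alg J g = generated_cone alg UNIV g"
    by (rule irredundant_exists[of UNIV g alg]) (use ng in auto)
  ultimately have J: "irredundant alg J g" "core alg A = generated_cone alg J g" using G(2) by auto
  have fin: "finite J" by simp
  let ?T = "mat_vec alg A"
  have mem: "g j \<in> core alg A" if "j \<in> J" for j
    unfolding J(2) using scale_in_generated_cone[OF fin that ng, of 1] by simp
  have "\<exists>l\<in>J. \<exists>t>0. ?T (g l) = t *\<^sub>R g j" if j: "j \<in> J" for j
  proof -
    obtain y where y: "y \<in> core alg A" "?T y = g j" using core_surj[OF A mem[OF j]] by blast
    then obtain c where c: "\<forall>j\<in>J. 0 \<le> c j" "y = alg_comb alg J c g" unfolding J(2) generated_cone_def by auto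
    then have "g j = alg_comb alg J c (\<lambda>l. ?T (g l))"
      using y(2) fin A ng by (simp add: mat_vec_alg_comb)
    moreover have "?T (g l) \<in> generated_cone alg J g" if "l \<in> J" for l
      using mat_vec_core[OF A mem[OF that]] J(2) by simp
    ultimately obtain l t where "l \<in> J" "t > 0" "?T (g l) = t *\<^sub>R g j"
      using irredundant_extremal[OF J(1) j fin, of c "\<lambda>l. ?T (g l)" thesis] c(1) by auto
    then show ?thesis by blast
  qed
  then obtain \<phi> where \<phi>: "\<And>j. j \<in> J \<Longrightarrow> \<phi> j \<in> J" "\<And>j. j \<in> J \<Longrightarrow> \<exists>t>0. ?T (g (\<phi> j)) = t *\<^sub>R g j" by metis
  have orb: "(\<phi> ^^ n) j \<in> J \<and> (\<exists>s>0. (?T ^^ n) (g ((\<phi> ^^ n) j)) = s *\<^sub>R g j)" if "j \<in> J" for n j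
  proof (induction n)
    case (Suc n)
    then obtain s where s: "s > 0" "(?T ^^ n) (g ((\<phi> ^^ n) j)) = s *\<^sub>R g j" by auto
    from Suc \<phi>(2) obtain t where t: "t > 0" "?T (g (\<phi> ((\<phi> ^^ n) j))) = t *\<^sub>R g ((\<phi> ^^ n) j)" by blast
    have "(?T ^^ Suc n) (g ((\<phi> ^^ Suc n) j)) = (?T ^^ n) (t *\<^sub>R g ((\<phi> ^^ n) j))"
      using t by (simp add: funpow_swap1)
    also have "\<dots> = (t * s) *\<^sub>R g j" using t s A ng by (simp add: funpow_scale)
    finally show ?case using s t Suc \<phi>(1) by (auto intro!: exI[of _ "t * s"])
  qed (use that in \<open>auto intro!: exI[of _ 1]\<close>)
  have per: "\<exists>m\<ge>1. \<exists>s>0. (?T ^^ m) (g j) = s *\<^sub>R g j" if j: "j \<in> J" for j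
  proof -
    have "\<not> inj (\<lambda>n. (\<phi> ^^ n) j)"
    proof
      assume "inj (\<lambda>n. (\<phi> ^^ n) j)"
      then have "infinite (range (\<lambda>n. (\<phi> ^^ n) j))" by (rule range_inj_infinite)
      then show False by simp
    qed
    then obtain a b where ab: "a < b" "(\<phi> ^^ a) j = (\<phi> ^^ b) j"
      by (meson linorder_injI)
    define p where "p = (\<phi> ^^ a) j"
    have p: "p \<in> J" using orb[OF j] by (simp add: p_def)
    have "(\<phi> ^^ (b - a)) p = (\<phi> ^^ (b - a + a)) j" unfolding p_def by (simp only: funpow_add comp_apply)
    also have "\<dots> = p" using ab by (simp add: p_def)
    finally obtain s where s: "s > 0" "(?T ^^ (b - a)) (g p) = s *\<^sub>R g p" using orb[OF p, of "b - a"] by auto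
    obtain r where r: "r > 0" "(?T ^^ a) (g p) = r *\<^sub>R g j" using orb[OF j, of a] by (auto simp: p_def)
    have "r *\<^sub>R (?T ^^ (b - a)) (g j) = (?T ^^ (b - a)) ((?T ^^ a) (g p))"
      using r A ng by (simp add: funpow_scale)
    also have "\<dots> = (?T ^^ a) ((?T ^^ (b - a)) (g p))"
      by (metis add.commute comp_apply funpow_add)
    also have "\<dots> = s *\<^sub>R (r *\<^sub>R g j)" using s r A ng by (simp add: funpow_scale)
    finally have "r *\<^sub>R (?T ^^ (b - a)) (g j) = r *\<^sub>R (s *\<^sub>R g j)" by (simp add: mult.commute)
    then have "(?T ^^ (b - a)) (g j) = s *\<^sub>R g j" using r(1) by (simp only: scaleR_cancel_left) simp
    then show ?thesis using s ab by (intro exI[of _ "b - a"]) auto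
  qed
  show thesis
  proof (rule that)
    show "nonneg_vec (g j) \<and> g j \<noteq> 0" if "j \<in> J" for j using ng irredundant_nz[OF J(1) that] by simp
  qed (fact J(2), fact per)
qed

section \<open>Periodic orbits\<close>

lemma alg_sum_reindex:
  assumes "inj_on h S" shows "alg_sum alg f (h ` S) = alg_sum alg (\<lambda>i. f (h i)) S"
  using assms by (cases alg) (auto simp: sum.reindex image_image)

text \<open>
  The orbit of an eigenvector of \<open>A\<^sup>k\<close> with eigenvalue \<open>\<rho>\<^sup>k\<close>, rescaled by \<open>\<rho>\<close> in each step so that it
  becomes periodic. Integer times allow the orbit to be followed backwards.
\<close>

locale periodic_orbit =
  fixes alg :: algebra_kind and A :: "real ^ 'n ^ 'n" and \<rho> :: real and k :: nat and f :: "int \<Rightarrow> real ^ 'n"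
  assumes A: "nonneg_mat A" and rho: "0 < \<rho>" and k: "0 < k" and nonneg: "nonneg_vec (f t)"
    and step: "mat_vec alg A (f t) = \<rho> *\<^sub>R f (t + 1)" and period: "f (t + int k) = f t"
begin

lemma nonneg_nth: "0 \<le> f t $ i"
  using nonneg by (rule nonneg_vecD)

lemma period_mult: "f (t + int k * z) = f t"
proof (induction z rule: int_induct[where k = 0])
  case (step1 i)
  then show ?case using period[of "t + int k * i"] by (simp add: algebra_simps)
next
  case (step2 i)
  then show ?case using period[of "t + int k * (i - 1)"] by (simp add: algebra_simps)
qed simp

lemma period_mod: "f (t mod int k) = f t"
  using period_mult[of "t mod int k" "t div int k"] by (simp add: add.commute)

lemma funpow_orbit: "(mat_vec alg A ^^ n) (f t) = \<rho> ^ n *\<^sub>R f (t + int n)"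
proof (induction n)
  case (Suc n)
  have "(mat_vec alg A ^^ Suc n) (f t) = mat_vec alg A (\<rho> ^ n *\<^sub>R f (t + int n))" using Suc by simp
  also have "\<dots> = \<rho> ^ Suc n *\<^sub>R f (t + int n + 1)"
    using rho A by (simp add: mat_vec_scale nonneg step mult.commute)
  finally show ?case by (simp add: add_ac)
qed simp

lemma edge_le: "A $ i $ j * f t $ j \<le> \<rho> * f (t + 1) $ i"
  using mat_vec_ge[OF A nonneg, of i j t alg] by (simp add: step)

definition orbit_sum :: "real ^ 'n" where
  "orbit_sum = alg_comb alg {..<k} (\<lambda>_. 1) (\<lambda>s. f (int s))"

lemma nonneg_orbit_sum: "nonneg_vec orbit_sum"
  unfolding orbit_sum_def using nonneg by (intro nonneg_alg_comb) auto

lemma orbit_sum_ge: "f t $ i \<le> orbit_sum $ i"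
proof -
  have "1 * f (int (nat (t mod int k))) $ i \<le> orbit_sum $ i"
    unfolding orbit_sum_def using nonneg k
    by (intro alg_comb_ge[where g = "\<lambda>s. f (int s)" and c = "\<lambda>_. 1"]) (auto simp: nat_less_iff)
  then show ?thesis using k by (simp add: period_mod)
qed

lemma orbit_sum_pos_iff: "0 < orbit_sum $ i \<longleftrightarrow> (\<exists>t. 0 < f t $ i)"
proof
  assume "0 < orbit_sum $ i"
  then show "\<exists>t. 0 < f t $ i"
    unfolding orbit_sum_def alg_comb_nth by (subst (asm) alg_sum_pos_iff) (auto simp: nonneg_nth)
next
  assume "\<exists>t. 0 < f t $ i"
  then show "0 < orbit_sum $ i" using orbit_sum_ge less_le_trans by blast
qed

lemma orbit_sum_eigen: "mat_vec alg A orbit_sum = \<rho> *\<^sub>R orbit_sum"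
proof -
  have "(\<lambda>s. Suc s mod k) ` {..<k} \<subseteq> {..<k}" "inj_on (\<lambda>s. Suc s mod k) {..<k}"
    using k by (auto simp: inj_on_def mod_Suc split: if_splits)
  then have shift: "inj_on (\<lambda>s. Suc s mod k) {..<k}" "(\<lambda>s. Suc s mod k) ` {..<k} = {..<k}"
    by (simp_all add: endo_inj_surj)
  have "alg_sum alg (\<lambda>s. f (int s + 1) $ i) {..<k} = alg_sum alg (\<lambda>s. f (int (Suc s mod k)) $ i) {..<k}" for i
    by (simp add: zmod_int period_mod add.commute)
  also have "\<dots>i = alg_sum alg (\<lambda>s. f (int s) $ i) {..<k}" for i
    using alg_sum_reindex[OF shift(1), of alg "\<lambda>s. f (int s) $ i"] shift(2) by simp
  finally have eq: "alg_sum alg (\<lambda>s. f (int s + 1) $ i) {..<k} = alg_sum alg (\<lambda>s. f (int s) $ i) {..<k}" for i .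
  have "mat_vec alg A orbit_sum = alg_comb alg {..<k} (\<lambda>_. 1) (\<lambda>s. \<rho> *\<^sub>R f (int s + 1))"
    unfolding orbit_sum_def using A nonneg by (simp add: mat_vec_alg_comb step)
  also have "\<dots> = \<rho> *\<^sub>R orbit_sum"
    unfolding orbit_sum_def vec_eq_iff alg_comb_nth vector_scaleR_component
    using rho by (simp add: alg_sum_distrib_left[symmetric] nonneg_nth eq)
  finally show ?thesis .
qed

lemma orbit_sum_nz: "f t \<noteq> 0 \<Longrightarrow> orbit_sum \<noteq> 0"
  using orbit_sum_pos_iff nonneg_nth[of t] by (metis less_le vec_eq_iff zero_index)

lemma eigenvalue_rho: "f t \<noteq> 0 \<Longrightarrow> \<rho> \<in> Lambda alg A"
  unfolding Lambda_def eigenvalue_def using rho nonneg_orbit_sum orbit_sum_nz orbit_sum_eigen by force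

text \<open>
  Iterating the inequality \<open>k\<close> times returns to the initial value, so all inequalities on the way are equalities.
\<close>

lemma shift_le_imp_eq:
  assumes le: "\<And>t. f t $ i \<le> f (t + s) $ i" shows "f (t + s) $ i = f t $ i"
proof (rule order_antisym)
  have "f t $ i \<le> f (t + s * int m) $ i" for m t
  proof (induction m)
    case (Suc m)
    with le[of "t + s * int m"] show ?case by (simp add: algebra_simps)
  qed simp
  from this[of "t + s" "k - 1"] have "f (t + s) $ i \<le> f (t + s + s * (int k - 1)) $ i"
    using k by (simp add: of_nat_diff)
  also have "t + s + s * (int k - 1) = t + int k * s" by (simp add: algebra_simps)
  finally show "f (t + s) $ i \<le> f t $ i" by (simp add: period_mult)
qed (rule le)

end

lemma periodic_orbit_exists:
  assumes A: "nonneg_mat A" and rho: "0 < \<rho>" and k: "0 < k" and x: "nonneg_vec x"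
    and eig: "(mat_vec alg A ^^ k) x = \<rho> ^ k *\<^sub>R x"
  obtains f where "periodic_orbit alg A \<rho> k f" "f 0 = x"
proof -
  define f where "f t = inverse (\<rho> ^ nat (t mod int k)) *\<^sub>R (mat_vec alg A ^^ nat (t mod int k)) x" for t :: int
  have "periodic_orbit alg A \<rho> k f"
  proof
    fix t
    show "nonneg_vec (f t)" unfolding f_def using rho A x by (simp add: nonneg_vec_scale nonneg_funpow)
    show "f (t + int k) = f t" by (simp add: f_def)
    define m where "m = nat (t mod int k)"
    have m: "m < k" "t mod int k = int m" using k by (auto simp: m_def nat_less_iff)
    have "(t + 1) mod int k = (int m + 1) mod int k" by (metis m(2) mod_add_left_eq)
    then have m1: "(t + 1) mod int k = (if Suc m = k then 0 else int (Suc m))"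
      using m(1) by (auto simp: add.commute)
    have "mat_vec alg A (f t) = inverse (\<rho> ^ m) *\<^sub>R (mat_vec alg A ^^ Suc m) x"
      unfolding f_def using rho A x by (simp add: m(2) mat_vec_scale nonneg_funpow)
    also have "\<dots> = \<rho> *\<^sub>R f (t + 1)"
    proof (cases "Suc m = k")
      case True
      then have "inverse (\<rho> ^ m) *\<^sub>R (mat_vec alg A ^^ Suc m) x = (inverse (\<rho> ^ m) * \<rho> ^ Suc m) *\<^sub>R x"
        using eig by simp
      also have "inverse (\<rho> ^ m) * \<rho> ^ Suc m = \<rho>" using rho by simp
      finally show ?thesis using True by (simp add: f_def m1)
    next
      case False
      then show ?thesis using rho by (simp add: f_def m1 nat_add_distrib del: funpow.simps of_nat_Suc)
    qed
    finally show "mat_vec alg A (f t) = \<rho> *\<^sub>R f (t + 1)" .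
  qed (use assms in auto)
  moreover have "f 0 = x" by (simp add: f_def)
  ultimately show thesis by (rule that)
qed

text \<open>
  The sum of the orbit of an eigenvector of \<open>A\<^sup>k\<close> is an eigenvector of \<open>A\<close>; it is nonzero
  since there are no cancellations.
\<close>

lemma root_in_Lambda:
  assumes "nonneg_mat A" "0 < k" "0 < r" "nonneg_vec x" "x \<noteq> 0" "(mat_vec alg A ^^ k) x = r *\<^sub>R x"
  shows "root k r \<in> Lambda alg A"
proof -
  have "(mat_vec alg A ^^ k) x = root k r ^ k *\<^sub>R x" using assms by simp
  then obtain f where "periodic_orbit alg A (root k r) k f" "f 0 = x"
    using periodic_orbit_exists[OF assms(1) _ assms(2,4), of "root k r"] assms(2,3) by auto
  then show ?thesis using periodic_orbit.eigenvalue_rho assms(5) by metis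
qed

lemma Lambda_pow_root:
  assumes A: "nonneg_mat A" and k: "0 < k" and r: "r \<in> Lambda alg (mat_pow alg A k)"
  obtains \<rho> where "\<rho> \<in> Lambda alg A" "r = \<rho> ^ k"
proof -
  from r obtain x where x: "nonneg_vec x" "x \<noteq> 0" "(mat_vec alg A ^^ k) x = r *\<^sub>R x" and "0 < r"
    by (auto simp: Lambda_def eigenvalue_def mat_vec_mat_pow[OF A])
  with A k have "root k r \<in> Lambda alg A" "r = root k r ^ k" by (auto intro: root_in_Lambda)
  then show thesis by (rule that)
qed

lemma Lambda_pow:
  assumes A: "nonneg_mat A" and r: "\<rho> \<in> Lambda alg A"
  shows "\<rho> ^ k \<in> Lambda alg (mat_pow alg A k)"
proof -
  from r obtain x where x: "nonneg_vec x" "x \<noteq> 0" "mat_vec alg A x = \<rho> *\<^sub>R x" and "0 < \<rho>"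
    by (auto simp: Lambda_def eigenvalue_def)
  then have "(mat_vec alg A ^^ (1 * k)) x = \<rho> ^ k *\<^sub>R x" using A by (intro funpow_eigen) auto
  with x \<open>0 < \<rho>\<close> show ?thesis by (auto simp: Lambda_def eigenvalue_def mat_vec_mat_pow[OF A])
qed

lemma core_subset_cone_sum:
  fixes A :: "real ^ 'n ^ 'n"
  assumes A: "nonneg_mat A"
  shows "core alg A \<subseteq> cone_sum alg ({1..} \<times> Lambda alg A) (\<lambda>(k, \<rho>). eigencone alg (mat_pow alg A k) (\<rho> ^ k))"
proof
  fix x assume x: "x \<in> core alg A"
  obtain J :: "'n set" and g where J: "\<And>j. j \<in> J \<Longrightarrow> nonneg_vec (g j) \<and> g j \<noteq> 0" "core alg A = generated_cone alg J g"
    "\<And>j. j \<in> J \<Longrightarrow> \<exists>m\<ge>1. \<exists>s>0. (mat_vec alg A ^^ m) (g j) = s *\<^sub>R g j"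
    by (rule core_eigen_generated[OF A, where alg = alg]) blast
  from x J(2) obtain c where c: "\<forall>j\<in>J. 0 \<le> c j" "x = alg_comb alg J c g" unfolding generated_cone_def by auto
  show "x \<in> cone_sum alg ({1..} \<times> Lambda alg A) (\<lambda>(k, \<rho>). eigencone alg (mat_pow alg A k) (\<rho> ^ k))"
    unfolding c
  proof (rule alg_comb_in_cone_sum)
    fix j assume j: "j \<in> J"
    obtain m s where m: "m \<ge> 1" "s > 0" "(mat_vec alg A ^^ m) (g j) = s *\<^sub>R g j" using J(3)[OF j] by blast
    then have "root m s \<in> Lambda alg A" using J(1)[OF j] A by (intro root_in_Lambda) auto
    moreover have "c j *\<^sub>R g j \<in> eigencone alg (mat_pow alg A m) (root m s ^ m)"
      unfolding eigencone_pow_iff[OF A] using c(1) j J(1)[OF j] m A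
      by (simp add: nonneg_vec_scale funpow_scale mult.commute)
    ultimately show "c j *\<^sub>R g j \<in> (\<Union>(k, \<rho>)\<in>{1..} \<times> Lambda alg A. eigencone alg (mat_pow alg A k) (\<rho> ^ k))"
      using m(1) by (intro UN_I[of "(m, root m s)"]) auto
  qed (use c J in auto)
qed

section \<open>The access relation and the classes\<close>

lemma alg_sum_subset_mono:
  assumes "finite S" "T \<subseteq> S" "\<And>i. i \<in> S \<Longrightarrow> 0 \<le> f i"
  shows "alg_sum alg f T \<le> alg_sum alg f S"
proof -
  have "alg_sum alg f T = alg_sum alg (\<lambda>i. if i \<in> T then f i else 0) T" by (intro alg_sum_cong) auto
  also have "\<dots> = alg_sum alg (\<lambda>i. if i \<in> T then f i else 0) S"
    using assms by (intro alg_sum_mono_neutral[symmetric]) auto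
  also have "\<dots> \<le> alg_sum alg f S" using assms by (intro alg_sum_mono) auto
  finally show ?thesis .
qed

lemma mat_digraph_on_simps [simp]:
  "verts (mat_digraph_on N A) = N" "arcs (mat_digraph_on N A) = {(i, j). i \<in> N \<and> j \<in> N \<and> A $ i $ j \<noteq> 0}"
  "arcs_ends (mat_digraph_on N A) = {(i, j). i \<in> N \<and> j \<in> N \<and> A $ i $ j \<noteq> 0}"
  "tail (mat_digraph_on N A) = fst" "head (mat_digraph_on N A) = snd"
  by (simp_all add: mat_digraph_on_def)

lemma fin_digraph_mat: "fin_digraph (mat_digraph_on N (A :: real ^ 'n ^ 'n))"
  by unfold_locales (auto intro: finite_subset[of _ UNIV])

lemma wf_digraph_mat: "wf_digraph (mat_digraph_on N (A :: real ^ 'n ^ 'n))"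
  using fin_digraph_mat fin_digraph.axioms(1) by blast

abbreviation access :: "real ^ 'n ^ 'n \<Rightarrow> 'n \<Rightarrow> 'n \<Rightarrow> bool" where
  "access A i j \<equiv> i \<rightarrow>\<^sup>*\<^bsub>mat_digraph A\<^esub> j"

lemma access_refl [simp]: "access A i i"
  by (simp add: wf_digraph.reachable_refl[OF wf_digraph_mat])

lemma access_trans: "access A i j \<Longrightarrow> access A j l \<Longrightarrow> access A i l"
  by (rule wf_digraph.reachable_trans[OF wf_digraph_mat])

lemma access_edge: "A $ i $ j \<noteq> 0 \<Longrightarrow> access A i j"
  by (rule wf_digraph.reachable_adjI[OF wf_digraph_mat]) simp

lemma access_backward_induct [consumes 1, case_names refl edge]:
  assumes "access A i j" "P j" "\<And>a b. A $ a $ b \<noteq> 0 \<Longrightarrow> access A b j \<Longrightarrow> P b \<Longrightarrow> P a"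
  shows "P i"
  using assms(1)
  by (induction rule: wf_digraph.converse_reachable_induct[OF wf_digraph_mat[of UNIV A]]) (use assms in auto)

lemma access_forward_induct [consumes 1, case_names refl edge]:
  assumes "access A i j" "P i" "\<And>a b. access A i a \<Longrightarrow> A $ a $ b \<noteq> 0 \<Longrightarrow> P a \<Longrightarrow> P b"
  shows "P j"
  using assms(1)
  by (induction rule: wf_digraph.reachable_induct[OF wf_digraph_mat[of UNIV A]]) (use assms in auto)

definition class_of :: "real ^ 'n ^ 'n \<Rightarrow> 'n \<Rightarrow> 'n set" where
  "class_of A i = pre_digraph.scc_of (mat_digraph A) i"

lemma mem_class_of: "j \<in> class_of A i \<longleftrightarrow> access A i j \<and> access A j i"
  by (simp add: class_of_def pre_digraph.scc_of_def)

lemma self_class_of [simp]: "i \<in> class_of A i"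
  by (simp add: mem_class_of)

lemma classes_eq: "classes A = range (class_of A)"
  unfolding classes_def class_of_def wf_digraph.sccs_verts_conv_scc_of[OF wf_digraph_mat] by simp

lemma class_of_in_classes [simp]: "class_of A i \<in> classes A"
  by (simp add: classes_eq)

lemma class_of_eq: "j \<in> class_of A i \<Longrightarrow> class_of A j = class_of A i"
  by (auto simp: mem_class_of intro: access_trans)

lemma class_eq_class_of: "\<mu> \<in> classes A \<Longrightarrow> i \<in> \<mu> \<Longrightarrow> \<mu> = class_of A i"
  by (auto simp: classes_eq class_of_eq)

lemma class_access: "\<mu> \<in> classes A \<Longrightarrow> i \<in> \<mu> \<Longrightarrow> j \<in> \<mu> \<Longrightarrow> access A i j"
  using class_eq_class_of mem_class_of by blast

lemma class_nonempty: "\<mu> \<in> classes A \<Longrightarrow> \<exists>i. i \<in> \<mu>"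
  unfolding classes_eq using self_class_of by blast

lemma class_memI: "\<mu> \<in> classes A \<Longrightarrow> i \<in> \<mu> \<Longrightarrow> access A i j \<Longrightarrow> access A j i \<Longrightarrow> j \<in> \<mu>"
  using class_eq_class_of mem_class_of by blast

lemma class_accesses_iff:
  assumes "\<mu> \<in> classes A" "\<nu> \<in> classes A" "i \<in> \<mu>" "j \<in> \<nu>"
  shows "class_accesses A \<mu> \<nu> \<longleftrightarrow> access A i j"
proof
  assume "class_accesses A \<mu> \<nu>"
  then consider "\<mu> = \<nu>" | a b where "a \<in> \<mu>" "b \<in> \<nu>" "access A a b" unfolding class_accesses_def by blast
  then show "access A i j"
  proof cases
    case 1
    with assms show ?thesis using class_access by blast
  next
    case 2
    then show ?thesis using assms class_access access_trans by metis
  qed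
qed (use assms class_accesses_def in blast)

text \<open>
  Walks between two nodes of a class do not leave the class, so a property that passes from the head to the
  tail of the edges inside the class spreads from one node to all of them.
\<close>

lemma class_backward_induct:
  assumes \<mu>: "\<mu> \<in> classes A" "i \<in> \<mu>" "j \<in> \<mu>" and "P j"
    and stp: "\<And>a b. a \<in> \<mu> \<Longrightarrow> b \<in> \<mu> \<Longrightarrow> A $ a $ b \<noteq> 0 \<Longrightarrow> P b \<Longrightarrow> P a"
  shows "P i"
proof -
  have "access A j i \<longrightarrow> P i"
    using class_access[OF \<mu>]
  proof (induction rule: access_backward_induct)
    case (edge a b)
    show ?case
    proof
      assume "access A j a"
      then have "access A j b" using edge access_edge access_trans by blast
      moreover from edge have "access A a j" using access_edge access_trans by blast
      ultimately have "a \<in> \<mu>" "b \<in> \<mu>" using \<open>access A j a\<close> edge class_memI[OF \<mu>(1,3)] by auto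
      with edge stp \<open>access A j b\<close> show "P a" by blast
    qed
  qed (use assms in auto)
  then show ?thesis using class_access[OF \<mu>(1) \<mu>(3) \<mu>(2)] by simp
qed

lemma class_forward_induct:
  assumes \<mu>: "\<mu> \<in> classes A" "i \<in> \<mu>" "j \<in> \<mu>" and "P i"
    and stp: "\<And>a b. a \<in> \<mu> \<Longrightarrow> b \<in> \<mu> \<Longrightarrow> A $ a $ b \<noteq> 0 \<Longrightarrow> P a \<Longrightarrow> P b"
  shows "P j"
proof (rule ccontr)
  assume "\<not> P j"
  then have "\<not> P i"
    by (rule class_backward_induct[OF \<mu>, where P = "\<lambda>a. \<not> P a"]) (use stp in blast)
  with \<open>P i\<close> show False by simp
qed

section \<open>Perron roots of classes\<close>

lemma class_subeigenvector_pos: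
  fixes A :: "real ^ 'n ^ 'n"
  assumes A: "nonneg_mat A" and \<mu>: "\<mu> \<in> classes A" and v: "\<And>i. i \<in> \<mu> \<Longrightarrow> 0 \<le> v i"
    and nz: "\<exists>i\<in>\<mu>. v i \<noteq> 0" and sub: "\<And>i. i \<in> \<mu> \<Longrightarrow> alg_sum alg (\<lambda>j. A $ i $ j * v j) \<mu> \<le> r * v i"
    and i: "i \<in> \<mu>"
  shows "0 < v i"
proof -
  from nz v obtain j where "j \<in> \<mu>" "0 < v j" by force
  with \<mu> i show ?thesis
  proof (rule class_backward_induct)
    fix a b assume ab: "a \<in> \<mu>" "b \<in> \<mu>" "A $ a $ b \<noteq> 0" "0 < v b"
    then have "0 < A $ a $ b * v b" using A by (simp add: less_le nonneg_matD)
    also have "\<dots> \<le> alg_sum alg (\<lambda>j. A $ a $ j * v j) \<mu>"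
      using A v ab by (intro alg_sum_ge[where f = "\<lambda>j. A $ a $ j * v j"]) (auto simp: nonneg_matD)
    also have "\<dots> \<le> r * v a" by (rule sub) fact
    finally show "0 < v a" using v[OF ab(1)] by (cases "v a = 0") auto
  qed
qed

text \<open>
  Scale \<open>w\<close> by the least \<open>\<alpha>\<close> with \<open>v \<le> \<alpha> w\<close> and compare the two sides at a node where \<open>v = \<alpha> w\<close>. Only monotonicity
  and homogeneity are used, which hold in both algebras. The contact node is returned for the
  discussion of the case \<open>r = s\<close>.
\<close>

lemma collatz_wielandt:
  fixes A :: "real ^ 'n ^ 'n"
  assumes A: "nonneg_mat A" and v: "\<And>i. i \<in> \<mu> \<Longrightarrow> 0 \<le> v i" "\<exists>i\<in>\<mu>. v i \<noteq> 0"
    and eig: "\<And>i. i \<in> \<mu> \<Longrightarrow> alg_sum alg (\<lambda>j. A $ i $ j * v j) \<mu> = r * v i"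
    and w: "\<And>i. i \<in> \<mu> \<Longrightarrow> 0 < w i"
    and sub: "\<And>i. i \<in> \<mu> \<Longrightarrow> alg_sum alg (\<lambda>j. A $ i $ j * w j) \<mu> \<le> s * w i"
  obtains \<alpha> i where "0 < \<alpha>" "\<And>j. j \<in> \<mu> \<Longrightarrow> v j \<le> \<alpha> * w j" "i \<in> \<mu>" "v i = \<alpha> * w i" "r \<le> s"
proof -
  define \<alpha> where "\<alpha> = Max ((\<lambda>i. v i / w i) ` \<mu>)"
  have "\<alpha> \<in> (\<lambda>i. v i / w i) ` \<mu>" unfolding \<alpha>_def using v(2) by (intro Max_in) auto
  then obtain i where i: "i \<in> \<mu>" "\<alpha> = v i / w i" by auto
  have le: "v j / w j \<le> \<alpha>" if "j \<in> \<mu>" for j unfolding \<alpha>_def using that by (intro Max_ge) auto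
  have vle: "v j \<le> \<alpha> * w j" if "j \<in> \<mu>" for j 
    using le[OF that] w[OF that] by (simp add: pos_divide_le_eq)
  from v obtain l where l: "l \<in> \<mu>" "0 < v l" by force
  then have "0 < v l / w l" using w by simp
  then have pos: "0 < \<alpha>" using le[OF l(1)] by simp
  have vi: "v i = \<alpha> * w i" using i w[OF i(1)] by simp
  have "r * v i \<le> alg_sum alg (\<lambda>j. \<alpha> * (A $ i $ j * w j)) \<mu>"
    unfolding eig[OF i(1), symmetric] using A v vle
    by (intro alg_sum_mono) (auto simp: nonneg_matD mult.left_commute[of \<alpha>] mult_left_mono)
  also have "\<dots> = \<alpha> * alg_sum alg (\<lambda>j. A $ i $ j * w j) \<mu>"
    using A w pos by (intro alg_sum_distrib_left[symmetric]) (auto simp: nonneg_matD less_imp_le)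
  also have "\<dots> \<le> \<alpha> * (s * w i)" using sub[OF i(1)] pos by simp
  also have "\<dots> = s * v i" using vi by simp
  finally have le_rs: "r \<le> s" using pos w[OF i(1)] vi by simp
  show thesis by (rule that[of \<alpha> i]) (fact pos, fact vle, fact i(1), fact vi, fact le_rs)
qed

lemma submatrix_eigenvalue_le:
  fixes A :: "real ^ 'n ^ 'n"
  assumes "nonneg_mat A" "submatrix_eigenvalue alg A \<mu> r" "\<And>i. i \<in> \<mu> \<Longrightarrow> 0 < w i"
    "\<And>i. i \<in> \<mu> \<Longrightarrow> alg_sum alg (\<lambda>j. A $ i $ j * w j) \<mu> \<le> s * w i"
  shows "r \<le> s"
proof -
  from assms(2) obtain v where "\<And>i. i \<in> \<mu> \<Longrightarrow> 0 \<le> v i" "\<exists>i\<in>\<mu>. v i \<noteq> 0"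
    "\<And>i. i \<in> \<mu> \<Longrightarrow> alg_sum alg (\<lambda>j. A $ i $ j * v j) \<mu> = r * v i"
    unfolding submatrix_eigenvalue_def by blast
  from collatz_wielandt[OF assms(1) this assms(3,4)] show ?thesis by auto
qed

lemma submatrix_eigenvalue_unique:
  fixes A :: "real ^ 'n ^ 'n"
  assumes A: "nonneg_mat A" and \<mu>: "\<mu> \<in> classes A"
    and r: "submatrix_eigenvalue alg A \<mu> r" and s: "submatrix_eigenvalue alg A \<mu> s"
  shows "r = s"
proof -
  have le: "r \<le> s" if r: "submatrix_eigenvalue alg A \<mu> r" and s: "submatrix_eigenvalue alg A \<mu> s" for r s
  proof -
    from s obtain v where v: "\<And>i. i \<in> \<mu> \<Longrightarrow> 0 \<le> v i" "\<exists>i\<in>\<mu>. v i \<noteq> 0"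
      "\<And>i. i \<in> \<mu> \<Longrightarrow> alg_sum alg (\<lambda>j. A $ i $ j * v j) \<mu> = s * v i"
      unfolding submatrix_eigenvalue_def by blast
    have "0 < v i" if "i \<in> \<mu>" for i
      by (rule class_subeigenvector_pos[OF A \<mu> v(1,2) _ that, where alg = alg and r = "s"]) (simp_all add: v(3))
    then show ?thesis using submatrix_eigenvalue_le[OF A r, of v s] v(3) by simp
  qed
  from le[OF r s] le[OF s r] show ?thesis by simp
qed

lemma continuous_alg_sum:
  fixes g :: "'a::metric_space \<Rightarrow> 'i \<Rightarrow> real"
  assumes "finite J" "\<And>x j. x \<in> S \<Longrightarrow> j \<in> J \<Longrightarrow> 0 \<le> g x j" "\<And>j. j \<in> J \<Longrightarrow> continuous_on S (\<lambda>x. g x j)"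
  shows "continuous_on S (\<lambda>x. alg_sum alg (g x) J)"
  unfolding continuous_on_sequentially comp_def
proof (intro allI ballI impI)
  fix x a assume xa: "a \<in> S" "(\<forall>n. x n \<in> S) \<and> x \<longlonglongrightarrow> a"
  show "(\<lambda>n. alg_sum alg (g (x n)) J) \<longlonglongrightarrow> alg_sum alg (g a) J"
    using assms xa by (intro tendsto_alg_sum) (auto simp: continuous_on_sequentially comp_def)
qed

text \<open>
  If every column of the principal submatrix has a nonzero entry, the map \<open>x \<mapsto> A x / |A x|\<close> is defined and continuous
  on the simplex, and a fixed point from Brouwer's theorem is an eigenvector. In either algebra
  this needs nothing more than continuity. If some column vanishes, no edge of the class enters its
  node, so the class is a single node without a loop, with eigenvalue \<open>0\<close>.
\<close>

lemma submatrix_eigenvalue_exists: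
  fixes A :: "real ^ 'n ^ 'n"
  assumes A: "nonneg_mat A" and \<mu>: "\<mu> \<in> classes A"
  shows "\<exists>r. submatrix_eigenvalue alg A \<mu> r"
proof (cases "\<forall>j\<in>\<mu>. \<exists>i\<in>\<mu>. A $ i $ j \<noteq> 0")
  case False
  then obtain j where j: "j \<in> \<mu>" "\<And>i. i \<in> \<mu> \<Longrightarrow> A $ i $ j = 0" by blast
  have "\<mu> = {j}"
  proof (rule ccontr)
    assume "\<mu> \<noteq> {j}"
    with j obtain i where i: "i \<in> \<mu>" "i \<noteq> j" by blast
    have "j \<noteq> j"
      by (rule class_forward_induct[where P = "\<lambda>a. a \<noteq> j", OF \<mu> i(1) j(1) i(2)]) (use j in blast)
    then show False by simp
  qed
  moreover have "A $ j $ j = 0" using j by blast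
  ultimately have "submatrix_eigenvalue alg A \<mu> 0"
    unfolding submatrix_eigenvalue_def by (cases alg) (auto intro!: exI[of _ "\<lambda>_. 1"])
  then show ?thesis ..
next
  case True
  define S where "S = {x :: real ^ 'n. (\<forall>i. 0 \<le> x $ i) \<and> (\<forall>i\<in>-\<mu>. x $ i = 0) \<and> (\<Sum>i\<in>UNIV. x $ i) = 1}"
  define g where "g i x = alg_sum alg (\<lambda>j. A $ i $ j * x $ j) \<mu>" for i and x :: "real ^ 'n"
  define D where "D x = (\<Sum>i\<in>\<mu>. g i x)" for x
  define F where "F x = (\<chi> i. if i \<in> \<mu> then g i x / D x else 0)" for x
  have g0: "0 \<le> g i x" if "x \<in> S" for i x
    unfolding g_def using A that by (intro alg_sum_nonneg) (auto simp: S_def nonneg_matD)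
  have D0: "0 < D x" if x: "x \<in> S" for x
  proof -
    have "\<exists>j. x $ j \<noteq> 0"
    proof (rule ccontr)
      assume "\<not> ?thesis"
      then show False using x by (simp add: S_def)
    qed
    then obtain j where j: "x $ j \<noteq> 0" by blast
    then have "j \<in> \<mu>" "0 < x $ j" using x by (auto simp: S_def less_le)
    moreover from True \<open>j \<in> \<mu>\<close> obtain i where i: "i \<in> \<mu>" "A $ i $ j \<noteq> 0" by blast
    ultimately have "0 < A $ i $ j * x $ j" using A by (simp add: less_le nonneg_matD)
    also have "\<dots> \<le> g i x"
      unfolding g_def using x A \<open>j \<in> \<mu>\<close>
      by (intro alg_sum_ge[where f = "\<lambda>j. A $ i $ j * x $ j"]) (auto simp: S_def nonneg_matD)
    also have "\<dots> \<le> D x" unfolding D_def using i g0[OF x] by (intro member_le_sum) auto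
    finally show ?thesis .
  qed
  have "convex S"
    unfolding convex_def S_def by (auto simp: sum.distrib simp flip: sum_distrib_left)
  moreover have "compact S"
  proof (subst compact_eq_bounded_closed, intro conjI)
    have "x $ i \<le> 1" if "x \<in> S" for x i
      using that member_le_sum[of i UNIV "\<lambda>i. x $ i"] by (simp add: S_def)
    then have "S \<subseteq> cbox 0 (\<chi> i. 1)" by (auto simp: mem_box_cart S_def)
    then show "bounded S" using bounded_cbox bounded_subset by blast
    have "S = (\<Inter>i. {x. 0 \<le> x $ i}) \<inter> (\<Inter>i\<in>-\<mu>. {x. x $ i = 0}) \<inter> {x. (\<Sum>i\<in>UNIV. x $ i) = 1}"
      by (auto simp: S_def)
    also have "closed \<dots>"
      by (intro closed_Int closed_INT ballI closed_Collect_le closed_Collect_eq continuous_intros)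
    finally show "closed S" .
  qed
  moreover have "S \<noteq> {}"
  proof -
    obtain i where "i \<in> \<mu>" using class_nonempty[OF \<mu>] by blast
    then have "axis i 1 \<in> S" by (auto simp: S_def axis_def)
    then show ?thesis by blast
  qed
  moreover have "continuous_on S F"
  proof -
    have cg: "continuous_on S (g i)" for i
      unfolding g_def using A
      by (intro continuous_alg_sum continuous_intros) (auto simp: S_def nonneg_matD)
    show ?thesis unfolding F_def
    proof (intro continuous_on_vec_lambda)
      fix i
      show "continuous_on S (\<lambda>x. if i \<in> \<mu> then g i x / D x else 0)"
        using D0 cg unfolding D_def
        by (cases "i \<in> \<mu>") (auto intro!: continuous_intros dest: less_imp_neq[symmetric])
    qed
  qed
  moreover have "F \<in> S \<rightarrow> S"
  proof
    fix x assume x: "x \<in> S"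
    have "(\<Sum>i\<in>UNIV. if i \<in> \<mu> then g i x / D x else 0) = (\<Sum>i\<in>\<mu>. g i x / D x)"
      by (simp flip: sum.inter_restrict)
    also have "\<dots> = 1" using D0[OF x] by (simp add: D_def flip: sum_divide_distrib)
    finally show "F x \<in> S" using g0[OF x] D0[OF x] by (auto simp: S_def F_def)
  qed
  ultimately obtain x where x: "x \<in> S" "F x = x" by - (rule brouwer[of S F]; assumption)
  have "alg_sum alg (\<lambda>j. A $ i $ j * x $ j) \<mu> = D x * x $ i" if "i \<in> \<mu>" for i
  proof -
    have "F x $ i = g i x / D x" using that by (simp add: F_def)
    then have "x $ i = g i x / D x" using x(2) by simp
    then show ?thesis using D0[OF x(1)] by (simp add: g_def)
  qed
  moreover have "\<exists>i\<in>\<mu>. x $ i \<noteq> 0"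
  proof (rule ccontr)
    assume "\<not> ?thesis"
    then have "x $ i = 0" for i using x(1) by (cases "i \<in> \<mu>") (auto simp: S_def)
    then show False using x(1) by (simp add: S_def)
  qed
  ultimately have "submatrix_eigenvalue alg A \<mu> (D x)"
    unfolding submatrix_eigenvalue_def using x(1) D0[OF x(1)] by (auto simp: S_def intro!: exI[of _ "\<lambda>i. x $ i"])
  then show ?thesis ..
qed

lemma submatrix_eigenvalue_iff:
  fixes A :: "real ^ 'n ^ 'n"
  assumes A: "nonneg_mat A" and \<mu>: "\<mu> \<in> classes A"
  shows "submatrix_eigenvalue alg A \<mu> r \<longleftrightarrow> perron_root alg A \<mu> = r"
proof -
  obtain s where s: "submatrix_eigenvalue alg A \<mu> s" using submatrix_eigenvalue_exists[OF assms] by blast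
  then have "perron_root alg A \<mu> = s"
    unfolding perron_root_def using submatrix_eigenvalue_unique[OF assms] by blast
  with s show ?thesis using submatrix_eigenvalue_unique[OF assms] by blast
qed

lemma perron_root_le:
  fixes A :: "real ^ 'n ^ 'n"
  assumes "nonneg_mat A" "\<mu> \<in> classes A" "\<And>i. i \<in> \<mu> \<Longrightarrow> 0 < w i"
    "\<And>i. i \<in> \<mu> \<Longrightarrow> alg_sum alg (\<lambda>j. A $ i $ j * w j) \<mu> \<le> s * w i"
  shows "perron_root alg A \<mu> \<le> s"
  using submatrix_eigenvalue_le[OF assms(1) _ assms(3,4)] submatrix_eigenvalue_iff[OF assms(1,2)] by blast

lemma perron_vector:
  fixes A :: "real ^ 'n ^ 'n"
  assumes A: "nonneg_mat A" and \<mu>: "\<mu> \<in> classes A"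
  obtains v where "\<And>i. i \<in> \<mu> \<Longrightarrow> 0 < v i"
    "\<And>i. i \<in> \<mu> \<Longrightarrow> alg_sum alg (\<lambda>j. A $ i $ j * v j) \<mu> = perron_root alg A \<mu> * v i"
    "0 \<le> perron_root alg A \<mu>"
proof -
  have "submatrix_eigenvalue alg A \<mu> (perron_root alg A \<mu>)" using submatrix_eigenvalue_iff[OF assms] by blast
  then obtain v where v: "\<And>i. i \<in> \<mu> \<Longrightarrow> 0 \<le> v i" "\<exists>i\<in>\<mu>. v i \<noteq> 0"
      "\<And>i. i \<in> \<mu> \<Longrightarrow> alg_sum alg (\<lambda>j. A $ i $ j * v j) \<mu> = perron_root alg A \<mu> * v i"
      "0 \<le> perron_root alg A \<mu>"
    unfolding submatrix_eigenvalue_def by blast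
  show thesis
  proof (rule that)
    show "0 < v i" if "i \<in> \<mu>" for i
      by (rule class_subeigenvector_pos[OF A \<mu> v(1,2) _ that, where alg = alg and r = "perron_root alg A \<mu>"]) (simp_all add: v(3))
  qed (use v in auto)
qed

section \<open>Classes in the support of an eigenvector\<close>

lemma eigenvector_support_closed:
  assumes A: "nonneg_mat A" and y: "nonneg_vec y" "mat_vec alg A y = \<rho> *\<^sub>R y" and "access A i j" "0 < y $ j"
  shows "0 < y $ i"
  using assms(4)
proof (induction rule: access_backward_induct)
  case (edge a b)
  then have "0 < A $ a $ b * y $ b" using A by (simp add: less_le nonneg_matD)
  also have "\<dots> \<le> \<rho> * y $ a" using mat_vec_ge[OF A y(1), of a b alg] y(2) by simp
  finally show ?case using y(1) by (cases "y $ a = 0") (auto simp: less_le nonneg_vecD)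
qed fact

text \<open>
  A final node lies in the support of \<open>y\<close>, in a class from which no other class of the support is
  accessible.
\<close>

definition final_node :: "real ^ 'n ^ 'n \<Rightarrow> real ^ 'n \<Rightarrow> 'n \<Rightarrow> bool" where
  "final_node A y j \<longleftrightarrow> 0 < y $ j \<and> (\<forall>l. 0 < y $ l \<longrightarrow> access A j l \<longrightarrow> access A l j)"

text \<open>
  Among the support nodes accessible from \<open>i\<close>, one that accesses the fewest support nodes is final.
\<close>

lemma final_node_exists:
  fixes A :: "real ^ 'n ^ 'n"
  assumes "0 < y $ i"
  obtains j where "access A i j" "final_node A y j"
proof -
  let ?R = "\<lambda>j. {l. 0 < y $ l \<and> access A j l}"
  obtain j where j: "access A i j \<and> 0 < y $ j" "\<And>l. access A i l \<and> 0 < y $ l \<Longrightarrow> card (?R j) \<le> card (?R l)"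
    using ex_has_least_nat[of "\<lambda>j. access A i j \<and> 0 < y $ j" i "\<lambda>j. card (?R j)"] assms access_refl by blast
  have "access A l j" if l: "0 < y $ l" "access A j l" for l
  proof -
    have "?R l \<subseteq> ?R j" using l access_trans by blast
    moreover have "card (?R j) \<le> card (?R l)" by (intro j(2) conjI access_trans[OF _ l(2)] l(1)) (use j(1) in simp)
    ultimately have "?R l = ?R j" by (intro card_seteq) auto
    moreover have "j \<in> ?R j" using j by simp
    ultimately show ?thesis by blast
  qed
  with j show thesis by (intro that[of j]) (auto simp: final_node_def)
qed

lemma class_eigenvector_le:
  fixes A :: "real ^ 'n ^ 'n"
  assumes A: "nonneg_mat A" and y: "nonneg_vec y" "mat_vec alg A y = \<rho> *\<^sub>R y"
  shows "alg_sum alg (\<lambda>j. A $ i $ j * y $ j) \<mu> \<le> \<rho> * y $ i"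
proof -
  have "alg_sum alg (\<lambda>j. A $ i $ j * y $ j) \<mu> \<le> mat_vec alg A y $ i"
    unfolding mat_vec_nth using A y by (intro alg_sum_subset_mono) (auto simp: nonneg_matD nonneg_vecD)
  then show ?thesis by (simp add: y)
qed

lemma class_support:
  assumes A: "nonneg_mat A" and y: "nonneg_vec y" "mat_vec alg A y = \<rho> *\<^sub>R y"
    and "\<mu> \<in> classes A" "i \<in> \<mu>" "access A i j" "0 < y $ j" "l \<in> \<mu>"
  shows "0 < y $ l"
proof -
  have "access A l j" using class_access[OF assms(4,8,5)] assms(6) by (rule access_trans)
  then show ?thesis using assms(7) by (rule eigenvector_support_closed[OF A y])
qed

lemma accessing_perron_root_le:
  fixes A :: "real ^ 'n ^ 'n"
  assumes A: "nonneg_mat A" and y: "nonneg_vec y" "mat_vec alg A y = \<rho> *\<^sub>R y"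
    and \<mu>: "\<mu> \<in> classes A" "i \<in> \<mu>" "access A i j" "0 < y $ j"
  shows "perron_root alg A \<mu> \<le> \<rho>"
  using class_support[OF A y \<mu>] class_eigenvector_le[OF A y] by (intro perron_root_le[OF A \<mu>(1)])

text \<open>
  The edges leaving a final class end outside the support, so the eigenvector equation of \<open>A\<close>
  restricts to the class.
\<close>

lemma final_class_eigenvector:
  fixes A :: "real ^ 'n ^ 'n"
  assumes A: "nonneg_mat A" and y: "nonneg_vec y" "mat_vec alg A y = \<rho> *\<^sub>R y"
    and j: "final_node A y j" and i: "i \<in> class_of A j"
  shows "alg_sum alg (\<lambda>l. A $ i $ l * y $ l) (class_of A j) = \<rho> * y $ i"
proof -
  have "alg_sum alg (\<lambda>l. A $ i $ l * y $ l) UNIV = alg_sum alg (\<lambda>l. A $ i $ l * y $ l) (class_of A j)"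
  proof (rule alg_sum_mono_neutral)
    fix l assume "l \<in> UNIV - class_of A j"
    then have l: "l \<notin> class_of A j" by simp
    show "A $ i $ l * y $ l = 0"
    proof (rule ccontr)
      assume "\<not> ?thesis"
      then have "A $ i $ l \<noteq> 0" "0 < y $ l" using y(1) by (auto simp: less_le nonneg_vecD)
      then have "access A j l" using i access_edge access_trans unfolding mem_class_of by blast
      moreover from this have "access A l j" using j \<open>0 < y $ l\<close> unfolding final_node_def by simp
      ultimately show False using l by (simp add: mem_class_of)
    qed
  qed (use A y in \<open>auto simp: nonneg_matD nonneg_vecD\<close>)
  then have "mat_vec alg A y $ i = alg_sum alg (\<lambda>l. A $ i $ l * y $ l) (class_of A j)" by (simp add: mat_vec_nth)
  then show ?thesis by (simp add: y)
qed

lemma final_class_perron_root: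
  fixes A :: "real ^ 'n ^ 'n"
  assumes A: "nonneg_mat A" and y: "nonneg_vec y" "mat_vec alg A y = \<rho> *\<^sub>R y" and \<rho>: "0 \<le> \<rho>"
    and j: "final_node A y j"
  shows "perron_root alg A (class_of A j) = \<rho>"
proof -
  have "submatrix_eigenvalue alg A (class_of A j) \<rho>"
    unfolding submatrix_eigenvalue_def using final_class_eigenvector[OF A y j] y(1) \<rho> j
    by (intro conjI exI[of _ "\<lambda>i. y $ i"]) (auto simp: nonneg_vecD final_node_def intro!: bexI[of _ j])
  then show ?thesis using submatrix_eigenvalue_iff[OF A class_of_in_classes] by blast
qed

text \<open>
  Each eigenvalue is the Perron root of a final class of its eigenvector.
\<close>

lemma finite_Lambda:
  fixes A :: "real ^ 'n ^ 'n"
  assumes A: "nonneg_mat A" shows "finite (Lambda alg A)"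
proof (rule finite_subset)
  show "Lambda alg A \<subseteq> perron_root alg A ` classes A"
  proof
    fix \<rho> assume "\<rho> \<in> Lambda alg A"
    then obtain y where y: "nonneg_vec y" "y \<noteq> 0" "mat_vec alg A y = \<rho> *\<^sub>R y" "0 \<le> \<rho>"
      by (auto simp: Lambda_def eigenvalue_def)
    then obtain i where "0 < y $ i" by (auto simp: vec_eq_iff nonneg_vec_def less_le)
    then obtain j where "final_node A y j" by (rule final_node_exists[where A = A])
    from final_class_perron_root[OF A y(1,3,4) this] show "\<rho> \<in> perron_root alg A ` classes A"
      using class_of_in_classes by (intro image_eqI[where x = "class_of A j"]) auto
  qed
qed simp

section \<open>Periods along strongly connected graphs\<close>

lemma period_multiple:
  fixes h :: "int \<Rightarrow> 'a"
  assumes "\<And>t. h (t + int d) = h t" shows "h (t + int (d * q)) = h t"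
proof (induction q)
  case (Suc q)
  then show ?case using assms[of "t + int (d * q)"] by (simp add: algebra_simps)
qed simp

text \<open>
  All periods are multiples of the least one, and therefore so is the gcd of any set of periods.
\<close>

lemma period_Gcd:
  fixes h :: "int \<Rightarrow> 'a"
  assumes k: "0 < k" "\<And>t. h (t + int k) = h t" and L: "\<And>l t. l \<in> L \<Longrightarrow> h (t + int l) = h t"
  shows "h (t + int (Gcd L)) = h t"
proof -
  define P where "P d \<longleftrightarrow> 0 < d \<and> (\<forall>t. h (t + int d) = h t)" for d
  define m where "m = (LEAST d. P d)"
  have Pm: "P m" unfolding m_def using k by (intro LeastI[of P k]) (simp add: P_def)
  have "m dvd l" if "l \<in> L" for l
  proof -
    have "h (t + int (l mod m)) = h t" for t
    proof -
      have "h (t + int (l mod m)) = h (t + int (l mod m) + int (m * (l div m)))"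
        using Pm by (intro period_multiple[symmetric]) (auto simp: P_def)
      also have "\<dots> = h (t + int l)" by (simp only: add.assoc flip: of_nat_add) simp
      finally show ?thesis using L[OF that] by simp
    qed
    then have "\<not> 0 < l mod m"
      using not_less_Least[of "l mod m" P] Pm unfolding m_def[symmetric] by (auto simp: P_def)
    then show ?thesis by auto
  qed
  then have "m dvd Gcd L" by (rule Gcd_greatest)
  then obtain q where "Gcd L = m * q" ..
  then show ?thesis using Pm period_multiple[of h m t q] by (simp add: P_def)
qed

definition walk_weight :: "('n \<Rightarrow> 'n \<Rightarrow> real) \<Rightarrow> ('n \<times> 'n) list \<Rightarrow> real" where
  "walk_weight w p = (\<Prod>(i, j)\<leftarrow>p. w i j)"

lemma walk_weight_simps [simp]:
  "walk_weight w [] = 1" "walk_weight w (e # p) = w (fst e) (snd e) * walk_weight w p"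
  "walk_weight w (p @ q) = walk_weight w p * walk_weight w q"
  by (simp_all add: walk_weight_def case_prod_beta)

lemma walk_relation:
  assumes "wf_digraph H" "tail H = fst" "head H = snd"
    and "\<And>i j t. (i, j) \<in> arcs H \<Longrightarrow> f (t + 1) i = w i j * f t j"
    and "pre_digraph.awalk H u p v"
  shows "f (t + int (length p)) u = walk_weight w p * f t v"
  using assms(5)
proof (induction p arbitrary: u)
  case Nil
  then show ?case by (simp add: wf_digraph.awalk_Nil_iff[OF assms(1)])
next
  case (Cons e p)
  then have "e \<in> arcs H" "u = fst e" "pre_digraph.awalk H (snd e) p v"
    by (simp_all add: wf_digraph.awalk_Cons_iff[OF assms(1)] assms(2,3))
  with Cons.IH assms(4)[of "fst e" "snd e" "t + int (length p)"] show ?case by (simp add: add_ac)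
qed

lemma walk_weight_pos:
  assumes "\<And>e. e \<in> set p \<Longrightarrow> 0 < w (fst e) (snd e)" shows "0 < walk_weight w p"
  using assms by (induction p) auto

text \<open>
  Along a walk the relation says that \<open>f\<close> at the start is a positive multiple of \<open>f\<close> at the end, delayed by the
  length of the walk. For a closed walk the multiple is \<open>1\<close>, since its powers stay bounded by periodicity; so
  the length is a period at the nodes of the walk. A walk from \<open>v\<close> to a cycle transports this
  period to \<open>v\<close>. The condition on return walks excludes components without cycles, for which the
  cyclicity is \<open>1\<close> by convention.
\<close>

lemma cyclicity_period:
  fixes G :: "('n, 'n \<times> 'n) pre_digraph"
  assumes fin: "fin_digraph G" and ends: "tail G = fst" "head G = snd"
    and w: "\<And>i j. (i, j) \<in> arcs G \<Longrightarrow> 0 < w i j"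
    and rel: "\<And>i j t. (i, j) \<in> arcs G \<Longrightarrow> f (t + 1) i = w i j * f t j"
    and k: "0 < k" "\<And>i t. f (t + int k) i = f t i"
    and closed: "\<And>v. v \<in> verts G \<Longrightarrow> \<exists>j. (v, j) \<in> arcs G \<and> j \<rightarrow>\<^sup>*\<^bsub>G\<^esub> v"
    and v: "v \<in> verts G"
  shows "f (t + int (cyclicity G)) v = (f t v :: real)"
proof -
  interpret fin_digraph G by (rule fin)
  define S where "S = scc_of v"
  define H where "H = G \<restriction> S"
  have H: "H \<in> sccs" unfolding H_def S_def sccs_conv_sccs_verts using scc_of_in_sccs_verts[OF v] by blast
  have vS: "v \<in> S" unfolding S_def using in_scc_of_self[OF v] .
  have HG [simp]: "tail H = fst" "head H = snd" "verts H = S"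
    by (simp_all add: H_def ends)
  have "induced_subgraph H G" and sc: "strongly_connected H" using H by (auto elim: in_sccsE)
  then have sub: "subgraph H G" by (simp add: induced_subgraph_def)
  then interpret H: wf_digraph H by auto
  have arcsH: "arcs H \<subseteq> arcs G" using sub by (auto simp: subgraph_def)
  have relH: "f (t + int (length p)) a = walk_weight w p * f t b" if "H.awalk a p b" for a p b t
    by (rule walk_relation[OF H.wf_digraph HG(1,2) _ that]) (use rel arcsH in auto)
  have posH: "0 < walk_weight w p" if "H.awalk a p b" for a p b
    using that w arcsH by (intro walk_weight_pos) (auto simp: H.awalk_def)
  have cyc: "f (t + int (length p)) v = f t v" if p: "H.cycle p" for p t
  proof -
    from p obtain u where u: "H.awalk u p u" by (auto simp: H.cycle_def)
    then have "u \<in> S" by (auto simp: H.awalk_def)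
    have pu: "f (t + int (length p)) u = f t u" for t
    proof (cases "\<forall>t. f t u = 0")
      case False
      then obtain s where s: "f s u \<noteq> 0" by blast
      have "f (s + int (length p * m)) u = walk_weight w p ^ m * f s u" for m
      proof (induction m)
        case (Suc m)
        then show ?case using relH[OF u, of "s + int (length p * m)"] by (simp add: algebra_simps)
      qed simp
      moreover have "f (s + int (length p * k)) u = f s u"
        using period_multiple[of "\<lambda>t. f t u" k s "length p"] k(2) by (simp add: mult.commute)
      ultimately have "walk_weight w p ^ k = 1" using s by (metis mult_cancel_right1)
      then have "walk_weight w p = 1"
        using posH[OF u] k(1) power_eq_imp_eq_base[of "walk_weight w p" k 1] by simp
      then show ?thesis using relH[OF u] by simp
    qed simp
    have "v \<rightarrow>\<^sup>*\<^bsub>H\<^esub> u" using sc vS \<open>u \<in> S\<close> by (auto elim: strongly_connectedE)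
    then obtain q where q: "H.awalk v q u" using H.reachable_awalk by blast
    have "f (t + int (length p)) v = f (t - int (length q) + int (length p) + int (length q)) v"
      by (simp add: algebra_simps)
    also have "\<dots> = f (t - int (length q) + int (length q)) v" unfolding relH[OF q] pu ..
    finally show ?thesis by simp
  qed
  have "\<exists>p. H.cycle p"
  proof -
    obtain j where j: "(v, j) \<in> arcs G" "j \<rightarrow>\<^sup>*\<^bsub>G\<^esub> v" using closed[OF v] by blast
    then have "v \<rightarrow>\<^bsub>G\<^esub> j" by (force simp: arcs_ends_conv ends)
    then have "v \<rightarrow>\<^sup>*\<^bsub>G\<^esub> j" by blast
    then have jS: "j \<in> S" using j by (simp add: S_def scc_of_def)
    then have arc: "(v, j) \<in> arcs H" using j vS by (simp add: H_def ends)
    have "j \<rightarrow>\<^sup>*\<^bsub>H\<^esub> v" using sc vS jS by (auto elim: strongly_connectedE)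
    then obtain q where "H.awalk j q v" using H.reachable_awalk by blast
    then have "H.awalk v ((v, j) # q) v" using arc by (simp add: H.awalk_Cons_iff)
    then show ?thesis using H.closed_w_imp_cycle[of "(v, j) # q"] by (auto simp: H.closed_w_def)
  qed
  then have "scc_cyclicity H = Gcd {length p | p. H.cycle p}" by (simp add: scc_cyclicity_def)
  moreover have "f (t + int (Gcd {length p | p. H.cycle p})) v = f t v" for t
    by (rule period_Gcd[where h = "\<lambda>t. f t v", OF k(1)]) (use k(2) cyc in auto)
  moreover have "scc_cyclicity H dvd cyclicity G" unfolding cyclicity_def using H by (intro dvd_Lcm) blast
  then obtain q where "cyclicity G = scc_cyclicity H * q" ..
  ultimately show ?thesis using period_multiple[of "\<lambda>t. f t v" "scc_cyclicity H" t q] by simp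
qed

lemma cyclicity_nz:
  assumes "fin_digraph G" shows "cyclicity G \<noteq> 0"
proof -
  interpret fin_digraph G by (rule assms)
  have "scc_cyclicity H \<noteq> 0" for H :: "('a, 'b) pre_digraph"
  proof (cases "\<exists>p. pre_digraph.cycle H p")
    case True
    then obtain p where p: "pre_digraph.cycle H p" by blast
    then have "length p \<in> {length p | p. pre_digraph.cycle H p}" "length p \<noteq> 0"
      by (auto simp: pre_digraph.cycle_def)
    then have "Gcd {length p | p. pre_digraph.cycle H p} \<noteq> 0" unfolding Gcd_0_iff by blast
    then show ?thesis using True by (simp only: scc_cyclicity_def if_True not_False_eq_True)
  qed (simp add: scc_cyclicity_def)
  moreover have "finite sccs" unfolding sccs_conv_sccs_verts using finite_sccs_verts by simp
  ultimately show ?thesis unfolding cyclicity_def by (auto simp: Lcm_0_iff_nat image_iff)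
qed

section \<open>Periods in nonnegative algebra\<close>

text \<open>
  The maximum principle: a weighted mean of the ratios \<open>g j / y j\<close> can reach their upper bound \<open>M\<close> only if all ratios with
  positive weight equal \<open>M\<close>. Multiplying out the ratios admits entries \<open>y j = 0\<close>.
\<close>

lemma weighted_max_principle:
  fixes a y g :: "'n::finite \<Rightarrow> real"
  assumes a: "\<And>j. 0 \<le> a j" and y: "(\<Sum>j\<in>UNIV. a j * y j) = r"
    and ge: "M * r \<le> (\<Sum>j\<in>UNIV. a j * g j)" and le: "\<And>j. a j \<noteq> 0 \<Longrightarrow> g j \<le> M * y j"
    and j: "a j \<noteq> 0"
  shows "g j = M * y j"
proof -
  have nn: "0 \<le> a j * (M * y j - g j)" for j using a[of j] le[of j] by (cases "a j = 0") auto
  have "(\<Sum>j\<in>UNIV. a j * (M * y j - g j)) = M * r - (\<Sum>j\<in>UNIV. a j * g j)"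
    by (simp add: y[symmetric] algebra_simps sum_subtractf sum_distrib_left)
  then have "(\<Sum>j\<in>UNIV. a j * (M * y j - g j)) \<le> 0" using ge by simp
  then have "(\<Sum>j\<in>UNIV. a j * (M * y j - g j)) = 0" using nn by (intro order_antisym sum_nonneg) auto
  then have "a j * (M * y j - g j) = 0" using nn by (subst (asm) sum_nonneg_eq_0_iff) auto
  then show ?thesis using j by simp
qed

text \<open>
  If the roots were equal, the maximum principle would spread the contact between the Perron vector of the
  class and \<open>\<alpha> y\<close> along all edges, including those that leave the class, where the Perron vector,
  extended by zero, would force \<open>y\<close> to vanish. But a support node outside the class is accessible.
\<close>

lemma strict_perron_root:
  fixes A :: "real ^ 'n ^ 'n"
  assumes A: "nonneg_mat A" and y: "nonneg_vec y" "mat_vec Nonneg_Alg A y = \<rho> *\<^sub>R y"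
    and \<mu>: "\<mu> \<in> classes A" "i \<in> \<mu>" "access A i j" "0 < y $ j" "j \<notin> \<mu>"
  shows "perron_root Nonneg_Alg A \<mu> < \<rho>"
proof (rule ccontr)
  assume "\<not> ?thesis"
  then have eq: "perron_root Nonneg_Alg A \<mu> = \<rho>" using accessing_perron_root_le[OF A y \<mu>(1-4)] by simp
  obtain v where v: "\<And>i. i \<in> \<mu> \<Longrightarrow> 0 < v i"
    "\<And>i. i \<in> \<mu> \<Longrightarrow> alg_sum Nonneg_Alg (\<lambda>j. A $ i $ j * v j) \<mu> = \<rho> * v i" "0 \<le> \<rho>"
    by (rule perron_vector[OF A \<mu>(1), of Nonneg_Alg, unfolded eq]) blast
  have nz: "\<exists>i\<in>\<mu>. v i \<noteq> 0" using v(1)[OF \<mu>(2)] \<mu>(2) by force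
  have ypos: "0 < y $ l" if "l \<in> \<mu>" for l using class_support[OF A y \<mu>(1-4) that] .
  have row: "(\<Sum>j\<in>UNIV. A $ a $ j * y $ j) = \<rho> * y $ a" for a
    using arg_cong[OF y(2), of "\<lambda>x. x $ a"] by (simp add: mat_vec_nth)
  obtain \<alpha> m where \<alpha>: "0 < \<alpha>" "\<And>j. j \<in> \<mu> \<Longrightarrow> v j \<le> \<alpha> * y $ j" "m \<in> \<mu>" "v m = \<alpha> * y $ m"
    by (rule collatz_wielandt[of A \<mu> v Nonneg_Alg \<rho> "\<lambda>i. y $ i" \<rho>])
      (use A v nz ypos class_eigenvector_le[OF A y, of _ \<mu>] in \<open>auto simp: less_imp_le\<close>)
  define g where "g j = (if j \<in> \<mu> then v j else 0)" for j
  have tight: "g b = \<alpha> * y $ b" if a: "a \<in> \<mu>" "v a = \<alpha> * y $ a" "A $ a $ b \<noteq> 0" for a b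
  proof (rule weighted_max_principle[where a = "\<lambda>j. A $ a $ j"])
    show "(\<Sum>j\<in>UNIV. A $ a $ j * y $ j) = \<rho> * y $ a" by (rule row)
    have "(\<Sum>j\<in>UNIV. A $ a $ j * g j) = (\<Sum>j\<in>\<mu>. A $ a $ j * v j)"
      by (rule sum.mono_neutral_cong_right) (auto simp: g_def)
    also have "\<dots> = \<rho> * v a" using v(2)[OF a(1)] by simp
    finally show "\<alpha> * (\<rho> * y $ a) \<le> (\<Sum>j\<in>UNIV. A $ a $ j * g j)" by (simp add: a(2))
    show "g j \<le> \<alpha> * y $ j" for j using \<alpha>(1,2) y(1) by (simp add: g_def nonneg_vecD)
  qed (use A a in \<open>auto simp: nonneg_matD\<close>)
  have all: "v a = \<alpha> * y $ a" if "a \<in> \<mu>" for a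
  proof (rule class_forward_induct[where P = "\<lambda>a. v a = \<alpha> * y $ a", OF \<mu>(1) \<alpha>(3) that \<alpha>(4)])
    fix a b assume ab: "a \<in> \<mu>" "b \<in> \<mu>" "A $ a $ b \<noteq> 0" "v a = \<alpha> * y $ a"
    show "v b = \<alpha> * y $ b" using tight[OF ab(1,4,3)] ab(2) by (simp add: g_def)
  qed
  have "i \<notin> \<mu>" using \<mu>(3)
  proof (induction rule: access_backward_induct)
    case (edge a b)
    show ?case
    proof
      assume "a \<in> \<mu>"
      then have "\<alpha> * y $ b = 0" using tight[OF _ all edge(1)] edge(3) by (simp add: g_def)
      moreover have "0 < y $ b" using eigenvector_support_closed[OF A y edge(2) \<mu>(4)] .
      ultimately show False using \<alpha>(1) by simp
    qed
  qed (rule \<mu>(5))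
  with \<mu>(2) show False by simp
qed

locale nonneg_orbit = periodic_orbit Nonneg_Alg A \<rho> k f
  for A :: "real ^ 'n ^ 'n" and \<rho> k f
begin

lemma row_step: "(\<Sum>j\<in>UNIV. A $ i $ j * f t $ j) = \<rho> * f (t + 1) $ i"
  using arg_cong[OF step[of t], of "\<lambda>x. x $ i"] by (simp add: mat_vec_nth)

lemma row_orbit_sum: "(\<Sum>j\<in>UNIV. A $ i $ j * orbit_sum $ j) = \<rho> * orbit_sum $ i"
  using arg_cong[OF orbit_sum_eigen, of "\<lambda>x. x $ i"] by (simp add: mat_vec_nth)

lemma final_class_spectral:
  assumes "final_node A orbit_sum j" shows "spectral_class Nonneg_Alg A \<rho> (class_of A j)"
proof -
  have pr: "perron_root Nonneg_Alg A (class_of A j) = \<rho>"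
    using final_class_perron_root[OF A nonneg_orbit_sum orbit_sum_eigen _ assms] rho by simp
  have "perron_root Nonneg_Alg A \<mu> < \<rho>"
    if \<mu>: "\<mu> \<in> classes A" "class_accesses A \<mu> (class_of A j)" "\<mu> \<noteq> class_of A j" for \<mu>
  proof -
    obtain i where i: "i \<in> \<mu>" using class_nonempty[OF \<mu>(1)] by blast
    then have "access A i j" using class_accesses_iff[OF \<mu>(1) class_of_in_classes i self_class_of] \<mu>(2) by simp
    moreover have "j \<notin> \<mu>" using class_eq_class_of[OF \<mu>(1)] \<mu>(3) by blast
    moreover have "0 < orbit_sum $ j" using assms by (simp add: final_node_def)
    ultimately show ?thesis using strict_perron_root[OF A nonneg_orbit_sum orbit_sum_eigen \<mu>(1) i] by blast
  qed
  then show ?thesis using rho pr by simp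
qed

lemma final_class_edge:
  assumes fin: "final_node A orbit_sum j0"
  shows "i \<in> class_of A j0 \<Longrightarrow> 0 < orbit_sum $ i"
    and "i \<in> class_of A j0 \<Longrightarrow> A $ i $ j \<noteq> 0 \<Longrightarrow> j \<notin> class_of A j0 \<Longrightarrow> orbit_sum $ j = 0"
proof -
  have pos: "0 < orbit_sum $ j0" using fin by (simp add: final_node_def)
  show "i \<in> class_of A j0 \<Longrightarrow> 0 < orbit_sum $ i"
    using eigenvector_support_closed[OF A nonneg_orbit_sum orbit_sum_eigen _ pos] by (simp add: mem_class_of)
  assume i: "i \<in> class_of A j0" and ij: "A $ i $ j \<noteq> 0" and j: "j \<notin> class_of A j0"
  show "orbit_sum $ j = 0"
  proof (rule ccontr)
    assume "orbit_sum $ j \<noteq> 0"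
    then have "0 < orbit_sum $ j" using nonneg_orbit_sum by (simp add: less_le nonneg_vecD)
    moreover have "access A j0 j" using i access_trans[OF _ access_edge[OF ij]] by (simp add: mem_class_of)
    ultimately have "access A j j0" using fin by (simp add: final_node_def)
    with j \<open>access A j0 j\<close> show False by (simp add: mem_class_of)
  qed
qed

lemma zero_outside: "orbit_sum $ j = 0 \<Longrightarrow> f t $ j = 0"
  using orbit_sum_ge[of t j] nonneg_nth[of t j] by simp

text \<open>
  The maximum \<open>M\<close> of the ratios \<open>f / y\<close> over all node-time pairs reachable from \<open>(i, t + 1)\<close> inside the
  class, one step back in time per edge, spreads by the maximum principle from a pair where it is
  attained to all pairs reachable from there. Among these is \<open>(i, t + 1)\<close> up to a multiple of the
  period \<open>k\<close>, as a closed walk can be run through \<open>k\<close> times. So the ratio is the same at both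
  ends of every edge.
\<close>

lemma final_class_relation:
  assumes fin: "final_node A orbit_sum j0" and ij: "i \<in> class_of A j0" "j \<in> class_of A j0" "A $ i $ j \<noteq> 0"
  shows "f (t + 1) $ i = orbit_sum $ i / orbit_sum $ j * f t $ j"
proof -
  define C where "C = class_of A j0"
  define E where "E = {(a, b). a \<in> C \<and> b \<in> C \<and> A $ a $ b \<noteq> 0}"
  define u where "u s a = f s $ a / orbit_sum $ a" for s a
  have pos: "0 < orbit_sum $ a" if "a \<in> C" for a using final_class_edge(1)[OF fin] that by (simp add: C_def)
  have iC: "i \<in> C" and jC: "j \<in> C" using ij by (simp_all add: C_def)
  have conn: "(a, b) \<in> E\<^sup>*" if "a \<in> C" "b \<in> C" for a b
  proof -
    have cl: "C \<in> classes A" by (simp add: C_def)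
    show ?thesis
      by (rule class_backward_induct[where P = "\<lambda>a. (a, b) \<in> E\<^sup>*", OF cl that])
        (auto simp: E_def intro: converse_rtrancl_into_rtrancl)
  qed
  have inC: "b \<in> C" if "(a, b) \<in> E ^^ m" "a \<in> C" for a b m
    using that by (cases m) (auto simp: E_def)
  let ?t = "t + 1"
  define R where "R = {(m, b). (i, b) \<in> E ^^ m}"
  define V where "V = (\<lambda>(m, b). u (?t - int m) b) ` R"
  have "V \<subseteq> (\<lambda>(s, b). u s b) ` ({0..<int k} \<times> UNIV)"
  proof
    fix x assume "x \<in> V"
    then obtain m b where "x = u (?t - int m) b" unfolding V_def by auto
    also have "\<dots> = u ((?t - int m) mod int k) b" by (simp add: u_def period_mod)
    finally show "x \<in> (\<lambda>(s, b). u s b) ` ({0..<int k} \<times> UNIV)"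
      using k by (intro image_eqI[of _ _ "((?t - int m) mod int k, b)"]) auto
  qed
  then have "finite V" by (rule finite_subset) auto
  have "(0, i) \<in> R" by (simp add: R_def)
  then have "V \<noteq> {}" unfolding V_def by blast
  define M where "M = Max V"
  have "M \<in> V" unfolding M_def by (rule Max_in) fact+
  then obtain m b where mb: "(i, b) \<in> E ^^ m" "u (?t - int m) b = M" unfolding V_def R_def by auto
  have leM: "u (?t - int m) b \<le> M" if "(i, b) \<in> E ^^ m" for m b
    unfolding M_def using \<open>finite V\<close> that by (intro Max_ge) (auto simp: V_def R_def)
  have orbit_max: "u (?t - int m - int n) c = M" if "(b, c) \<in> E ^^ n" for n c
    using that
  proof (induction n arbitrary: c)
    case (Suc n)
    then obtain d where d: "(b, d) \<in> E ^^ n" "(d, c) \<in> E" by auto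
    then have id: "(i, d) \<in> E ^^ (m + n)" using mb(1) by (auto simp: relpow_add)
    then have dC: "d \<in> C" using inC iC by blast
    let ?s = "?t - int m - int n"
    have "f ?s $ d = M * orbit_sum $ d" using Suc.IH[OF d(1)] pos[OF dC] by (auto simp: u_def field_simps)
    have "f (?s - 1) $ c = M * orbit_sum $ c"
    proof (rule weighted_max_principle[where a = "\<lambda>j. A $ d $ j"])
      show "(\<Sum>j\<in>UNIV. A $ d $ j * orbit_sum $ j) = \<rho> * orbit_sum $ d" by (rule row_orbit_sum)
      show "M * (\<rho> * orbit_sum $ d) \<le> (\<Sum>j\<in>UNIV. A $ d $ j * f (?s - 1) $ j)"
        unfolding row_step diff_add_cancel \<open>f ?s $ d = M * orbit_sum $ d\<close> by simp
      show "f (?s - 1) $ e \<le> M * orbit_sum $ e" if e: "A $ d $ e \<noteq> 0" for e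
      proof (cases "e \<in> C")
        case True
        then have "(i, e) \<in> E ^^ (Suc (m + n))" using id dC e by (auto simp: E_def)
        from leM[OF this] have "u (?s - 1) e \<le> M" by (simp add: algebra_simps)
        then show ?thesis using pos[OF True] by (simp add: u_def pos_divide_le_eq)
      next
        case False
        then have "orbit_sum $ e = 0" using final_class_edge(2)[OF fin] dC e by (simp add: C_def)
        then show ?thesis by (simp add: zero_outside)
      qed
    qed (use A d in \<open>auto simp: nonneg_matD E_def\<close>)
    moreover have "0 < orbit_sum $ c" using d pos by (auto simp: E_def)
    moreover have "?t - int m - int (Suc n) = ?s - 1" by simp
    ultimately show ?case by (simp add: u_def)
  qed (use mb in simp)
  have bC: "b \<in> C" using inC[OF mb(1) iC] .
  obtain r where r: "(b, i) \<in> E ^^ r" using conn[OF bC iC] by (auto simp: rtrancl_power)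
  let ?l = "m + r"
  have loop: "(i, i) \<in> E ^^ (?l * q)" for q
  proof (induction q)
    case (Suc q)
    have "(i, i) \<in> E ^^ ?l" using mb(1) r by (auto simp: relpow_add)
    with Suc show ?case by (auto simp: relpow_add)
  qed simp
  \<comment> \<open>Together with the \<open>m\<close> steps from \<open>i\<close> to \<open>b\<close> this makes \<open>k\<close> rounds of a closed walk of length \<open>?l\<close>.\<close>
  define n where "n = r + ?l * (k - 1)"
  have bi: "(b, i) \<in> E ^^ n" unfolding n_def using r loop by (auto simp: relpow_add)
  moreover have "(i, j) \<in> E" using ij iC jC by (simp add: E_def)
  ultimately have bj: "(b, j) \<in> E ^^ Suc n" by auto
  have mn: "?t - int m - int n = ?t + int k * (- int ?l)"
    using k by (cases k) (simp_all add: n_def algebra_simps)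
  have "u ?t i = M" using orbit_max[OF bi] unfolding mn by (simp add: u_def period_mult)
  moreover have "u t j = M"
  proof -
    have "?t - int m - int (Suc n) = t + int k * (- int ?l)" using mn by simp
    then show ?thesis using orbit_max[OF bj] period_mult[of t "- int ?l"] by (simp add: u_def)
  qed
  ultimately have "f ?t $ i = M * orbit_sum $ i" "f t $ j = M * orbit_sum $ j"
    using pos[OF iC] pos[OF jC] by (auto simp: u_def field_simps)
  then show ?thesis using pos[OF jC] by simp
qed

text \<open>
  The edge relation makes the cyclicity of a final class a period at its nodes.
\<close>

lemma final_class_period:
  assumes fin: "final_node A orbit_sum j0" and i: "i \<in> class_of A j0"
  shows "f (t + int (cyclicity (mat_digraph_on (class_of A j0) A))) $ i = f t $ i"
proof -
  let ?C = "class_of A j0"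
  have pos: "0 < orbit_sum $ a" if "a \<in> ?C" for a using final_class_edge(1)[OF fin that] .
  have conn: "a \<rightarrow>\<^sup>*\<^bsub>mat_digraph_on ?C A\<^esub> b" if "a \<in> ?C" "b \<in> ?C" for a b
  proof (rule class_backward_induct[where P = "\<lambda>a. a \<rightarrow>\<^sup>*\<^bsub>mat_digraph_on ?C A\<^esub> b", OF class_of_in_classes that])
    show "b \<rightarrow>\<^sup>*\<^bsub>mat_digraph_on ?C A\<^esub> b"
      using that by (simp add: wf_digraph.reachable_refl[OF wf_digraph_mat])
    fix c d assume cd: "c \<in> ?C" "d \<in> ?C" "A $ c $ d \<noteq> 0" and db: "d \<rightarrow>\<^sup>*\<^bsub>mat_digraph_on ?C A\<^esub> b"
    show "c \<rightarrow>\<^sup>*\<^bsub>mat_digraph_on ?C A\<^esub> b"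
      by (rule wf_digraph.adj_reachable_trans[OF wf_digraph_mat _ db]) (use cd in simp)
  qed
  show ?thesis
  proof (rule cyclicity_period[where f = "\<lambda>t i. f t $ i" and w = "\<lambda>i j. orbit_sum $ i / orbit_sum $ j"])
    show "fin_digraph (mat_digraph_on ?C A)" by (rule fin_digraph_mat)
    show "\<exists>j. (v, j) \<in> arcs (mat_digraph_on ?C A) \<and> j \<rightarrow>\<^sup>*\<^bsub>mat_digraph_on ?C A\<^esub> v"
      if "v \<in> verts (mat_digraph_on ?C A)" for v
    proof -
      have v: "v \<in> ?C" using that by simp
      have "\<exists>j\<in>?C. A $ v $ j \<noteq> 0"
      proof (rule ccontr)
        assume "\<not> ?thesis"
        then have "(\<Sum>j\<in>?C. A $ v $ j * orbit_sum $ j) = 0" by (intro sum.neutral) auto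
        then show False
          using final_class_eigenvector[OF A nonneg_orbit_sum orbit_sum_eigen fin v] rho pos[OF v] by simp
      qed
      then show ?thesis using conn v by auto
    qed
  qed (use final_class_relation[OF fin] pos k period i in auto)
qed

text \<open>
  On final nodes the cyclicity of a spectral class is a period. The modulus of the difference between the orbit and its
  shift by \<open>s\<close>, relative to \<open>y\<close>, is subharmonic; so its maximum spreads along the edges of the support up to a final
  node, where the difference vanishes.
\<close>

lemma orbit_period:
  assumes dvd: "sigma_rho Nonneg_Alg A \<rho> dvd s"
  shows "f (t + int s) = f t"
proof -
  have fin_per: "f (t + int s) $ i = f t $ i" if fin: "final_node A orbit_sum i" for i t
  proof -
    have "cyclicity (mat_digraph_on (class_of A i) A) dvd sigma_rho Nonneg_Alg A \<rho>"
      using final_class_spectral[OF fin] unfolding sigma_rho.simps by (intro dvd_Lcm) blast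
    then obtain q where "s = cyclicity (mat_digraph_on (class_of A i) A) * q" using dvd dvdE dvd_trans by metis
    then show ?thesis
      using period_multiple[of "\<lambda>t. f t $ i" "cyclicity (mat_digraph_on (class_of A i) A)" t q]
        final_class_period[OF fin self_class_of] by simp
  qed
  define z where "z t i = \<bar>f (t + int s) $ i - f t $ i\<bar>" for t i
  define V where "V = (\<lambda>(t, i). z t i / orbit_sum $ i) ` (UNIV \<times> {i. 0 < orbit_sum $ i})"
  have "V \<subseteq> (\<lambda>(t, i). z t i / orbit_sum $ i) ` ({0..<int k} \<times> UNIV)"
  proof
    fix x assume "x \<in> V"
    then obtain t i where "x = z t i / orbit_sum $ i" unfolding V_def by auto
    also have "z t i = z (t mod int k) i"
      using period_mult[of "t mod int k + int s" "t div int k"] by (simp add: z_def period_mod algebra_simps)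
    finally show "x \<in> (\<lambda>(t, i). z t i / orbit_sum $ i) ` ({0..<int k} \<times> UNIV)"
      using k by (intro image_eqI[of _ _ "(t mod int k, i)"]) auto
  qed
  then have finV: "finite V" by (rule finite_subset) auto
  have z0: "z t i = 0" if "orbit_sum $ i = 0" for t i using that by (simp add: z_def zero_outside)
  have "z t i = 0" for t i
  proof (rule ccontr)
    assume nz: "z t i \<noteq> 0"
    then have ti: "0 < orbit_sum $ i" using z0 nonneg_orbit_sum by (metis less_le nonneg_vecD)
    define M where "M = Max V"
    have leM: "z t i / orbit_sum $ i \<le> M" if "0 < orbit_sum $ i" for t i
      unfolding M_def using finV that by (intro Max_ge) (auto simp: V_def)
    have "0 < z t i / orbit_sum $ i" using nz ti by (simp add: z_def)
    then have "0 < M" using leM[OF ti, of t] by simp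
    have zle: "z t i \<le> M * orbit_sum $ i" for t i
    proof (cases "0 < orbit_sum $ i")
      case True
      then show ?thesis using leM[OF True, of t] by (simp add: pos_divide_le_eq)
    next
      case False
      then have "orbit_sum $ i = 0" using nonneg_orbit_sum by (simp add: less_le nonneg_vecD)
      then show ?thesis by (simp add: z0)
    qed
    have "M \<in> V" unfolding M_def using finV ti by (intro Max_in) (auto simp: V_def)
    then obtain t1 i1 where "0 < orbit_sum $ i1" "z t1 i1 / orbit_sum $ i1 = M" unfolding V_def by auto
    then have i1: "0 < orbit_sum $ i1" "z t1 i1 = M * orbit_sum $ i1" by (auto simp: field_simps)
    obtain j where j: "access A i1 j" "final_node A orbit_sum j" using final_node_exists[OF i1(1)] by blast
    have "0 < orbit_sum $ j \<longrightarrow> (\<exists>t. z t j = M * orbit_sum $ j)"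
      using j(1)
    proof (induction rule: access_forward_induct)
      case (edge a b)
      show ?case
      proof
        assume b: "0 < orbit_sum $ b"
        then have "0 < orbit_sum $ a"
          using eigenvector_support_closed[OF A nonneg_orbit_sum orbit_sum_eigen access_edge[OF edge(2)]] by simp
        with edge obtain t where t: "z t a = M * orbit_sum $ a" by blast
        have "z (t - 1) b = M * orbit_sum $ b"
        proof (rule weighted_max_principle[where a = "\<lambda>j. A $ a $ j"])
          show "(\<Sum>j\<in>UNIV. A $ a $ j * orbit_sum $ j) = \<rho> * orbit_sum $ a" by (rule row_orbit_sum)
          have "M * (\<rho> * orbit_sum $ a) = \<bar>\<rho> * f (t - 1 + int s + 1) $ a - \<rho> * f (t - 1 + 1) $ a\<bar>"
            using t rho by (simp add: z_def abs_mult flip: right_diff_distrib)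
          also have "\<dots> = \<bar>\<Sum>j\<in>UNIV. A $ a $ j * (f (t - 1 + int s) $ j - f (t - 1) $ j)\<bar>"
            unfolding row_step[symmetric] by (simp add: algebra_simps sum_subtractf)
          also have "\<dots> \<le> (\<Sum>j\<in>UNIV. \<bar>A $ a $ j * (f (t - 1 + int s) $ j - f (t - 1) $ j)\<bar>)"
            by (rule sum_abs)
          also have "\<dots> = (\<Sum>j\<in>UNIV. A $ a $ j * z (t - 1) j)"
            using A by (simp add: abs_mult z_def nonneg_matD)
          finally show "M * (\<rho> * orbit_sum $ a) \<le> (\<Sum>j\<in>UNIV. A $ a $ j * z (t - 1) j)" .
        qed (use zle A edge in \<open>auto simp: nonneg_matD\<close>)
        then show "\<exists>t. z t b = M * orbit_sum $ b" by blast
      qed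
    qed (use i1 in blast)
    moreover have "0 < orbit_sum $ j" using j(2) by (simp add: final_node_def)
    moreover have "z t j = 0" for t using fin_per[OF j(2)] by (simp add: z_def)
    ultimately show False using \<open>0 < M\<close> by auto
  qed
  then show ?thesis by (simp add: vec_eq_iff z_def)
qed

end

section \<open>Walks, cycles and critical edges\<close>

lemma pcas_append: "pcas u (p @ q) v \<longleftrightarrow> (\<exists>m. pcas u p m \<and> pcas m q v)"
  by (induction p arbitrary: u) auto

lemma awalk_mat_digraph:
  "pre_digraph.awalk (mat_digraph B) u p v \<longleftrightarrow> (\<forall>e\<in>set p. B $ fst e $ snd e \<noteq> 0) \<and> pcas u p v"
  by (auto simp: pre_digraph.awalk_def mat_digraph_on_def cas_with_proj_eq)

lemma mat_cycle_iff:
  "mat_cycle B p \<longleftrightarrow> p \<noteq> [] \<and> (\<forall>e\<in>set p. B $ fst e $ snd e \<noteq> 0) \<and> (\<exists>u. pcas u p u)"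
  by (auto simp: mat_cycle_def awalk_mat_digraph)

lemma walk_access:
  assumes "pcas u p v" "\<And>e. e \<in> set p \<Longrightarrow> A $ fst e $ snd e \<noteq> 0"
  shows "access A u v" and "e \<in> set p \<Longrightarrow> access A u (fst e) \<and> access A (snd e) v"
proof -
  have "access A u v \<and> (\<forall>e\<in>set p. access A u (fst e) \<and> access A (snd e) v)"
    using assms
  proof (induction p arbitrary: u)
    case (Cons e p)
    then have "access A u (snd e)" by (auto intro: access_edge)
    with Cons show ?case by (auto intro: access_trans)
  qed auto
  then show "access A u v" and "e \<in> set p \<Longrightarrow> access A u (fst e) \<and> access A (snd e) v" by auto
qed

lemma walk_weight_le:
  assumes "pcas a p b" and "\<And>e. e \<in> set p \<Longrightarrow> w (fst e) (snd e) * v (snd e) \<le> r * v (fst e)"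
    and "\<And>e. e \<in> set p \<Longrightarrow> 0 \<le> w (fst e) (snd e)" and r: "0 \<le> r"
  shows "walk_weight w p * v b \<le> r ^ length p * v a"
  using assms(1-3)
proof (induction p arbitrary: a)
  case (Cons e p)
  then have "w (fst e) (snd e) * (walk_weight w p * v b) \<le> w (fst e) (snd e) * (r ^ length p * v (snd e))"
    by (intro mult_left_mono Cons.IH) auto
  also have "\<dots> = r ^ length p * (w (fst e) (snd e) * v (snd e))" by simp
  also have "\<dots> \<le> r ^ length p * (r * v (fst e))" using Cons.prems r by (intro mult_left_mono) auto
  finally show ?case using Cons.prems(1) by (simp add: mult_ac)
qed simp

abbreviation entry :: "real ^ 'n ^ 'n \<Rightarrow> 'n \<Rightarrow> 'n \<Rightarrow> real" where
  "entry A i j \<equiv> A $ i $ j"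

lemma perron_root_nonneg:
  fixes A :: "real ^ 'n ^ 'n"
  assumes "nonneg_mat A" "\<mu> \<in> classes A" shows "0 \<le> perron_root alg A \<mu>"
  by (rule perron_vector[OF assms])

text \<open>
  Multiply the inequalities \<open>a i j v j \<le> r v i\<close> for a positive Perron vector \<open>v\<close> along the cycle.
\<close>

lemma cycle_weight_le_perron_root:
  fixes A :: "real ^ 'n ^ 'n"
  assumes A: "nonneg_mat A" and p: "pcas u p u" "\<And>e. e \<in> set p \<Longrightarrow> A $ fst e $ snd e \<noteq> 0"
  shows "walk_weight (entry A) p \<le> perron_root alg A (class_of A u) ^ length p"
proof -
  let ?\<mu> = "class_of A u"
  let ?r = "perron_root alg A ?\<mu>"
  obtain v where v: "\<And>i. i \<in> ?\<mu> \<Longrightarrow> 0 < v i"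
    "\<And>i. i \<in> ?\<mu> \<Longrightarrow> alg_sum alg (\<lambda>j. A $ i $ j * v j) ?\<mu> = ?r * v i" "0 \<le> ?r"
    by (rule perron_vector[OF A class_of_in_classes]) blast
  have "walk_weight (entry A) p * v u \<le> ?r ^ length p * v u"
  proof (rule walk_weight_le[OF p(1) _ _ v(3)])
    fix e assume e: "e \<in> set p"
    have "access A u (fst e)" "access A (snd e) u" "access A (fst e) (snd e)"
      using walk_access(2)[OF p(1), of A e] p(2) e access_edge[OF p(2)[OF e]] by auto
    then have mem: "fst e \<in> ?\<mu>" "snd e \<in> ?\<mu>" by (auto simp: mem_class_of intro: access_trans)
    have "A $ fst e $ snd e * v (snd e) \<le> alg_sum alg (\<lambda>j. A $ fst e $ j * v j) ?\<mu>"
      using A v(1) mem by (intro alg_sum_ge[where f = "\<lambda>j. A $ fst e $ j * v j"]) (auto simp: nonneg_matD less_imp_le)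
    then show "A $ fst e $ snd e * v (snd e) \<le> ?r * v (fst e)" using v(2) mem by simp
  qed (simp add: nonneg_matD[OF A])
  moreover have "0 < v u" using v(1) by simp
  ultimately show ?thesis by simp
qed

lemma cycle_mean_eq: "cycle_mean B p = root (length p) (walk_weight (entry B) p)"
  by (simp add: cycle_mean_def walk_weight_def)

text \<open>
  Rotating a critical cycle so that it starts with a given edge.
\<close>

lemma critical_edge_return:
  assumes "e \<in> critical_edges B"
  obtains p where "pcas (snd e) p (fst e)" "set p \<subseteq> critical_edges B" "mat_cycle B (e # p)"
    "cycle_mean B (e # p) = max_cycle_mean B"
proof -
  from assms obtain c where c: "mat_cycle B c" "cycle_mean B c = max_cycle_mean B" "e \<in> set c"
    by (auto simp: critical_edges_def)
  from c(3) obtain p1 p2 where sp: "c = p1 @ e # p2" by (meson split_list)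
  from c(1) obtain u where "pcas u c u" and nz: "\<forall>e\<in>set c. B $ fst e $ snd e \<noteq> 0" by (auto simp: mat_cycle_iff)
  then have w: "pcas (snd e) (p2 @ p1) (fst e)" by (auto simp: sp pcas_append)
  show thesis
  proof (rule that[OF w])
    show "set (p2 @ p1) \<subseteq> critical_edges B" using c by (auto simp: critical_edges_def sp)
    show "mat_cycle B (e # p2 @ p1)" using nz w by (auto simp: mat_cycle_iff sp)
    show "cycle_mean B (e # p2 @ p1) = max_cycle_mean B"
      unfolding c(2)[symmetric] by (simp add: cycle_mean_eq sp mult_ac add_ac)
  qed
qed

lemma critical_graph_simps [simp]:
  "verts (critical_graph B) = fst ` critical_edges B" "arcs (critical_graph B) = critical_edges B"
  "tail (critical_graph B) = fst" "head (critical_graph B) = snd"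
  by (simp_all add: critical_graph_def)

lemma critical_edge_head:
  assumes "e \<in> critical_edges B" shows "snd e \<in> fst ` critical_edges B"
proof -
  obtain p where p: "pcas (snd e) p (fst e)" "set p \<subseteq> critical_edges B"
    by (rule critical_edge_return[OF assms]) blast
  then show ?thesis using assms by (cases p) force+
qed

lemma fin_digraph_critical: "fin_digraph (critical_graph (B :: real ^ 'n ^ 'n))"
  by unfold_locales (auto intro: critical_edge_head finite_subset[of _ UNIV])

lemma reachable_critical:
  fixes B :: "real ^ 'n ^ 'n"
  assumes "pcas a p b" "set p \<subseteq> critical_edges B" "a \<in> fst ` critical_edges B"
  shows "a \<rightarrow>\<^sup>*\<^bsub>critical_graph B\<^esub> b"
proof -
  have "pre_digraph.awalk (critical_graph B) a p b"
    using assms by (auto simp: pre_digraph.awalk_def critical_graph_def cas_with_proj_eq)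
  then show ?thesis
    using wf_digraph.reachable_awalk[OF fin_digraph.axioms(1)[OF fin_digraph_critical]] by blast
qed

section \<open>Periods in max algebra\<close>

lemma access_matrix_nth:
  "access_matrix A \<rho> $ i $ j = (if i \<in> access_set A \<rho> \<and> j \<in> access_set A \<rho> then A $ i $ j / \<rho> else 0)"
  by (simp add: access_matrix_def divide_inverse mult.commute)

lemma access_set_perron_root_le:
  assumes "i \<in> access_set A \<rho>" shows "perron_root Max_Alg A (class_of A i) \<le> \<rho>"
proof -
  from assms obtain \<nu> \<mu> where \<nu>: "spectral_class Max_Alg A \<rho> \<nu>" "\<mu> \<in> classes A" "i \<in> \<mu>" "class_accesses A \<mu> \<nu>"
    unfolding access_set_def by blast
  moreover have "\<mu> = class_of A i" using \<nu> by (intro class_eq_class_of)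
  ultimately show ?thesis by auto
qed

lemma access_matrix_walk_weight:
  assumes "\<And>e. e \<in> set p \<Longrightarrow> fst e \<in> access_set A \<rho> \<and> snd e \<in> access_set A \<rho>"
  shows "walk_weight (entry (access_matrix A \<rho>)) p = walk_weight (entry A) p / \<rho> ^ length p"
  using assms by (induction p) (auto simp: access_matrix_nth)

text \<open>
  The class of a cycle of \<open>A\<^sub>\<rho>\<close> accesses a spectral class with root \<open>\<rho>\<close>, so its own root, and with it the
  geometric mean of the cycle in \<open>A\<close>, is at most \<open>\<rho>\<close>.
\<close>

lemma access_matrix_cycle_mean_le:
  fixes A :: "real ^ 'n ^ 'n"
  assumes A: "nonneg_mat A" and \<rho>: "0 < \<rho>" and p: "mat_cycle (access_matrix A \<rho>) p"
  shows "cycle_mean (access_matrix A \<rho>) p \<le> 1"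
proof -
  from p obtain u where u: "pcas u p u" "p \<noteq> []" "\<And>e. e \<in> set p \<Longrightarrow> access_matrix A \<rho> $ fst e $ snd e \<noteq> 0"
    by (auto simp: mat_cycle_iff)
  have mem: "fst e \<in> access_set A \<rho> \<and> snd e \<in> access_set A \<rho>" "A $ fst e $ snd e \<noteq> 0" if "e \<in> set p" for e
    using u(3)[OF that] by (auto simp: access_matrix_nth split: if_splits)
  have "u \<in> access_set A \<rho>" using u mem by (cases p) auto
  then have le: "perron_root Max_Alg A (class_of A u) \<le> \<rho>" by (rule access_set_perron_root_le)
  have "perron_root Max_Alg A (class_of A u) ^ length p \<le> \<rho> ^ length p" 
    using le perron_root_nonneg[OF A class_of_in_classes] by (intro power_mono)
  then have "walk_weight (entry A) p \<le> \<rho> ^ length p"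
    using cycle_weight_le_perron_root[OF A u(1) mem(2), of Max_Alg] by linarith
  then have "walk_weight (entry (access_matrix A \<rho>)) p \<le> 1"
    using \<rho> access_matrix_walk_weight[OF mem(1)] by simp
  then show ?thesis using u(2) by (simp add: cycle_mean_eq)
qed

locale max_orbit = periodic_orbit Max_Alg A \<rho> k f
  for A :: "real ^ 'n ^ 'n" and \<rho> k f
begin

lemma predecessor:
  assumes "0 < f t $ i"
  obtains j where "\<rho> * f t $ i = A $ i $ j * f (t - 1) $ j" "A $ i $ j \<noteq> 0" "0 < f (t - 1) $ j"
proof -
  have "\<rho> * f t $ i = Max (range (\<lambda>j. A $ i $ j * f (t - 1) $ j))"
    using arg_cong[OF step[of "t - 1"], of "\<lambda>x. x $ i"] by (simp add: mat_vec_nth)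
  also have "\<dots> \<in> range (\<lambda>j. A $ i $ j * f (t - 1) $ j)" by (rule Max_in) auto
  finally obtain j where j: "\<rho> * f t $ i = A $ i $ j * f (t - 1) $ j" by auto
  moreover have "A $ i $ j \<noteq> 0" "f (t - 1) $ j \<noteq> 0" using j assms rho by auto
  ultimately show thesis using that nonneg_nth[of "t - 1" j] by (simp add: less_le)
qed

text \<open>
  Follow the orbit back in time from \<open>i\<close>, always to a node that attains the maximum. Some node returns at
  the same time modulo \<open>k\<close>; between the two visits the walk closes up, and the product of its weights is
  a power of \<open>\<rho>\<close>, because the positive value of the orbit is the same at both visits.
\<close>

lemma tight_walk_to_cycle:
  assumes "0 < f t $ i"
  obtains q c p where "pcas i q c" "pcas c p c" "p \<noteq> []"
    "\<And>e. e \<in> set q \<union> set p \<Longrightarrow> A $ fst e $ snd e \<noteq> 0"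
    "\<rho> ^ length q * f t $ i = walk_weight (entry A) q * f (t - int (length q)) $ c"
    "walk_weight (entry A) p = \<rho> ^ length p" "0 < f (t - int (length q)) $ c"
proof -
  define nxt where "nxt s a = (SOME j. \<rho> * f s $ a = A $ a $ j * f (s - 1) $ j \<and> A $ a $ j \<noteq> 0 \<and> 0 < f (s - 1) $ j)" for s a
  have nxt: "\<rho> * f s $ a = A $ a $ nxt s a * f (s - 1) $ nxt s a \<and> A $ a $ nxt s a \<noteq> 0 \<and> 0 < f (s - 1) $ nxt s a"
    if "0 < f s $ a" for s a
    unfolding nxt_def by (rule someI_ex) (use predecessor[OF that] in metis)
  define g where "g = rec_nat i (\<lambda>m a. nxt (t - int m) a)"
  have g0: "g 0 = i" and gS: "g (Suc m) = nxt (t - int m) (g m)" for m by (simp_all add: g_def)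
  have pos: "0 < f (t - int m) $ g m" for m
  proof (induction m)
    case (Suc m)
    then show ?case using nxt[OF Suc] by (simp add: gS algebra_simps)
  qed (use assms g0 in simp)
  have edge: "\<rho> * f (t - int m) $ g m = A $ g m $ g (Suc m) * f (t - int (Suc m)) $ g (Suc m)"
    "A $ g m $ g (Suc m) \<noteq> 0" for m
    using nxt[OF pos[of m]] by (simp_all add: gS algebra_simps)
  define w where "w a b = map (\<lambda>m. (g m, g (Suc m))) [a..<b]" for a b
  have len: "length (w a b) = b - a" for a b by (simp add: w_def)
  have walk: "pcas (g a) (w a b) (g b) \<and> \<rho> ^ (b - a) * f (t - int a) $ g a
      = walk_weight (entry A) (w a b) * f (t - int b) $ g b" if "a \<le> b" for a b
    using that
  proof (induction rule: inc_induct)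
    case (step m)
    have wm: "w m b = (g m, g (Suc m)) # w (Suc m) b" using step.hyps by (simp add: w_def upt_conv_Cons)
    have "\<rho> ^ (b - m) * f (t - int m) $ g m = \<rho> ^ (b - Suc m) * (\<rho> * f (t - int m) $ g m)"
      using step.hyps by (simp flip: power_Suc2 add: Suc_diff_Suc mult.assoc[symmetric])
    also have "\<dots> = A $ g m $ g (Suc m) * (\<rho> ^ (b - Suc m) * f (t - int (Suc m)) $ g (Suc m))"
      unfolding edge(1) by simp
    finally show ?case using step.IH by (simp add: wm mult.assoc)
  qed (simp add: w_def)
  have nz: "A $ fst e $ snd e \<noteq> 0" if "e \<in> set (w a b)" for a b e
    using that edge(2) by (auto simp: w_def)
  have "\<not> inj (\<lambda>m. (g m, (t - int m) mod int k))"
  proof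
    assume "inj (\<lambda>m. (g m, (t - int m) mod int k))"
    then have "infinite (range (\<lambda>m. (g m, (t - int m) mod int k)))" by (rule range_inj_infinite)
    moreover have "range (\<lambda>m. (g m, (t - int m) mod int k)) \<subseteq> UNIV \<times> {0..<int k}" using k by auto
    ultimately show False by (meson finite_SigmaI finite finite_atLeastLessThan_int finite_subset)
  qed
  then obtain a b where ab: "a < b" "g a = g b" "(t - int a) mod int k = (t - int b) mod int k"
    by (metis (mono_tags, lifting) Pair_inject linorder_injI)
  have fab: "f (t - int b) $ g b = f (t - int a) $ g a" using ab by (metis period_mod)
  show thesis
  proof (rule that[of "w 0 a" "g a" "w a b"])
    show "walk_weight (entry A) (w a b) = \<rho> ^ length (w a b)"
      using walk[of a b] ab(1) pos[of a] unfolding fab len by simp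
    show "pcas (g a) (w a b) (g a)" using walk[of a b] ab by simp
    show "w a b \<noteq> []" using ab(1) by (simp add: w_def)
  qed (use walk[of 0 a] nz pos[of a] g0 in \<open>auto simp: len\<close>)
qed

text \<open>
  The class of such a cycle has root at least \<open>\<rho>\<close> because of the cycle, and all classes that access it have root
  at most \<open>\<rho>\<close> by comparison with the sum of the orbit. So it is spectral.
\<close>

lemma tight_cycle_access_set:
  assumes c: "pcas c p c" "p \<noteq> []" "\<And>e. e \<in> set p \<Longrightarrow> A $ fst e $ snd e \<noteq> 0"
    "walk_weight (entry A) p = \<rho> ^ length p" "0 < f s $ c" and j: "access A j c"
  shows "j \<in> access_set A \<rho>"
proof -
  have tc: "0 < orbit_sum $ c" using c(5) orbit_sum_pos_iff by blast
  have le: "perron_root Max_Alg A \<mu> \<le> \<rho>" if \<mu>: "\<mu> \<in> classes A" "class_accesses A \<mu> (class_of A c)" for \<mu>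
  proof -
    obtain i where i: "i \<in> \<mu>" using class_nonempty[OF \<mu>(1)] by blast
    then have "access A i c" using class_accesses_iff[OF \<mu>(1) class_of_in_classes i self_class_of] \<mu>(2) by simp
    then show ?thesis using accessing_perron_root_le[OF A nonneg_orbit_sum orbit_sum_eigen \<mu>(1) i] tc by blast
  qed
  have r0: "0 \<le> perron_root Max_Alg A (class_of A c)" by (rule perron_root_nonneg[OF A class_of_in_classes])
  have "\<rho> ^ length p \<le> perron_root Max_Alg A (class_of A c) ^ length p"
    using cycle_weight_le_perron_root[OF A c(1,3), of Max_Alg] c(4) by simp
  then have "\<rho> \<le> perron_root Max_Alg A (class_of A c)"
    using r0 c(2) rho by (simp add: power_mono_iff)
  moreover have "perron_root Max_Alg A (class_of A c) \<le> \<rho>"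
    by (rule le) (simp_all add: class_accesses_def)
  ultimately have "perron_root Max_Alg A (class_of A c) = \<rho>" by simp
  then have "spectral_class Max_Alg A \<rho> (class_of A c)" using rho le by simp
  moreover have "class_accesses A (class_of A j) (class_of A c)"
    using class_accesses_iff[OF class_of_in_classes class_of_in_classes self_class_of self_class_of] j by blast
  ultimately show ?thesis unfolding access_set_def using class_of_in_classes self_class_of by blast
qed

abbreviation B :: "real ^ 'n ^ 'n" where "B \<equiv> access_matrix A \<rho>"

lemma B_nonneg: "0 \<le> B $ i $ j"
  using A rho by (simp add: access_matrix_nth nonneg_matD)

lemma B_edge_le: "B $ i $ j * f t $ j \<le> f (t + 1) $ i"
  using edge_le[of i j t] rho by (simp add: access_matrix_nth nonneg_nth pos_divide_le_eq mult.commute)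

text \<open>
  Outside the access set the entries of \<open>A\<^sub>\<rho>\<close> are \<open>0\<close>, so the orbit of \<open>A\<close> satisfies the
  inequalities for \<open>A\<^sub>\<rho>\<close> at all nodes.
\<close>

lemma B_walk_le: "pcas a p b \<Longrightarrow> walk_weight (entry B) p * f t $ b \<le> f (t + int (length p)) $ a"
proof (induction p arbitrary: a)
  case (Cons e p)
  then have "B $ fst e $ snd e * (walk_weight (entry B) p * f t $ b)
      \<le> B $ fst e $ snd e * f (t + int (length p)) $ snd e"
    by (intro mult_left_mono B_nonneg) auto
  also have "\<dots> \<le> f (t + int (length p) + 1) $ fst e" by (rule B_edge_le)
  finally show ?case using Cons.prems by (simp add: mult.assoc add_ac)
qed simp

text \<open>
  The inequalities around a critical cycle through the edge compare the value at \<open>i\<close> with the value at \<open>i\<close> a cycle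
  length earlier. By periodicity of the orbit both are equal, so every inequality on the way is
  tight, in particular the one for the edge \<open>(i, j)\<close>.
\<close>

lemma critical_edge_relation:
  assumes mean: "max_cycle_mean B = 1" and e: "(i, j) \<in> critical_edges B"
  shows "f (t + 1) $ i = B $ i $ j * f t $ j"
proof -
  obtain p where p: "pcas j p i" "cycle_mean B ((i, j) # p) = 1"
    by (rule critical_edge_return[OF e]) (use mean in auto)
  then have w: "B $ i $ j * walk_weight (entry B) p = 1" by (simp add: cycle_mean_eq real_root_eq_1_iff)
  have ge: "f (t - int (length p)) $ i \<le> B $ i $ j * f t $ j" for t
  proof -
    have "B $ i $ j * (walk_weight (entry B) p * f (t - int (length p)) $ i) \<le> B $ i $ j * f t $ j"
      using B_walk_le[OF p(1), of "t - int (length p)"] by (intro mult_left_mono B_nonneg) simp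
    then show ?thesis using w by (simp flip: mult.assoc)
  qed
  have "f t $ i \<le> f (t + int (Suc (length p))) $ i" for t
    using ge[of "t + int (length p)"] B_edge_le[of i j "t + int (length p)"] by (simp add: add_ac)
  from shift_le_imp_eq[OF this, of "t - int (length p)"]
  have "f (t + 1) $ i = f (t - int (length p)) $ i" by (simp add: algebra_simps)
  with ge[of t] B_edge_le[of i j t] show ?thesis by simp
qed

lemma critical_node_period:
  assumes mean: "max_cycle_mean B = 1" and c: "c \<in> fst ` critical_edges B"
  shows "f (t + int (cyclicity (critical_graph B))) $ c = f t $ c"
proof (rule cyclicity_period[where f = "\<lambda>t i. f t $ i" and w = "entry B"])
  show "fin_digraph (critical_graph B)" by (rule fin_digraph_critical)
  show "\<exists>j. (v, j) \<in> arcs (critical_graph B) \<and> j \<rightarrow>\<^sup>*\<^bsub>critical_graph B\<^esub> v"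
    if "v \<in> verts (critical_graph B)" for v
  proof -
    from that obtain j where e: "(v, j) \<in> critical_edges B" by auto
    obtain p where p: "pcas j p v" "set p \<subseteq> critical_edges B"
      by (rule critical_edge_return[OF e]) auto
    have "j \<in> fst ` critical_edges B" using critical_edge_head[OF e] by simp
    from reachable_critical[OF p this] e show ?thesis by auto
  qed
  show "0 < B $ i $ j" if "(i, j) \<in> arcs (critical_graph B)" for i j
  proof -
    have "(i, j) \<in> critical_edges B" using that by simp
    then have "B $ i $ j \<noteq> 0" by (auto simp: critical_edges_def mat_cycle_iff)
    then show ?thesis using B_nonneg[of i j] by simp
  qed
qed (use critical_edge_relation[OF mean] k period c in auto)

text \<open>
  The tight walk from \<open>i\<close> to a critical node gives \<open>f t i\<close> exactly and bounds \<open>f (t + s) i\<close> from below; the two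
  values agree at the critical node, so \<open>f t \<le> f (t + s)\<close>, and periodicity forces equality.
\<close>

lemma orbit_period:
  assumes dvd: "sigma_rho Max_Alg A \<rho> dvd s"
  shows "f (t + int s) = f t"
proof -
  have "f t $ i \<le> f (t + int s) $ i" for t i
  proof (cases "0 < f t $ i")
    case False
    then show ?thesis using nonneg_nth[of t i] nonneg_nth[of "t + int s" i] by simp
  next
    case True
    obtain q c p where w: "pcas i q c" "pcas c p c" "p \<noteq> []"
      "\<And>e. e \<in> set q \<union> set p \<Longrightarrow> A $ fst e $ snd e \<noteq> 0"
      "\<rho> ^ length q * f t $ i = walk_weight (entry A) q * f (t - int (length q)) $ c"
      "walk_weight (entry A) p = \<rho> ^ length p" "0 < f (t - int (length q)) $ c"
      by (rule tight_walk_to_cycle[OF True]) blast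
    have nzq: "A $ fst e $ snd e \<noteq> 0" if "e \<in> set q" for e using w(4) that by blast
    have nzp: "A $ fst e $ snd e \<noteq> 0" if "e \<in> set p" for e using w(4) that by blast
    have mem: "j \<in> access_set A \<rho>" if "access A j c" for j
      by (rule tight_cycle_access_set[OF w(2,3) nzp w(6,7) that])
    have ends: "fst e \<in> access_set A \<rho> \<and> snd e \<in> access_set A \<rho>" if e: "e \<in> set q \<union> set p" for e
    proof -
      have "access A (snd e) c"
        using e walk_access(2)[OF w(1) nzq] walk_access(2)[OF w(2) nzp] by blast
      moreover from this have "access A (fst e) c" using access_edge[OF w(4)[OF e]] access_trans by blast
      ultimately show ?thesis using mem by blast
    qed
    have "walk_weight (entry B) p = walk_weight (entry A) p / \<rho> ^ length p"
      using ends by (intro access_matrix_walk_weight) blast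
    then have "walk_weight (entry B) p = 1" using w(6) rho by simp
    then have cm: "cycle_mean B p = 1" using w(3) by (simp add: cycle_mean_eq)
    have cyc: "mat_cycle B p"
      using w(2,3) ends nzp rho by (auto simp: mat_cycle_iff access_matrix_nth)
    have mean: "max_cycle_mean B = 1"
      unfolding max_cycle_mean_def
      by (rule Greatest_equality) (use cm cyc access_matrix_cycle_mean_le[OF A rho] in auto)
    have "hd p \<in> critical_edges B" "fst (hd p) = c"
      using w(2,3) cyc cm mean by (cases p; force simp: critical_edges_def)+
    then have crit: "c \<in> fst ` critical_edges B" by force
    obtain d where d: "s = cyclicity (critical_graph B) * d" using dvd by auto
    have per: "f (t + int s) $ c = f t $ c" for t
      unfolding d by (rule period_multiple[where h = "\<lambda>t. f t $ c"]) (rule critical_node_period[OF mean crit])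
    have wq: "walk_weight (entry B) q = walk_weight (entry A) q / \<rho> ^ length q"
      using ends by (intro access_matrix_walk_weight) blast
    have "f t $ i = walk_weight (entry B) q * f (t - int (length q)) $ c"
      unfolding wq using w(5) rho by (simp add: field_simps)
    also have "\<dots> = walk_weight (entry B) q * f (t - int (length q) + int s) $ c" by (simp add: per)
    also have "\<dots> \<le> f (t - int (length q) + int s + int (length q)) $ i" by (rule B_walk_le[OF w(1)])
    finally show ?thesis by (simp add: algebra_simps)
  qed
  then show ?thesis by (auto simp: vec_eq_iff intro: shift_le_imp_eq)
qed

end

section \<open>The core as a sum of eigencones\<close>

lemma eigencone_pow_period:
  fixes A :: "real ^ 'n ^ 'n"
  assumes A: "nonneg_mat A" and \<rho>: "0 < \<rho>" and k: "1 \<le> k" and s: "sigma_rho alg A \<rho> dvd s"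
  shows "eigencone alg (mat_pow alg A k) (\<rho> ^ k) \<subseteq> eigencone alg (mat_pow alg A s) (\<rho> ^ s)"
proof
  fix x assume "x \<in> eigencone alg (mat_pow alg A k) (\<rho> ^ k)"
  then have x: "nonneg_vec x" "(mat_vec alg A ^^ k) x = \<rho> ^ k *\<^sub>R x" using eigencone_pow_iff[OF A] by blast+
  obtain f where f: "periodic_orbit alg A \<rho> k f" "f 0 = x"
    using periodic_orbit_exists[OF A \<rho> _ x] k by auto
  have "f (0 + int s) = f 0"
  proof (cases alg)
    case Nonneg_Alg
    then have "nonneg_orbit A \<rho> k f" using f(1) by (simp add: nonneg_orbit_def)
    then show ?thesis using s unfolding Nonneg_Alg by (rule nonneg_orbit.orbit_period)
  next
    case Max_Alg
    then have "max_orbit A \<rho> k f" using f(1) by (simp add: max_orbit_def)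
    then show ?thesis using s unfolding Max_Alg by (rule max_orbit.orbit_period)
  qed
  then have "(mat_vec alg A ^^ s) x = \<rho> ^ s *\<^sub>R x"
    using periodic_orbit.funpow_orbit[OF f(1), of s 0] f(2) by simp
  then show "x \<in> eigencone alg (mat_pow alg A s) (\<rho> ^ s)" using x eigencone_pow_iff[OF A] by blast
qed

lemma sigma_Lambda_pos:
  fixes A :: "real ^ 'n ^ 'n"
  assumes A: "nonneg_mat A" shows "0 < sigma_Lambda alg A"
proof -
  have "sigma_rho alg A \<rho> \<noteq> 0" for \<rho>
  proof (cases alg)
    case Nonneg_Alg
    have "finite {cyclicity (mat_digraph_on \<nu> A) | \<nu>. spectral_class Nonneg_Alg A \<rho> \<nu>}"
      by (rule finite_subset[of _ "range (\<lambda>\<nu>. cyclicity (mat_digraph_on \<nu> A))"]) auto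
    moreover have "0 \<notin> {cyclicity (mat_digraph_on \<nu> A) | \<nu>. spectral_class Nonneg_Alg A \<rho> \<nu>}"
    proof
      assume "0 \<in> {cyclicity (mat_digraph_on \<nu> A) | \<nu>. spectral_class Nonneg_Alg A \<rho> \<nu>}"
      then obtain \<nu> where "0 = cyclicity (mat_digraph_on \<nu> A)" by blast
      then show False using cyclicity_nz[OF fin_digraph_mat, of \<nu> A] by simp
    qed
    ultimately show ?thesis unfolding Nonneg_Alg sigma_rho.simps by (simp only: Lcm_0_iff_nat not_False_eq_True)
  next
    case Max_Alg
    then show ?thesis using cyclicity_nz[OF fin_digraph_critical] by simp
  qed
  then show ?thesis
    unfolding sigma_Lambda_def using finite_Lambda[OF A] by (auto simp: Lcm_0_iff_nat neq0_conv[symmetric] simp del: neq0_conv)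
qed

theorem theorem1:
  fixes alg :: algebra_kind and A :: "real ^ 'n ^ 'n"
  assumes "nonneg_mat A"
  shows "core alg A
           = cone_sum alg ({1..} \<times> Lambda alg A) (\<lambda>(k, \<rho>). eigencone alg (mat_pow alg A k) (\<rho> ^ k))
       \<and> cone_sum alg ({1..} \<times> Lambda alg A) (\<lambda>(k, \<rho>). eigencone alg (mat_pow alg A k) (\<rho> ^ k))
           = eigencone_sum alg (mat_pow alg A (sigma_Lambda alg A))"
proof -
  let ?C = "\<lambda>(k, \<rho>). eigencone alg (mat_pow alg A k) (\<rho> ^ k)"
  let ?s = "sigma_Lambda alg A"
  have pos: "0 < \<rho>" if "\<rho> \<in> Lambda alg A" for \<rho> using that by (auto simp: Lambda_def eigenvalue_def)
  have "cone_sum alg ({1..} \<times> Lambda alg A) ?C \<subseteq> core alg A"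
  proof (rule cone_sum_subset_core[OF assms])
    fix z :: "nat \<times> real" assume "z \<in> {1..} \<times> Lambda alg A"
    then show "?C z \<subseteq> core alg A"
      using eigencone_pow_subset_core[OF assms, of "fst z" "snd z ^ fst z" alg] pos[of "snd z"] by auto
  qed
  then have "core alg A = cone_sum alg ({1..} \<times> Lambda alg A) ?C"
    using core_subset_cone_sum[OF assms] by blast
  moreover have "cone_sum alg ({1..} \<times> Lambda alg A) ?C \<subseteq> eigencone_sum alg (mat_pow alg A ?s)"
    unfolding eigencone_sum_def
  proof (intro cone_sum_mono UN_least)
    fix z :: "nat \<times> real" assume "z \<in> {1..} \<times> Lambda alg A"
    then obtain k \<rho> where z: "z = (k, \<rho>)" "1 \<le> k" "\<rho> \<in> Lambda alg A" by auto
    have "sigma_rho alg A \<rho> dvd ?s" unfolding sigma_Lambda_def using z(3) by (intro dvd_Lcm) blast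
    then have "?C z \<subseteq> eigencone alg (mat_pow alg A ?s) (\<rho> ^ ?s)"
      using eigencone_pow_period[OF assms pos[OF z(3)] z(2)] z(1) by simp
    also have "\<dots> \<subseteq> (\<Union>r\<in>Lambda alg (mat_pow alg A ?s). eigencone alg (mat_pow alg A ?s) r)"
      using Lambda_pow[OF assms z(3)] by blast
    finally show "?C z \<subseteq> (\<Union>r\<in>Lambda alg (mat_pow alg A ?s). eigencone alg (mat_pow alg A ?s) r)" .
  qed
  moreover have "eigencone_sum alg (mat_pow alg A ?s) \<subseteq> cone_sum alg ({1..} \<times> Lambda alg A) ?C"
    unfolding eigencone_sum_def
  proof (intro cone_sum_mono UN_least)
    fix r assume "r \<in> Lambda alg (mat_pow alg A ?s)"
    then obtain \<rho> where \<rho>: "\<rho> \<in> Lambda alg A" "r = \<rho> ^ ?s"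
      using Lambda_pow_root[OF assms sigma_Lambda_pos[OF assms]] by blast
    then have "(?s, \<rho>) \<in> {1..} \<times> Lambda alg A" using sigma_Lambda_pos[OF assms, of alg] by simp
    then show "eigencone alg (mat_pow alg A ?s) r \<subseteq> (\<Union>z\<in>{1..} \<times> Lambda alg A. ?C z)"
      unfolding \<rho>(2) by force
  qed
  ultimately show ?thesis by blast
qed

end
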